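(* Let $K=\mathbb Q(\sqrt{-19})$. Up to conjugation in $\operatorname{GL}_3(K)$, the finite subgroups of $\operatorname{GL}_3(K)$ that are not conjugate in $\operatorname{GL}_3(K)$ to a subgroup of $\operatorname{GL}_3(\mathbb Q)$ form exactly $8$ conjugacy classes, and their isomorphism types, with multiplicity, are $$Q_8,\ Q_8,\ C_3\rtimes C_4,\ C_3\rtimes C_4,\ C_2\times Q_8,\ C_2\times(C_3\rtimes C_4),\ \operatorname{SL}(2,3),\ C_2\times\operatorname{SL}(2,3).$$
   Context: $C_m$ is the cyclic group of order $m$; $Q_8$ is the quaternion group of order $8$; $C_3\rtimes C_4$ is the nonabelian semidirect product of order $12$ in which a generator of $C_4$ acts on $C_3$ by inversion; $\operatorname{SL}(2,3)=\operatorname{SL}_2(\mathbb F_3)$. *)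

theory Defs
  imports "HOL-Analysis.Analysis" "HOL-Algebra.Elementary_Groups"
begin

subsection \<open>Quadratic fields and general linear groups over subfields\<close>

definition quadratic_field :: "int \<Rightarrow> complex set" where
  "quadratic_field d = {of_rat a + of_rat b * csqrt (of_int d) | a b. True}"

definition mat_monoid :: "'a::semiring_1 set \<Rightarrow> ('a^'n^'n) monoid" where
  "mat_monoid F = \<lparr>carrier = {A. \<forall>i j. A $ i $ j \<in> F}, monoid.mult = (**), one = mat 1\<rparr>"

text \<open>The inverse is required to have entries in \<open>F\<close> as well. Hence, for a subfield \<open>E\<close> of \<open>F\<close>,
  \<open>carrier (GL E) \<subseteq> carrier (GL F)\<close>, with the same multiplication.\<close>

definition GL :: "'a::semiring_1 set \<Rightarrow> ('a^'n^'n) monoid" where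
  "GL F = units_of (mat_monoid F)"

lemma quadratic_field_closed:
  assumes "x \<in> quadratic_field d" "y \<in> quadratic_field d"
  shows "x + y \<in> quadratic_field d" "- x \<in> quadratic_field d" "x * y \<in> quadratic_field d"
    "inverse x \<in> quadratic_field d" "of_rat q \<in> quadratic_field d" "csqrt (of_int d) \<in> quadratic_field d"
proof -
  define s where "s = csqrt (of_int d)"
  have s2: "s * s = of_rat (of_int d)"
    using power2_csqrt[of "of_int d"] by (simp add: s_def power2_eq_square)
  have I: "z \<in> quadratic_field d" if "z = of_rat a + of_rat b * s" for z a b
    using that by (auto simp: quadratic_field_def s_def)
  obtain a b where x: "x = of_rat a + of_rat b * s"
    using assms(1) by (auto simp: quadratic_field_def s_def)
  obtain a' b' where y: "y = of_rat a' + of_rat b' * s"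
    using assms(2) by (auto simp: quadratic_field_def s_def)
  show "x + y \<in> quadratic_field d"
    by (rule I[of _ "a + a'" "b + b'"]) (simp add: x y of_rat_add algebra_simps)
  show "- x \<in> quadratic_field d"
    by (rule I[of _ "- a" "- b"]) (simp add: x of_rat_minus)
  have "x * y = of_rat a * of_rat a' + of_rat b * of_rat b' * (s * s)
      + (of_rat a * of_rat b' + of_rat b * of_rat a') * s"
    by (simp add: x y algebra_simps)
  then show "x * y \<in> quadratic_field d"
    by (intro I[of _ "a * a' + b * b' * of_int d" "a * b' + b * a'"])
       (simp only: s2 of_rat_add of_rat_mult)
  show "of_rat q \<in> quadratic_field d"
    by (rule I[of _ q 0]) simp
  show "csqrt (of_int d) \<in> quadratic_field d"
    by (rule I[of _ 0 1]) (simp add: s_def)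
  show "inverse x \<in> quadratic_field d"
  proof (cases "of_rat a - of_rat b * s = 0")
    case True
    then have "x = of_rat (2 * a)"
      by (simp add: x of_rat_mult)
    then show ?thesis
      by (intro I[of _ "inverse (2 * a)" 0]) (simp only: of_rat_inverse of_rat_0 mult_zero_left add_0_right)
  next
    case False
    define n where "n = a * a - b * b * of_int d"
    have n: "x * (of_rat a - of_rat b * s) = of_rat n"
    proof -
      have "x * (of_rat a - of_rat b * s) = of_rat a * of_rat a - of_rat b * of_rat b * (s * s)"
        by (simp add: x algebra_simps)
      then show ?thesis
        by (simp only: s2 n_def of_rat_diff of_rat_mult)
    qed
    have "inverse x = (of_rat a - of_rat b * s) / of_rat n"
      unfolding n[symmetric] using False by (simp add: divide_inverse)
    then show ?thesis
      by (intro I[of _ "a / n" "- (b / n)"])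
         (simp add: of_rat_divide of_rat_minus diff_divide_distrib)
  qed
qed

lemma monoid_mat_monoid:
  assumes "0 \<in> F" "1 \<in> F" "\<And>x y. x \<in> F \<Longrightarrow> y \<in> F \<Longrightarrow> x + y \<in> F"
    "\<And>x y. x \<in> F \<Longrightarrow> y \<in> F \<Longrightarrow> x * y \<in> F"
  shows "monoid (mat_monoid F :: ('a::semiring_1^'n^'n) monoid)"
proof -
  have "sum f A \<in> F" if "\<And>i. i \<in> A \<Longrightarrow> f i \<in> F" for f :: "'n \<Rightarrow> 'a" and A
    using that by (induction A rule: infinite_finite_induct) (auto intro: assms)
  then have "A ** B \<in> carrier (mat_monoid F)"
    if "A \<in> carrier (mat_monoid F)" "B \<in> carrier (mat_monoid F)" for A B :: "'a^'n^'n"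
    using that assms by (simp add: mat_monoid_def matrix_matrix_mult_def)
  moreover have "(mat 1 :: 'a^'n^'n) \<in> carrier (mat_monoid F)"
    using assms by (simp add: mat_monoid_def mat_def)
  ultimately show ?thesis
    by unfold_locales (simp_all add: mat_monoid_def matrix_mul_assoc)
qed

lemma group_GL_quadratic_field: "group (GL (quadratic_field d))"
  unfolding GL_def
proof (intro monoid.units_group monoid_mat_monoid)
  have 0: "0 \<in> quadratic_field d"
    unfolding quadratic_field_def by (rule CollectI, intro exI[of _ 0]) simp
  show "0 \<in> quadratic_field d" "1 \<in> quadratic_field d"
    using 0 quadratic_field_closed(5)[OF 0 0, of 1] by simp_all
qed (auto intro: quadratic_field_closed)


subsection \<open>Conjugacy of subgroups\<close>

definition conjugate_in :: "('a, 'b) monoid_scheme \<Rightarrow> 'a set \<Rightarrow> 'a set \<Rightarrow> bool" where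
  "conjugate_in G H H' \<longleftrightarrow> (\<exists>g\<in>carrier G. H' = g <#\<^bsub>G\<^esub> (H #>\<^bsub>G\<^esub> inv\<^bsub>G\<^esub> g))"

definition conjugacy_classes_in ::
    "('a, 'b) monoid_scheme \<Rightarrow> 'a set set \<Rightarrow> 'a set set set" where
  "conjugacy_classes_in G S = S // {(H, H'). H \<in> S \<and> H' \<in> S \<and> conjugate_in G H H'}"

definition finite_subgroups_not_over_Q :: "complex set \<Rightarrow> (complex^'n^'n) set set" where
  "finite_subgroups_not_over_Q F =
     {H. subgroup H (GL F) \<and> finite H \<and>
         \<not> (\<exists>H'. subgroup H' (GL \<rat>) \<and> conjugate_in (GL F) H H')}"


subsection \<open>The model groups\<close>

text \<open>A quadruple \<open>(a, b, c, d)\<close> stands for the quaternion \<open>a + b i + c j + d k\<close>.\<close>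

type_synonym int_quaternion = "int \<times> int \<times> int \<times> int"

fun quaternion_mult :: "int_quaternion \<Rightarrow> int_quaternion \<Rightarrow> int_quaternion" where
  "quaternion_mult (a, b, c, d) (a', b', c', d') =
     (a * a' - b * b' - c * c' - d * d',
      a * b' + b * a' + c * d' - d * c',
      a * c' - b * d' + c * a' + d * b',
      a * d' + b * c' - c * b' + d * a')"

definition Q8 :: "int_quaternion monoid" where
  "Q8 = \<lparr>carrier = {(1,0,0,0), (-1,0,0,0), (0,1,0,0), (0,-1,0,0),
                    (0,0,1,0), (0,0,-1,0), (0,0,0,1), (0,0,0,-1)},
         monoid.mult = quaternion_mult, one = (1,0,0,0)\<rparr>"

definition semidirect_prod ::
    "('a, 'c) monoid_scheme \<Rightarrow> ('b, 'd) monoid_scheme \<Rightarrow> ('b \<Rightarrow> 'a \<Rightarrow> 'a) \<Rightarrow> ('a \<times> 'b) monoid" where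
  "semidirect_prod N H \<phi> =
     \<lparr>carrier = carrier N \<times> carrier H,
      monoid.mult = (\<lambda>(n, h) (n', h'). (n \<otimes>\<^bsub>N\<^esub> \<phi> h n', h \<otimes>\<^bsub>H\<^esub> h')),
      one = (\<one>\<^bsub>N\<^esub>, \<one>\<^bsub>H\<^esub>)\<rparr>"

definition C3_sdp_C4 :: "(int \<times> int) monoid" where
  "C3_sdp_C4 = semidirect_prod (integer_mod_group 3) (integer_mod_group 4)
     (\<lambda>h n. if even h then n else inv\<^bsub>integer_mod_group 3\<^esub> n)"

text \<open>The numeral type \<open>3\<close> is the ring of integers modulo 3, that is, the field with three elements.\<close>

definition SL_2_3 :: "(3^2^2) monoid" where
  "SL_2_3 = \<lparr>carrier = {A. det A = 1}, monoid.mult = (**), one = mat 1\<rparr>"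

lemma quaternion_mult_assoc:
  "quaternion_mult (quaternion_mult x y) z = quaternion_mult x (quaternion_mult y z)"
  by (cases x; cases y; cases z) (simp add: algebra_simps)

lemma group_Q8: "group Q8"
proof (rule groupI)
  fix x y assume "x \<in> carrier Q8" "y \<in> carrier Q8"
  then show "x \<otimes>\<^bsub>Q8\<^esub> y \<in> carrier Q8"
    by (auto simp: Q8_def)
next
  fix x assume "x \<in> carrier Q8"
  then show "\<exists>y\<in>carrier Q8. y \<otimes>\<^bsub>Q8\<^esub> x = \<one>\<^bsub>Q8\<^esub>"
    by (auto simp: Q8_def)
qed (auto simp: Q8_def quaternion_mult_assoc)

lemma group_semidirect_prod:
  assumes "group N" "group H"
    and hom: "\<And>h. h \<in> carrier H \<Longrightarrow> \<phi> h \<in> hom N N"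
    and one: "\<And>n. n \<in> carrier N \<Longrightarrow> \<phi> \<one>\<^bsub>H\<^esub> n = n"
    and mult: "\<And>h h' n. h \<in> carrier H \<Longrightarrow> h' \<in> carrier H \<Longrightarrow> n \<in> carrier N \<Longrightarrow>
      \<phi> (h \<otimes>\<^bsub>H\<^esub> h') n = \<phi> h (\<phi> h' n)"
  shows "group (semidirect_prod N H \<phi>)"
proof -
  interpret N: group N by fact
  interpret H: group H by fact
  have closed: "\<phi> h n \<in> carrier N" if "h \<in> carrier H" "n \<in> carrier N" for h n
    using hom[OF that(1)] that(2) by (auto simp: hom_def)
  have hom': "\<phi> h (n \<otimes>\<^bsub>N\<^esub> n') = \<phi> h n \<otimes>\<^bsub>N\<^esub> \<phi> h n'"
    if "h \<in> carrier H" "n \<in> carrier N" "n' \<in> carrier N" for h n n'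
    using hom[OF that(1)] that by (auto simp: hom_def)
  show ?thesis
  proof (rule groupI)
    fix x assume x: "x \<in> carrier (semidirect_prod N H \<phi>)"
    obtain n h where "x = (n, h)" "n \<in> carrier N" "h \<in> carrier H"
      using x by (auto simp: semidirect_prod_def)
    then show "\<exists>y\<in>carrier (semidirect_prod N H \<phi>).
        y \<otimes>\<^bsub>semidirect_prod N H \<phi>\<^esub> x = \<one>\<^bsub>semidirect_prod N H \<phi>\<^esub>"
      by (intro bexI[of _ "(inv\<^bsub>N\<^esub> \<phi> (inv\<^bsub>H\<^esub> h) n, inv\<^bsub>H\<^esub> h)"])
         (simp_all add: semidirect_prod_def closed)
  qed (auto simp: semidirect_prod_def closed hom' one mult N.m_assoc H.m_assoc)
qed

lemma group_C3_sdp_C4: "group C3_sdp_C4"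
proof -
  interpret N: comm_group "integer_mod_group 3" by simp
  have even_mod: "even (k mod 4) \<longleftrightarrow> even k" for k :: int
    by presburger
  show ?thesis
    unfolding C3_sdp_C4_def
  proof (rule group_semidirect_prod)
    fix h assume "h \<in> carrier (integer_mod_group 4)"
    have "(\<lambda>n. inv\<^bsub>integer_mod_group 3\<^esub> n) \<in> hom (integer_mod_group 3) (integer_mod_group 3)"
      by (intro homI N.inv_closed N.inv_mult)
    then show "(\<lambda>n. if even h then n else inv\<^bsub>integer_mod_group 3\<^esub> n)
        \<in> hom (integer_mod_group 3) (integer_mod_group 3)"
      by (cases "even h") (simp_all add: hom_def del: inv_integer_mod_group)
  next
    fix h h' n assume "n \<in> carrier (integer_mod_group 3)"
    then show "(if even (h \<otimes>\<^bsub>integer_mod_group 4\<^esub> h') then n else inv\<^bsub>integer_mod_group 3\<^esub> n) =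
        (if even h then if even h' then n else inv\<^bsub>integer_mod_group 3\<^esub> n
         else inv\<^bsub>integer_mod_group 3\<^esub> (if even h' then n else inv\<^bsub>integer_mod_group 3\<^esub> n))"
      using N.inv_inv[of n] by (simp add: even_mod del: inv_integer_mod_group)
  qed simp_all
qed

lemma group_SL_2_3: "group SL_2_3"
proof (rule groupI)
  fix A assume "A \<in> carrier SL_2_3"
  then have A: "A $ 1 $ 1 * A $ 2 $ 2 - A $ 1 $ 2 * A $ 2 $ 1 = 1"
    by (simp add: SL_2_3_def det_2)
  define B :: "3^2^2" where
    "B = vector [vector [A $ 2 $ 2, - A $ 1 $ 2], vector [- A $ 2 $ 1, A $ 1 $ 1]]"
  have "B ** A = mat 1" "det B = 1"
    using A by (auto simp: B_def vec_eq_iff forall_2 matrix_matrix_mult_def sum_2 mat_def det_2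
        algebra_simps)
  then show "\<exists>B\<in>carrier SL_2_3. B \<otimes>\<^bsub>SL_2_3\<^esub> A = \<one>\<^bsub>SL_2_3\<^esub>"
    by (auto simp: SL_2_3_def)
qed (auto simp: SL_2_3_def det_mul matrix_mul_assoc)

end

theory Submission
  imports Defs "HOL-Number_Theory.Cong" "HOL-Computational_Algebra.Fundamental_Theorem_Algebra"
begin

text \<open>
  Let \<open>G\<close> be a finite subgroup of \<open>GL\<^sub>3(K)\<close>. The trace of an element is an integer of \<open>K\<close> of absolute value at most \<open>3\<close>
  and so is the trace of its square, which forces all traces to be rational. Hence every \<open>g \<noteq> \<plusminus>1\<close> in \<open>G\<close> has
  \<open>det g = \<plusminus>1\<close> as a simple eigenvalue, and the projection to the eigenline \<open>L\<close> lies in the rational group algebra.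
  If \<open>G\<close> moves \<open>L\<close>, the matrix coefficients with respect to the orbit of an eigenvector are rational, and \<open>G\<close> is
  conjugate to a rational group. Otherwise \<open>G\<close> consists of matrices \<open>diag(\<plusminus>1, M)\<close> for an invariant Hermitian form, and
  \<open>det M = 1\<close> because a second common eigenvector would make \<open>G\<close> diagonal. Integrality of the traces of the \<open>M\<close>
  shows that they form a cyclic group (and \<open>G\<close> is rational), or contain \<open>a\<close>, \<open>b\<close> with \<open>tr a \<in> {0, -1}\<close> and
  \<open>tr b = tr (a b) = 0\<close>. Since \<open>p\<^sup>2 + u p q + q\<^sup>2 = -1\<close> with \<open>u = tr a\<close> is solvable in \<open>K\<close>, such a pair has a unique
  normal form, and the trace coordinates with respect to \<open>1, a, b, a b\<close> leave only \<open>Q\<^sub>8\<close>, \<open>SL(2,3)\<close> and the dicyclic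
  group of order \<open>12\<close> for the set of all \<open>M\<close>. The eight groups are distinguished by their order and by
  whether all determinants are \<open>1\<close>; they are not rational because a rational group has a nondegenerate
  invariant symmetric bilinear form.
\<close>

text \<open>What makes a group nonrational is not its character, which turns out rational, but a
  Schur index: the rational span of the matrices M is a definite quaternion algebra, ramified at 2
  for the quaternion group and SL(2,3), and at 3 for the dicyclic group. Both 2 and 3 are inert in
  K, so K splits the two algebras, which is why both norm equations have solutions. On the other
  hand K contains no square root of -1 or -3, so a matrix a of determinant 1 and trace 0 or +-1 has
  no eigenvector over K, and any nonzero w gives a basis w, a w. The odd degree supplies the
  rational eigenvalue: three eigenvalues of absolute value 1 with product +-1 and rational symmetric
  functions are the roots of a cubic that is self-reciprocal up to sign. The Hermitian form stands
  in for complete reducibility. Its values need not be squares in K, so orthogonal bases are left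
  unnormalized, and what invariance still yields for entries is that a matrix and its inverse have
  transposed zero patterns.\<close>

section \<open>Integrality of rational sums of roots of unity\<close>

text \<open>Gaussian elimination: the coefficient matrix is the identity modulo \<open>b\<close>, and this persists when
  one unknown is eliminated.\<close>

lemma zero_if_identity_mod:
  fixes f :: "'a \<Rightarrow> complex" and m :: "'a \<Rightarrow> 'a \<Rightarrow> int" and b :: int
  assumes "finite V" "b > 1"
    and "\<And>v. v \<in> V \<Longrightarrow> (\<Sum>w\<in>V. of_int (m v w) * f w) = 0"
    and "\<And>v w. v \<in> V \<Longrightarrow> w \<in> V \<Longrightarrow> [m v w = (if v = w then 1 else 0)] (mod b)"
    and "v \<in> V"
  shows "f v = 0"
  using assms(1,3-)
proof (induction V arbitrary: m v rule: finite_induct)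
  case (insert x V)
  have mxx: "[m x x = 1] (mod b)"
    using insert.prems(2)[of x x] by simp
  have mxx0: "m x x \<noteq> 0"
    using mxx \<open>b > 1\<close> by (auto simp: cong_def)
  define m' where "m' v w = m x x * m v w - m v x * m x w" for v w
  have f0: "f v = 0" if "v \<in> V" for v
  proof (rule insert.IH[of m'])
    fix v assume v: "v \<in> V"
    have 1: "of_int (m v x) * f x + (\<Sum>w\<in>V. of_int (m v w) * f w) = 0"
      using insert.prems(1)[of v] v insert.hyps by simp
    have 2: "of_int (m x x) * f x + (\<Sum>w\<in>V. of_int (m x w) * f w) = 0"
      using insert.prems(1)[of x] insert.hyps by simp
    have "(\<Sum>w\<in>V. of_int (m' v w) * f w) = of_int (m x x) * (\<Sum>w\<in>V. of_int (m v w) * f w)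
        - of_int (m v x) * (\<Sum>w\<in>V. of_int (m x w) * f w)"
      by (simp add: m'_def sum_distrib_left sum_subtractf algebra_simps)
    also have "\<dots> = 0"
      using 1 2 by (simp add: add_eq_0_iff algebra_simps)
    finally show "(\<Sum>w\<in>V. of_int (m' v w) * f w) = 0" .
  next
    fix v w assume vw: "v \<in> V" "w \<in> V"
    have "[m x x * m v w - m v x * m x w = 1 * (if v = w then 1 else 0) - 0 * 0] (mod b)"
      using insert.prems(2)[of v w] insert.prems(2)[of v x] insert.prems(2)[of x w] vw insert.hyps
      by (intro cong_diff cong_mult mxx) (auto split: if_splits)
    then show "[m' v w = (if v = w then 1 else 0)] (mod b)"
      by (simp add: m'_def)
  qed (fact that)
  have "of_int (m x x) * f x + (\<Sum>w\<in>V. of_int (m x w) * f w) = 0"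
    using insert.prems(1)[of x] insert.hyps by simp
  moreover have "(\<Sum>w\<in>V. of_int (m x w) * f w) = 0"
    by (intro sum.neutral) (simp add: f0)
  ultimately have "f x = 0"
    using mxx0 by simp
  then show ?case
    using insert.prems(3) f0 by auto
qed simp

text \<open>Multiplication by the sum sends each \<open>n\<close>-th root of unity to an integer
  combination of such roots. If the sum were a/b in lowest terms with b > 1, a Bezout relation x a +
  y b = 1 would turn this into a linear system for the roots that is the identity modulo b, and the
  root 1 would have to vanish.\<close>

lemma rational_sum_of_roots_of_unity:
  fixes xs :: "complex list"
  assumes n: "n > 0" and xs: "\<And>x. x \<in> set xs \<Longrightarrow> x ^ n = 1" and rat: "sum_list xs \<in> \<rat>"
  shows "sum_list xs \<in> \<int>"
proof -
  obtain q where q: "sum_list xs = of_rat q"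
    using rat by (auto elim: Rats_cases)
  obtain a b where ab: "quotient_of q = (a, b)"
    by force
  have b0: "b > 0" and cop: "coprime a b" and qab: "q = of_int a / of_int b"
    using quotient_of_denom_pos[OF ab] quotient_of_coprime[OF ab] quotient_of_div[OF ab] by auto
  have r: "of_int b * sum_list xs = (of_int a :: complex)"
    using b0 by (simp add: q qab of_rat_divide)
  have "\<not> b > 1"
  proof
    assume b1: "b > 1"
    obtain x y where xy: "x * a + y * b = 1"
      using cop by (metis bezout_int coprime_imp_gcd_eq_1)
    define V where "V = {z :: complex. z ^ n = 1}"
    have finV: "finite V"
      unfolding V_def using n by (intro finite_roots_unity) auto
    \<comment> \<open>Row \<open>v\<close> encodes v - (x a + y b) v = 0, where a v is replaced by b
      times the sum of the products of v with the members of \<open>xs\<close>.\<close>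
    define m where "m v w = (if v = w then 1 else 0)
      - b * (x * int (count_list (map ((*) v) xs) w) + y * (if v = w then 1 else 0))" for v w :: complex
    have "id (1::complex) = 0"
    proof (rule zero_if_identity_mod[of V b m id])
      fix v assume v: "v \<in> V"
      have 1: "sum_list xs * v = (\<Sum>w\<in>V. of_nat (count_list (map ((*) v) xs) w) * w)"
      proof -
        have sub: "set (map ((*) v) xs) \<subseteq> V"
          using v xs by (auto simp: V_def power_mult_distrib)
        have "sum_list xs * v = sum_list (map ((*) v) xs)"
          by (simp add: sum_list_const_mult mult.commute)
        also have "\<dots> = (\<Sum>w\<in>V. of_nat (count_list (map ((*) v) xs) w) * w)"
          using sub finV
        proof (induction "map ((*) v) xs" arbitrary: xs)
          case (Cons z zs)
          then obtain x0 xs0 where xs0: "xs = x0 # xs0" "z = v * x0" "zs = map ((*) v) xs0"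
            by auto
          have zV: "z \<in> V" using Cons.prems xs0 by auto
          have IH: "sum_list (map ((*) v) xs0) = (\<Sum>w\<in>V. of_nat (count_list (map ((*) v) xs0) w) * w)"
            by (rule Cons.hyps(1)) (use Cons.prems xs0 in auto)
          have "(\<Sum>w\<in>V. of_nat (count_list (z # zs) w) * w)
            = (\<Sum>w\<in>V. of_nat (count_list zs w) * w + (if w = z then z else 0))"
            by (intro sum.cong) (auto simp: algebra_simps)
          also have "\<dots> = (\<Sum>w\<in>V. of_nat (count_list zs w) * w) + z"
            using finV zV by (simp add: sum.distrib)
          finally show ?case
            using IH xs0 by (simp add: add.commute)
        qed simp
        finally show ?thesis .
      qed
      have "(\<Sum>w\<in>V. of_int (m v w) * id w) =
          (\<Sum>w\<in>V. (if v = w then v - of_int (b * y) * v else 0)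
             - of_int (b * x) * (of_nat (count_list (map ((*) v) xs) w) * w))"
        by (intro sum.cong) (auto simp: m_def algebra_simps)
      also have "\<dots> = v - of_int (b * y) * v - of_int (b * x) * (sum_list xs * v)"
        using finV v by (simp add: sum_subtractf sum_distrib_left[symmetric] 1)
      also have "\<dots> = v - of_int (b * y) * v - of_int x * (of_int b * sum_list xs) * v"
        by (simp add: algebra_simps)
      also have "\<dots> = v - of_int (x * a + y * b) * v"
        by (simp only: r) (simp add: algebra_simps)
      also have "\<dots> = 0" by (simp add: xy)
      finally show "(\<Sum>w\<in>V. of_int (m v w) * id w) = 0" .
    next
      fix v w
      show "[m v w = (if v = w then 1 else 0)] (mod b)"
        by (simp add: m_def cong_iff_dvd_diff)
    qed (use finV b1 in \<open>auto simp: V_def\<close>)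
    then show False by simp
  qed
  then have "b = 1" using b0 by simp
  then show ?thesis
    using r by simp
qed

section \<open>The field\<close>

abbreviation (input) KK :: "complex set" where "KK \<equiv> quadratic_field (-19)"

definition sq19 :: complex where "sq19 = csqrt (of_int (-19))"

lemma sq19: "sq19 = \<i> * sqrt 19"
  using csqrt_of_real_nonpos[of "-19"] by (simp add: sq19_def)

lemma sq19_sq: "sq19 * sq19 = -19"
  by (simp add: sq19 complex_eq_iff)

lemma KK_iff: "z \<in> KK \<longleftrightarrow> (\<exists>a b. z = of_rat a + of_rat b * sq19)"
  by (simp add: quadratic_field_def sq19_def)

lemma KK_iff_Re_Im: "z \<in> KK \<longleftrightarrow> (\<exists>a b. Re z = of_rat a \<and> Im z = of_rat b * sqrt 19)"
proof -
  have "Re (of_rat q) = of_rat q" "Im (of_rat q) = 0" for q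
    by (cases q; simp add: of_rat_rat complex_eq_iff Re_divide Im_divide power2_eq_square)+
  then show ?thesis
    unfolding KK_iff by (auto simp: sq19 complex_eq_iff)
qed

lemma KK_closed [simp, intro]:
  "x \<in> KK \<Longrightarrow> y \<in> KK \<Longrightarrow> x + y \<in> KK"
  "x \<in> KK \<Longrightarrow> y \<in> KK \<Longrightarrow> x - y \<in> KK"
  "x \<in> KK \<Longrightarrow> y \<in> KK \<Longrightarrow> x * y \<in> KK"
  "x \<in> KK \<Longrightarrow> y \<in> KK \<Longrightarrow> x / y \<in> KK"
  "x \<in> KK \<Longrightarrow> - x \<in> KK" "x \<in> KK \<Longrightarrow> inverse x \<in> KK"
  "0 \<in> KK" "1 \<in> KK" "numeral k \<in> KK" "of_int i \<in> KK" "of_nat j \<in> KK" "sq19 \<in> KK"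
proof -
  have q: "of_rat q \<in> KK" for q
    unfolding KK_iff by (rule exI[of _ q], rule exI[of _ 0]) simp
  show "0 \<in> KK" "1 \<in> KK" "numeral k \<in> KK" "of_int i \<in> KK" "of_nat j \<in> KK"
    using q[of 0] q[of 1] q[of "numeral k"] q[of "of_int i"] q[of "of_nat j"] by simp_all
  then show "sq19 \<in> KK"
    using quadratic_field_closed(6) unfolding sq19_def by blast
  show "x \<in> KK \<Longrightarrow> y \<in> KK \<Longrightarrow> x + y \<in> KK" "x \<in> KK \<Longrightarrow> y \<in> KK \<Longrightarrow> x * y \<in> KK"
     "x \<in> KK \<Longrightarrow> - x \<in> KK" "x \<in> KK \<Longrightarrow> inverse x \<in> KK"
    by (auto intro: quadratic_field_closed)
  show "x \<in> KK \<Longrightarrow> y \<in> KK \<Longrightarrow> x - y \<in> KK"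
    by (metis quadratic_field_closed(1,2) diff_conv_add_uminus)
  show "x \<in> KK \<Longrightarrow> y \<in> KK \<Longrightarrow> x / y \<in> KK"
    by (metis quadratic_field_closed(3,4) divide_inverse)
qed

lemma KK_sum [intro]: "(\<And>i. i \<in> A \<Longrightarrow> f i \<in> KK) \<Longrightarrow> sum f A \<in> KK"
  by (induction A rule: infinite_finite_induct) auto

lemma KK_cnj [simp, intro]: "x \<in> KK \<Longrightarrow> cnj x \<in> KK"
proof -
  assume "x \<in> KK"
  then obtain a b where "Re x = of_rat a" "Im x = of_rat b * sqrt 19"
    by (auto simp: KK_iff_Re_Im)
  then show ?thesis
    unfolding KK_iff_Re_Im by (intro exI[of _ a] exI[of _ "-b"]) (simp add: of_rat_minus)
qed

lemma KK_real_imp_Rats: "x \<in> KK \<Longrightarrow> Im x = 0 \<Longrightarrow> x \<in> \<rat>"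
  unfolding KK_iff_Re_Im
proof (elim exE conjE)
  fix a b :: rat assume "Re x = of_rat a" "Im x = 0"
  then have "x = of_rat a"
    by (cases a) (simp add: of_rat_rat complex_eq_iff Re_divide Im_divide power2_eq_square)
  then show "x \<in> \<rat>" by simp
qed

lemma Rats_square_int:
  fixes x :: real
  assumes "x \<in> \<rat>" "x * x \<in> \<int>"
  shows "x \<in> \<int>"
proof -
  have "algebraic_int (x * x)"
    using assms(2) by (auto elim!: Ints_cases)
  then have "algebraic_int x"
    using algebraic_int_root[of "x * x" "monom 1 2" x] by (auto simp: poly_monom degree_monom_eq power2_eq_square)
  then show ?thesis
    using rational_algebraic_int_is_int assms(1) by blast
qed

text \<open>Only the half-integral shape is recorded; the parity relation between \<open>m\<close>
  and \<open>k\<close> is extracted from the norm where it matters.\<close>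

lemma KK_integral:
  assumes "z \<in> KK" "z + cnj z \<in> \<int>" "z * cnj z \<in> \<int>"
  obtains m k :: int where "z = (of_int m + of_int k * sq19) / 2"
proof -
  obtain a b where ab: "Re z = of_rat a" "Im z = of_rat b * sqrt 19"
    using assms(1) by (auto simp: KK_iff_Re_Im)
  obtain m where m: "z + cnj z = of_int m" using assms(2) by (auto elim: Ints_cases)
  obtain N where N: "z * cnj z = of_int N" using assms(3) by (auto elim: Ints_cases)
  have m': "2 * Re z = of_int m" using m by (simp add: complex_eq_iff)
  have N': "Re z * Re z + Im z * Im z = of_int N" using N by (simp add: complex_eq_iff)
  have "Im z * Im z = 19 * (of_rat b * of_rat b)"
    by (simp add: ab(2) mult_ac)
  then have N'': "of_int (m * m) + 76 * (of_rat b * of_rat b) = (of_int (4 * N) :: real)"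
    using N' m' by (simp add: algebra_simps flip: m')
  \<comment> \<open>Four times the norm is m^2 + 76 b^2 = 4 N. Multiplying by 19 turns the second
    term into the square of 38 b, so 38 b is an integer, and 19 divides it because 19 divides its
    square.\<close>
  define c :: real where "c = 38 * of_rat b"
  have cc: "c * c = of_int (19 * (4 * N - m * m))"
    using N'' by (simp add: c_def algebra_simps)
  have "c \<in> \<rat>" unfolding c_def by auto
  then have "c \<in> \<int>"
    by (rule Rats_square_int) (simp only: cc Ints_of_int)
  then obtain l where l: "c = of_int l" by (auto elim: Ints_cases)
  have "(of_int (l * l) :: real) = of_int (19 * (4 * N - m * m))"
    using cc l by simp
  then have "l * l = 19 * (4 * N - m * m)" by (simp only: of_int_eq_iff)
  then have "19 dvd l * l" by simp
  moreover have "prime (19::int)" by simp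
  ultimately have "19 dvd l" by (auto simp: prime_dvd_mult_iff)
  then obtain k where k: "l = 19 * k" by blast
  have "2 * Im z = of_int k * sqrt 19"
    using l k by (simp add: c_def ab(2))
  then have "z = (of_int m + of_int k * sq19) / 2"
    using m' by (simp add: complex_eq_iff sq19)
  then show ?thesis by (rule that)
qed

lemma KK_bound:
  assumes "z = (of_int m + of_int k * sq19) / 2" "norm z \<le> 3"
  shows "m * m + 19 * (k * k) \<le> 36"
proof -
  have "(norm z)\<^sup>2 \<le> 3\<^sup>2" using assms(2) by (intro power_mono) auto
  then have "(Re z)\<^sup>2 + (Im z)\<^sup>2 \<le> 9" by (simp add: cmod_power2)
  moreover have "Re z = of_int m / 2" "Im z = of_int k * sqrt 19 / 2"
    by (simp_all add: assms(1) sq19)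
  ultimately have "of_int (m * m + 19 * (k * k)) \<le> (36 :: real)"
    by (simp add: power2_eq_square field_simps)
  then show ?thesis by linarith
qed

text \<open>For eigenvalues with product \<open>1\<close> of an element of finite order, \<open>z \<mapsto> z\<^sup>2 - 2 cnj z\<close> sends its trace to
  the trace of its square. An irrational trace would be \<open>(\<plusminus>1 \<plusminus> \<surd>-19)/2\<close> or \<open>(\<plusminus>3 \<plusminus> \<surd>-19)/2\<close> by the
  bound \<open>3\<close>, and at most two squarings lead to an integer of \<open>K\<close> of absolute value greater than \<open>3\<close>.\<close>

lemma KK_trace_rational:
  fixes z :: complex
  defines "f \<equiv> \<lambda>z::complex. z * z - 2 * cnj z"
  assumes P: "\<And>w. w \<in> {z, f z, f (f z)} \<Longrightarrow> w + cnj w \<in> \<int> \<and> w * cnj w \<in> \<int> \<and> norm w \<le> 3"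
    and z: "z \<in> KK"
  shows "z \<in> \<rat>"
proof -
  have eq: "f ((of_int m + of_int k * sq19) / 2) =
      (of_int ((m*m - 19*(k*k)) div 2 - 2*m) + of_int (m*k + 2*k) * sq19) / 2"
    if "odd m" "odd k" for m k
  proof -
    from that obtain m1 k1 where "m = 2*m1+1" "k = 2*k1+1" by (auto elim!: oddE)
    then have "even (m*m - 19*(k*k))" by simp
    then obtain h where h: "m*m - 19*(k*k) = 2 * h" by blast
    have 1: "of_int ((m*m - 19*(k*k)) div 2) = (of_int (m*m - 19*(k*k)) / 2 :: complex)"
      unfolding h by simp
    show ?thesis
      unfolding of_int_add of_int_diff 1 using sq19_sq
      by (simp add: f_def complex_eq_iff sq19 field_simps)
  qed
  obtain m k where zm: "z = (of_int m + of_int k * sq19) / 2"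
    using KK_integral[OF z] P[of z] by auto
  have bz: "m * m + 19 * (k * k) \<le> 36"
    using KK_bound[OF zm] P[of z] by auto
  have "k * k \<le> 1"
    using bz zero_le_square[of m] by linarith
  then have k: "\<bar>k\<bar> \<le> 1"
    using abs_le_square_iff[of k 1] by (simp add: power2_eq_square)
  have "k = 0"
  proof (rule ccontr)
    assume "k \<noteq> 0"
    then have k1: "k = 1 \<or> k = -1" using k by linarith
    \<comment> \<open>For \<open>k\<close> = +-1 an even \<open>m\<close> would make the norm (m^2 +
      19)/4 non-integral.\<close>
    have "odd m"
    proof
      assume "even m"
      obtain N where N: "z * cnj z = of_int N" using P[of z] by (auto elim: Ints_cases)
      have "of_int (m*m + 19) = (of_int (4 * N) :: complex)"
        using N k1 by (auto simp: zm sq19 complex_eq_iff field_simps)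
      then have "m*m + 19 = 4 * N" by (simp only: of_int_eq_iff)
      moreover obtain h where "m = 2 * h" using \<open>even m\<close> by blast
      ultimately have "4 * (h * h) + 19 = 4 * N" by simp
      then show False by presburger
    qed
    have "m * m \<le> 17" using bz k1 by auto
    have "\<bar>m\<bar> < 5"
    proof (rule ccontr)
      assume "\<not> \<bar>m\<bar> < 5"
      then have "5 * 5 \<le> \<bar>m\<bar> * \<bar>m\<bar>" by (intro mult_mono) auto
      then show False using \<open>m * m \<le> 17\<close> by simp
    qed
    then have "m = -4 \<or> m = -3 \<or> m = -2 \<or> m = -1 \<or> m = 0 \<or> m = 1 \<or> m = 2 \<or> m = 3 \<or> m = 4" by linarith
    then have m: "m \<in> {-3, -1, 1, 3}" using \<open>odd m\<close> by auto
    define m2 where "m2 = (m*m - 19*(k*k)) div 2 - 2*m"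
    define k2 where "k2 = m*k + 2*k"
    have f1: "f z = (of_int m2 + of_int k2 * sq19) / 2"
      unfolding zm m2_def k2_def using eq[of m k] \<open>odd m\<close> k1 by auto
    have b1: "m2 * m2 + 19 * (k2 * k2) \<le> 36"
      using KK_bound[OF f1] P[of "f z"] by auto
    \<comment> \<open>Of the candidates +-1 and +-3 only -3 survives the bound after one application
      of \<open>f\<close>; its image has \<open>m2\<close> = 1, which violates the bound after the
      second.\<close>
    have m3: "m = -3"
      using b1 m k1 by (auto simp: m2_def k2_def)
    have m2: "m2 = 1" "odd k2" "k2 * k2 = 1" using m3 k1 by (auto simp: m2_def k2_def)
    have f2: "f (f z) = (of_int (-11) + of_int (3 * k2) * sq19) / 2"
      unfolding f1 using eq[of m2 k2] m2 by simp
    show False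
      using KK_bound[OF f2] P[of "f (f z)"] m2 by auto
  qed
  then show ?thesis
    by (simp add: zm)
qed

text \<open>Here m^2 + 19 k^2 = 4 leaves only k = 0: the field has no units of absolute value 1
  besides the signs.\<close>

lemma KK_root_of_unity:
  assumes "d \<in> KK" "d ^ n = 1" "n > 0"
  shows "d = 1 \<or> d = -1"
proof -
  have nd: "norm d = 1"
    using assms by (metis power_eq_1_iff less_not_refl2)
  then have dc: "d * cnj d = 1"
    by (simp add: complex_norm_square[symmetric])
  have "sum_list [d, cnj d] \<in> \<int>"
  proof (rule rational_sum_of_roots_of_unity[OF assms(3)])
    have "sum_list [d, cnj d] \<in> KK" using assms(1) by auto
    then show "sum_list [d, cnj d] \<in> \<rat>" by (rule KK_real_imp_Rats) simp
  qed (use assms(2) in \<open>auto simp flip: complex_cnj_power\<close>)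
  then obtain m k where d: "d = (of_int m + of_int k * sq19) / 2"
    using KK_integral[OF assms(1)] dc by auto
  have "of_int (m * m + 19 * (k * k)) = (of_int 4 :: complex)"
    using dc by (simp add: d sq19 complex_eq_iff field_simps)
  then have *: "m * m + 19 * (k * k) = 4" by (simp only: of_int_eq_iff)
  have "k * k \<le> 0" using * zero_le_square[of m] by linarith
  then have "k = 0" by (auto simp: mult_le_0_iff)
  with * have "m\<^sup>2 = 2\<^sup>2" by (simp add: power2_eq_square)
  then have "m = 2 \<or> m = -2" using power2_eq_iff by blast
  then show ?thesis using \<open>k = 0\<close> by (auto simp: d)
qed

section \<open>Triples of roots of unity with symmetric functions in K\<close>

lemma norm_eq_1_if_power_eq_1: "(x::complex) ^ n = 1 \<Longrightarrow> n > 0 \<Longrightarrow> norm x = 1"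
  by (metis norm_one norm_power norm_ge_zero power_eq_imp_eq_base power_one)

lemma root_of_unity_cnj: "(x::complex) ^ n = 1 \<Longrightarrow> n > 0 \<Longrightarrow> x * cnj x = 1"
  using norm_eq_1_if_power_eq_1[of x n] by (simp add: complex_norm_square[symmetric])

text \<open>Since the product is 1, conjugation sends each root to the product of the other two;
  hence the sum of the squares is s^2 - 2 cnj s and stays in K. Trace and norm of s are sums of six
  and nine roots of unity that are real and in K, hence rational, hence integers.\<close>

lemma KK_sum_three_roots_of_unity:
  assumes n: "n > 0" and a: "a ^ n = 1" and b: "b ^ n = 1" and c: "c ^ n = 1"
    and abc: "a * b * c = 1" and s: "a + b + c \<in> KK"
  shows "a + b + c \<in> \<int>"
proof -
  define P where "P w \<longleftrightarrow> w + cnj w \<in> \<int> \<and> w * cnj w \<in> \<int> \<and> norm w \<le> 3" for w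
  have P: "P (a + b + c)" if a: "a ^ n = 1" and b: "b ^ n = 1" and c: "c ^ n = 1" and s: "a + b + c \<in> KK" for a b c
  proof -
    have cn: "cnj a ^ n = 1" "cnj b ^ n = 1" "cnj c ^ n = 1"
      using a b c by (auto simp flip: complex_cnj_power)
    have "sum_list [a, b, c, cnj a, cnj b, cnj c] \<in> \<int>"
    proof (rule rational_sum_of_roots_of_unity[OF n])
      have "(a + b + c) + cnj (a + b + c) \<in> \<rat>"
        by (rule KK_real_imp_Rats) (use s in \<open>blast, simp\<close>)
      then show "sum_list [a, b, c, cnj a, cnj b, cnj c] \<in> \<rat>" by (simp add: algebra_simps)
    qed (use a b c cn in auto)
    moreover have "sum_list [a * cnj a, a * cnj b, a * cnj c, b * cnj a, b * cnj b, b * cnj c,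
        c * cnj a, c * cnj b, c * cnj c] \<in> \<int>"
    proof (rule rational_sum_of_roots_of_unity[OF n])
      have "(a + b + c) * cnj (a + b + c) \<in> \<rat>"
        by (rule KK_real_imp_Rats) (use s in \<open>blast, simp add: algebra_simps\<close>)
      then show "sum_list [a * cnj a, a * cnj b, a * cnj c, b * cnj a, b * cnj b, b * cnj c,
        c * cnj a, c * cnj b, c * cnj c] \<in> \<rat>" by (simp add: algebra_simps)
    qed (use a b c cn in \<open>auto simp: power_mult_distrib\<close>)
    moreover have "norm (a + b + c) \<le> norm a + norm b + norm c"
      by (meson norm_triangle_ineq norm_triangle_le add_right_mono)
    ultimately show ?thesis
      using norm_eq_1_if_power_eq_1[OF a n] norm_eq_1_if_power_eq_1[OF b n] norm_eq_1_if_power_eq_1[OF c n]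
      by (simp add: P_def algebra_simps)
  qed
  have f: "(a + b + c) * (a + b + c) - 2 * cnj (a + b + c) = a\<^sup>2 + b\<^sup>2 + c\<^sup>2"
    if "a ^ n = 1" "b ^ n = 1" "c ^ n = 1" "a * b * c = 1" for a b c :: complex
  proof -
    have "cnj a * a = 1" "cnj b * b = 1" "cnj c * c = 1"
      using that root_of_unity_cnj[OF _ n] by (simp_all add: mult.commute)
    then have "cnj a = b * c" "cnj b = a * c" "cnj c = a * b"
      using that(4) by algebra+
    then show ?thesis by (simp add: power2_eq_square algebra_simps)
  qed
  have p2: "(a\<^sup>2) ^ n = 1" "(b\<^sup>2) ^ n = 1" "(c\<^sup>2) ^ n = 1"
      "((a\<^sup>2)\<^sup>2) ^ n = 1" "((b\<^sup>2)\<^sup>2) ^ n = 1" "((c\<^sup>2)\<^sup>2) ^ n = 1"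
    using a b c by (metis power_mult mult.commute power_one)+
  have prod2: "a\<^sup>2 * b\<^sup>2 * c\<^sup>2 = 1" using abc by (simp flip: power_mult_distrib)
  note f1 = f[OF a b c abc] and f2 = f[OF p2(1-3) prod2]
  have s1: "a\<^sup>2 + b\<^sup>2 + c\<^sup>2 \<in> KK" unfolding f1[symmetric] using s by blast
  have s2: "(a\<^sup>2)\<^sup>2 + (b\<^sup>2)\<^sup>2 + (c\<^sup>2)\<^sup>2 \<in> KK" unfolding f2[symmetric] using s1 by blast
  have "a + b + c \<in> \<rat>"
  proof (rule KK_trace_rational[OF _ s], unfold f1 f2)
    fix w assume "w \<in> {a + b + c, a\<^sup>2 + b\<^sup>2 + c\<^sup>2, (a\<^sup>2)\<^sup>2 + (b\<^sup>2)\<^sup>2 + (c\<^sup>2)\<^sup>2}"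
    then show "w + cnj w \<in> \<int> \<and> w * cnj w \<in> \<int> \<and> norm w \<le> 3"
      using P[OF a b c s] P[OF p2(1-3) s1] P[OF p2(4-6) s2] unfolding P_def by blast
  qed
  then have "sum_list [a, b, c] \<in> \<int>"
    by (intro rational_sum_of_roots_of_unity[OF n]) (use a b c in \<open>auto simp: add.assoc\<close>)
  then show ?thesis by (simp add: add.assoc)
qed

text \<open>Scaling by the sign e = a b c reduces to product 1, because e^3 = e. Conjugation inverts
  the roots, so the second symmetric function is e times the conjugate of the sum; the cubic then
  has the root e, and \<open>u\<close> is the sum of the other two.\<close>

lemma KK_three_roots_of_unity:
  assumes n: "n > 0" and a: "a ^ n = 1" and b: "b ^ n = 1" and c: "c ^ n = 1"
    and d: "a * b * c \<in> KK" and s: "a + b + c \<in> KK"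
  obtains e u :: int where "e = 1 \<or> e = -1" "-2 \<le> u" "u \<le> 2" "a * b * c = of_int e"
    "a + b + c = of_int (e + u)" "a * b + b * c + c * a = of_int (1 + e * u)"
proof -
  have "(a * b * c) ^ n = 1" using a b c by (simp add: power_mult_distrib)
  from KK_root_of_unity[OF d this n] obtain e :: int where e: "e = 1 \<or> e = -1" "a * b * c = of_int e"
    by (metis of_int_1 of_int_minus)
  have e2: "of_int e * of_int e = (1::complex)" using e(1) by auto
  have "of_int e * a + of_int e * b + of_int e * c \<in> \<int>"
  proof (rule KK_sum_three_roots_of_unity[of "2 * n"])
    have "(of_int e * x) ^ (2 * n) = 1" if "x ^ n = 1" for x :: complex
    proof -
      have "(of_int e * x) ^ (2 * n) = ((of_int e * of_int e)) ^ n * (x ^ n) ^ 2"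
        by (simp add: power_mult power_mult_distrib power2_eq_square mult_ac)
      then show ?thesis using that e2 by simp
    qed
    then show "(of_int e * a) ^ (2 * n) = 1" "(of_int e * b) ^ (2 * n) = 1" "(of_int e * c) ^ (2 * n) = 1"
      using a b c by blast+
    have "of_int e * a * (of_int e * b) * (of_int e * c) = (of_int e * of_int e) * (of_int e * (a * b * c))"
      by (simp add: mult_ac)
    then show "of_int e * a * (of_int e * b) * (of_int e * c) = 1"
      by (simp add: e2 e(2))
    have "of_int e * (a + b + c) \<in> KK" using s by blast
    then show "of_int e * a + of_int e * b + of_int e * c \<in> KK" by (simp add: algebra_simps)
  qed (use n in auto)
  then obtain t' where "of_int e * a + of_int e * b + of_int e * c = of_int t'" by (auto elim: Ints_cases)
  then have "of_int e * of_int e * (a + b + c) = of_int (e * t')" by (simp add: algebra_simps flip: distrib_left)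
  then have "a + b + c = of_int (e * t')" by (simp add: e2)
  then obtain t :: int where t: "a + b + c = of_int t" by blast
  define u where "u = t - e"
  have t': "a + b + c = of_int (e + u)" by (simp add: t u_def)
  have ca: "cnj a * a = 1" "cnj b * b = 1" "cnj c * c = 1"
    using a b c root_of_unity_cnj[OF _ n] by (simp_all add: mult.commute)
  have "cnj a + cnj b + cnj c = cnj (a + b + c)" by simp
  then have ct: "cnj a + cnj b + cnj c = of_int (e + u)" unfolding t' by simp
  have "a * b + b * c + c * a = a * b * c * (cnj a + cnj b + cnj c)"
    using ca by algebra
  also have "\<dots> = of_int e * of_int e + of_int e * of_int u"
    unfolding ct e(2) by (simp add: algebra_simps)
  finally have min: "a * b + b * c + c * a = of_int (1 + e * u)" by (simp add: e2)
  have "(of_int e - a) * (of_int e - b) * (of_int e - c) = 0"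
  proof -
    have "(of_int e - a) * (of_int e - b) * (of_int e - c) =
      of_int e * of_int e * of_int e - of_int e * of_int e * (a + b + c) + of_int e * (a * b + b * c + c * a) - a * b * c"
      by (simp add: algebra_simps)
    then show ?thesis
      using e(1) unfolding min t' e(2) by auto
  qed
  then consider "a = of_int e" | "b = of_int e" | "c = of_int e" by auto
  then have "\<exists>x y. x ^ n = 1 \<and> y ^ n = 1 \<and> x + y = (of_int u :: complex)"
  proof cases
    case 1 then show ?thesis using b c t' by (intro exI[of _ b] exI[of _ c]) simp
  next
    case 2 then show ?thesis using a c t' by (intro exI[of _ a] exI[of _ c]) simp
  next
    case 3 then show ?thesis using a b t' by (intro exI[of _ a] exI[of _ b]) simp
  qed
  then obtain x y where xy: "x ^ n = 1" "y ^ n = 1" "x + y = (of_int u :: complex)" by blast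
  have "norm (x + y) \<le> 2"
    using norm_triangle_ineq[of x y] norm_eq_1_if_power_eq_1[OF xy(1) n] norm_eq_1_if_power_eq_1[OF xy(2) n]
    by simp
  then have "\<bar>u\<bar> \<le> 2" by (simp add: xy(3))
  then show ?thesis
    by (intro that[OF e(1) _ _ e(2) t' min]) auto
qed

text \<open>A square root of -m is purely imaginary, say b sqrt(-19), and then (19 b)^2 = 19 m, but
  19 and 57 are not squares. The values -1 and -3 are the square classes of u^2 - 4 for u = 0 and u
  = +-1.\<close>

lemma KK_no_sqrt:
  assumes "x \<in> KK" shows "x * x \<noteq> -1" "x * x \<noteq> -3"
proof -
  obtain a b where ab: "Re x = of_rat a" "Im x = of_rat b * sqrt 19"
    using assms by (auto simp: KK_iff_Re_Im)
  have *: False if eq: "x * x = - of_nat m" and m: "m > 0" "\<And>k::int. k * k \<noteq> 19 * int m" for m :: nat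
  proof -
    have 1: "Re x * Re x - Im x * Im x = - real m" "Re x * Im x = 0"
      using eq by (auto simp: complex_eq_iff)
    have "Im x \<noteq> 0"
    proof
      assume "Im x = 0"
      then have "Re x * Re x = - real m" using 1 by simp
      then show False using m(1) zero_le_square[of "Re x"] by simp
    qed
    then have "Im x * Im x = m" using 1 by simp
    then have "19 * (of_rat b * of_rat b) = real m" by (simp add: ab(2) mult_ac)
    then have 2: "(19 * of_rat b) * (19 * of_rat b) = real_of_int (19 * int m)" by simp
    have "(19 * of_rat b :: real) \<in> \<int>"
      by (rule Rats_square_int) (auto simp only: 2 Ints_of_int intro!: Rats_mult, auto)
    then obtain k where "19 * of_rat b = real_of_int k" by (auto elim: Ints_cases)
    then have "of_int (k * k) = real_of_int (19 * int m)" using 2 by simp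
    then have "k * k = 19 * int m" by (simp only: of_int_eq_iff)
    then show False using m by blast
  qed
  have nsq: "k * k \<noteq> m" if "l * l < m" "m < (l + 1) * (l + 1)" "l \<ge> 0" for k l m :: int
  proof
    assume "k * k = m"
    then have "\<bar>k\<bar> * \<bar>k\<bar> = m" by simp
    then show False using that mult_mono[of "\<bar>k\<bar>" l "\<bar>k\<bar>" l] mult_mono[of "l+1" "\<bar>k\<bar>" "l+1" "\<bar>k\<bar>"] by linarith
  qed
  show "x * x \<noteq> -1" using *[of 1] nsq[of 4 19] by auto
  show "x * x \<noteq> -3" using *[of 3] nsq[of 7 57] by auto
qed

section \<open>Elements of finite order\<close>

definition entries_in :: "'a set \<Rightarrow> 'a^'n^'m \<Rightarrow> bool" where
  "entries_in F A \<longleftrightarrow> (\<forall>i j. A $ i $ j \<in> F)"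

lemmas mat_expand = vec_eq_iff forall_3 forall_2 matrix_matrix_mult_def matrix_vector_mult_def
  sum_3 sum_2 mat_def

lemma det_eq_0_imp_kernel:
  fixes A :: "'a::field^'n^'n"
  assumes "det A = 0" obtains v where "v \<noteq> 0" "A *v v = 0"
proof -
  have "\<not> (\<exists>B. B ** A = mat 1)"
    using assms by (simp add: invertible_det_nz flip: invertible_left_inverse)
  then show ?thesis unfolding matrix_left_invertible_ker using that by auto
qed

lemma kernel_0_imp_det_nz:
  fixes A :: "'a::field^'n^'n"
  assumes "\<And>v. A *v v = 0 \<Longrightarrow> v = 0" shows "det A \<noteq> 0"
proof -
  have "\<exists>B. B ** A = mat 1"
    unfolding matrix_left_invertible_ker using assms by blast
  then show ?thesis by (simp add: invertible_det_nz flip: invertible_left_inverse)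
qed

definition minor_sum :: "'a::comm_ring_1^3^3 \<Rightarrow> 'a" where
  "minor_sum A = A$1$1 * A$2$2 - A$1$2 * A$2$1 + (A$1$1 * A$3$3 - A$1$3 * A$3$1)
     + (A$2$2 * A$3$3 - A$2$3 * A$3$2)"

lemma char_poly_3:
  fixes A :: "'a::comm_ring_1^3^3"
  shows "det (mat x - A) = x * x * x - trace A * (x * x) + minor_sum A * x - det A"
  by (simp add: det_3 trace_def minor_sum_def mat_def sum_3 algebra_simps)

lemma Cayley_Hamilton_3:
  fixes A :: "'a::comm_ring_1^3^3"
  shows "A *v (A *v (A *v v)) - trace A *s (A *v (A *v v)) + minor_sum A *s (A *v v) - det A *s v = 0"
  by (simp add: det_3 trace_def minor_sum_def mat_expand algebra_simps)

text \<open>Iterating the action on vectors, rather than taking matrix powers, lets eigenvectors and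
  Jordan chains be followed directly by induction.\<close>

definition has_period :: "nat \<Rightarrow> 'a::semiring_1^'n^'n \<Rightarrow> bool" where
  "has_period n A \<longleftrightarrow> n > 0 \<and> (\<forall>v. (((*v) A) ^^ n) v = v)"

lemma eigenvalue_root_of_unity:
  fixes A :: "complex^'n^'n"
  assumes "has_period n A" "A *v v = c *s v" "v \<noteq> 0"
  shows "c ^ n = 1"
proof -
  have "(((*v) A) ^^ k) v = c ^ k *s v" for k
    by (induction k) (simp_all add: vector_scalar_commute assms(2) vector_smult_assoc mult_ac)
  then have "c ^ n *s v = v" using assms(1) by (metis has_period_def)
  moreover obtain i where "v $ i \<noteq> 0" using assms(3) by (auto simp: vec_eq_iff)
  ultimately show ?thesis
    by (metis mult_cancel_right1 vector_smult_component)
qed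

text \<open>Along a Jordan chain the k-th iterate picks up the term k c^(k-1) y, which is nonzero at
  the period unless y = 0.\<close>

lemma periodic_no_Jordan_block:
  fixes A :: "complex^'n^'n"
  assumes "has_period n A" "A *v w = c *s w + y" "A *v y = c *s y"
  shows "y = 0"
proof (rule ccontr)
  assume "y \<noteq> 0"
  from eigenvalue_root_of_unity[OF assms(1,3) this] have cn: "c ^ n = 1" .
  have n: "n > 0" using assms(1) by (simp add: has_period_def)
  have "c \<noteq> 0" using cn n by (auto simp: power_0_left)
  \<comment> \<open>The coefficient is written \<open>c ^ k / c\<close> so that the formula also
    covers k = 0.\<close>
  have "(((*v) A) ^^ k) w = c ^ k *s w + (of_nat k * c ^ k / c) *s y" for k
  proof (induction k)
    case (Suc k)
    have "(((*v) A) ^^ Suc k) w = A *v (c ^ k *s w + (of_nat k * c ^ k / c) *s y)"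
      by (simp add: Suc)
    then show ?case
      using \<open>c \<noteq> 0\<close>
      by (simp add: vector_scalar_commute matrix_vector_right_distrib assms(2,3) vec_eq_iff field_simps)
  qed simp
  from this[of n] have "w = w + (of_nat n / c) *s y"
    using assms(1) cn by (simp add: has_period_def)
  then have "(of_nat n / c) *s y = 0" by simp
  then show False using \<open>y \<noteq> 0\<close> n \<open>c \<noteq> 0\<close> by (auto simp: vec_eq_iff)
qed

lemma cubic_splits:
  fixes t e d :: complex
  obtains a b c where "a + b + c = t" "a * b + b * c + c * a = e" "a * b * c = d"
proof -
  have "\<not> constant (poly [:-d, e, -t, 1:])"
    by (simp add: constant_degree)
  then obtain a where "poly [:-d, e, -t, 1:] a = 0"
    using fundamental_theorem_of_algebra by blast
  then have a: "a * a * a - t * (a * a) + e * a - d = 0"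
    by (simp add: algebra_simps)
  define p where "p = t - a"
  define q where "q = e - a * p"
  define s where "s = csqrt (p\<^sup>2 - 4 * q)"
  have s: "s * s = p\<^sup>2 - 4 * q"
    using power2_csqrt[of "p\<^sup>2 - 4 * q"] by (simp add: s_def power2_eq_square)
  define b where "b = (p + s) / 2"
  define c where "c = (p - s) / 2"
  have bc: "b + c = p" "b * c = q"
    using s by (simp_all add: b_def c_def field_simps power2_eq_square)
  show ?thesis
  proof (rule that[of a b c])
    show "a + b + c = t" using bc(1) by (simp add: p_def algebra_simps)
    have "a * b + b * c + c * a = a * (b + c) + b * c" by (simp add: algebra_simps)
    then show "a * b + b * c + c * a = e" by (simp add: bc q_def)
    have "a * b * c = a * (b * c)" by simp
    also have "\<dots> = d" using a by (simp add: bc q_def p_def algebra_simps)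
    finally show "a * b * c = d" .
  qed
qed

lemma entries_in_det_trace_KK:
  assumes "entries_in KK (A :: complex^3^3)"
  shows "det A \<in> KK" "trace A \<in> KK"
  using assms unfolding entries_in_def
  by (auto simp: det_3 trace_def sum_3 intro!: KK_closed(1-3))

text \<open>The characteristic polynomial is (X - d)(X^2 - u X + 1). For d u = 2 it is (X - d)^3,
  and periodicity excludes Jordan blocks, so the matrix is scalar.\<close>

lemma KK_period_char_poly:
  fixes A :: "complex^3^3"
  assumes A: "entries_in KK A" and n: "has_period n A"
  obtains d u :: int where "d = 1 \<or> d = -1" "-2 \<le> u" "u \<le> 2" "det A = of_int d"
    "trace A = of_int (d + u)" "minor_sum A = of_int (1 + d * u)"
    "d * u = 2 \<Longrightarrow> A = mat (of_int d)"
proof -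
  obtain a b c where abc: "a + b + c = trace A" "a * b + b * c + c * a = minor_sum A" "a * b * c = det A"
    by (rule cubic_splits)
  have root: "x ^ n = 1" if "x \<in> {a, b, c}" for x
  proof -
    have "det (mat x - A) = (x - a) * (x - b) * (x - c)"
      unfolding char_poly_3 abc[symmetric] by (simp add: algebra_simps)
    then have "det (mat x - A) = 0" using that by auto
    then obtain v where "v \<noteq> 0" "(mat x - A) *v v = 0" by (rule det_eq_0_imp_kernel)
    moreover have "mat x *v v = x *s v" by (simp add: mat_expand)
    ultimately show ?thesis
      using eigenvalue_root_of_unity[OF n, of v x] by (simp add: matrix_vector_mult_diff_rdistrib)
  qed
  obtain d u :: int where du: "d = 1 \<or> d = -1" "-2 \<le> u" "u \<le> 2" "a * b * c = of_int d"
    "a + b + c = of_int (d + u)" "a * b + b * c + c * a = of_int (1 + d * u)"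
    by (rule KK_three_roots_of_unity[of n a b c])
      (use n root entries_in_det_trace_KK[OF A] in \<open>auto simp: abc has_period_def\<close>)
  have "A = mat (of_int d)" if "d * u = 2"
  proof -
    define N where "N v = A *v v - of_int d *s v" for v
    have u: "u = 2 * d" using du(1) that by auto
    have NNN: "N (N (N v)) = 0" for v
    proof -
      have d3: "of_int d * (of_int d * (x::complex)) = x" for x using du(1) by auto
      have "N (N (N v)) = A *v (A *v (A *v v)) - trace A *s (A *v (A *v v)) + minor_sum A *s (A *v v) - det A *s v"
        unfolding N_def abc[symmetric] du u matrix_vector_mult_diff_distrib vector_scalar_commute
        by (simp add: vec_eq_iff algebra_simps d3)
      then show ?thesis by (simp only: Cayley_Hamilton_3)
    qed
    have step: "N v = 0" if "N (N v) = 0" for v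
      by (rule periodic_no_Jordan_block[OF n, of v "of_int d"]) (use that in \<open>simp_all add: N_def\<close>)
    have "N v = 0" for v using step[of v] step[of "N v"] NNN by blast
    then have "A *v v = mat (of_int d) *v v" for v
      by (simp add: N_def vec_eq_iff mat_expand)
    then show ?thesis by (simp add: matrix_eq)
  qed
  then show ?thesis
    using that[of d u] du abc by simp
qed

section \<open>Finite groups of matrices\<close>

lemma entries_in_KK_mult [intro]: "entries_in KK A \<Longrightarrow> entries_in KK B \<Longrightarrow> entries_in KK (A ** B)"
  by (auto simp: entries_in_def matrix_matrix_mult_def)

lemma entries_in_KK_mat [simp]: "entries_in KK (mat 1)"
  by (auto simp: entries_in_def mat_def)

text \<open>A base change is carried together with its inverse, so no inverse operation enters the
  conjugations.\<close>

definition KK_inverses :: "complex^3^3 \<Rightarrow> complex^3^3 \<Rightarrow> bool" where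
  "KK_inverses P Q \<longleftrightarrow> entries_in KK P \<and> entries_in KK Q \<and> P ** Q = mat 1 \<and> Q ** P = mat 1"

definition adjugate_3 :: "'a::comm_ring_1^3^3 \<Rightarrow> 'a^3^3" where
  "adjugate_3 A = vector [
    vector [A$2$2 * A$3$3 - A$2$3 * A$3$2, A$1$3 * A$3$2 - A$1$2 * A$3$3, A$1$2 * A$2$3 - A$1$3 * A$2$2],
    vector [A$2$3 * A$3$1 - A$2$1 * A$3$3, A$1$1 * A$3$3 - A$1$3 * A$3$1, A$1$3 * A$2$1 - A$1$1 * A$2$3],
    vector [A$2$1 * A$3$2 - A$2$2 * A$3$1, A$1$2 * A$3$1 - A$1$1 * A$3$2, A$1$1 * A$2$2 - A$1$2 * A$2$1]]"

definition inverse_3 :: "complex^3^3 \<Rightarrow> complex^3^3" where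
  "inverse_3 A = (\<chi> i j. adjugate_3 A $ i $ j / det A)"

lemma mult_inverse_3:
  assumes "det A \<noteq> 0" shows "A ** inverse_3 A = mat 1"
proof -
  have "A ** adjugate_3 A = mat (det A)"
    by (simp add: mat_expand adjugate_3_def det_3 algebra_simps)
  then show ?thesis
    using assms by (simp add: mat_expand inverse_3_def flip: add_divide_distrib)
qed

lemma det_nz_imp_KK_inverses:
  assumes A: "entries_in KK A" and nz: "det A \<noteq> 0"
  obtains B where "KK_inverses A B"
proof -
  have ent: "A $ i $ j \<in> KK" for i j using A by (simp add: entries_in_def)
  have "entries_in KK (inverse_3 A)"
    unfolding entries_in_def inverse_3_def forall_3 using entries_in_det_trace_KK(1)[OF A]
    by (simp add: adjugate_3_def) (intro conjI KK_closed(2,3,4) ent)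
  then show ?thesis
    using A mult_inverse_3[OF nz] matrix_left_right_inverse[of A "inverse_3 A"]
    by (intro that[of "inverse_3 A"]) (simp add: KK_inverses_def)
qed

definition KK_group :: "(complex^3^3) set \<Rightarrow> bool" where
  "KK_group G \<longleftrightarrow> finite G \<and> mat 1 \<in> G \<and> (\<forall>x\<in>G. entries_in KK x) \<and> (\<forall>x\<in>G. \<forall>y\<in>G. x ** y \<in> G) \<and>
     (\<forall>x\<in>G. \<exists>y\<in>G. x ** y = mat 1 \<and> y ** x = mat 1)"

definition conj_by :: "complex^3^3 \<Rightarrow> complex^3^3 \<Rightarrow> (complex^3^3) set \<Rightarrow> (complex^3^3) set" where
  "conj_by P Q G = (\<lambda>x. Q ** x ** P) ` G"

text \<open>Rational entries alone are demanded: for a group \<open>G\<close> the conjugates form a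
  group again, so inverses have rational entries automatically, as \<open>rationalizable_iff\<close>
  makes precise.\<close>

definition rationalizable :: "(complex^3^3) set \<Rightarrow> bool" where
  "rationalizable G \<longleftrightarrow> (\<exists>P Q. KK_inverses P Q \<and> (\<forall>x\<in>G. entries_in \<rat> (Q ** x ** P)))"

lemma KK_inverses_sym: "KK_inverses P Q \<Longrightarrow> KK_inverses Q P"
  by (auto simp: KK_inverses_def)

lemma KK_inverses_cancel:
  assumes "KK_inverses P Q"
  shows "P ** (Q ** x) = x" "Q ** (P ** x) = x" "x ** P ** Q = x" "x ** Q ** P = x"
proof -
  have PQ: "P ** Q = mat 1" "Q ** P = mat 1" using assms by (auto simp: KK_inverses_def)
  show "P ** (Q ** x) = x" "Q ** (P ** x) = x" by (simp_all add: matrix_mul_assoc PQ)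
  show "x ** P ** Q = x" "x ** Q ** P = x" by (simp_all add: PQ flip: matrix_mul_assoc)
qed

lemma KK_inverses_mult:
  assumes "KK_inverses P Q" "KK_inverses P' Q'"
  shows "KK_inverses (P ** P') (Q' ** Q)"
proof -
  have "P ** P' ** (Q' ** Q) = P ** (P' ** (Q' ** Q))" "Q' ** Q ** (P ** P') = Q' ** (Q ** (P ** P'))"
    by (simp_all only: matrix_mul_assoc)
  then show ?thesis
    unfolding KK_inverses_def using assms
    by (auto simp: KK_inverses_cancel[OF assms(1)] KK_inverses_cancel[OF assms(2)]) (auto simp: KK_inverses_def)
qed

lemma conj_mult:
  assumes "KK_inverses P Q"
  shows "(Q ** x ** P) ** (Q ** y ** P) = Q ** (x ** y) ** P"
proof -
  have "(Q ** x ** P) ** (Q ** y ** P) = Q ** x ** (P ** (Q ** y)) ** P"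
    by (simp only: matrix_mul_assoc)
  then show ?thesis by (simp only: KK_inverses_cancel[OF assms] matrix_mul_assoc)
qed

lemma conj_by_conj_by: "conj_by P' Q' (conj_by P Q G) = conj_by (P ** P') (Q' ** Q) G"
  by (simp add: conj_by_def image_image matrix_mul_assoc)

lemma conj_by_inverse: "KK_inverses P Q \<Longrightarrow> conj_by Q P (conj_by P Q G) = G"
  by (simp add: conj_by_conj_by) (simp add: conj_by_def KK_inverses_def)

lemma KK_group_conj_by:
  assumes G: "KK_group G" and PQ: "KK_inverses P Q"
  shows "KK_group (conj_by P Q G)"
  unfolding KK_group_def conj_by_def
proof (intro conjI ballI)
  show "finite ((\<lambda>x. Q ** x ** P) ` G)" using G by (simp add: KK_group_def)
  have "Q ** mat 1 ** P = mat 1" using PQ by (simp add: KK_inverses_def)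
  then show "mat 1 \<in> (\<lambda>x. Q ** x ** P) ` G" using G by (auto simp: KK_group_def intro!: image_eqI[of _ _ "mat 1"])
next
  fix x assume "x \<in> (\<lambda>x. Q ** x ** P) ` G"
  then show "entries_in KK x" using G PQ by (auto simp: KK_group_def KK_inverses_def)
next
  fix x y assume "x \<in> (\<lambda>x. Q ** x ** P) ` G" "y \<in> (\<lambda>x. Q ** x ** P) ` G"
  then show "x ** y \<in> (\<lambda>x. Q ** x ** P) ` G" using G by (auto simp: KK_group_def conj_mult[OF PQ])
next
  fix x assume "x \<in> (\<lambda>x. Q ** x ** P) ` G"
  then obtain x0 where x0: "x0 \<in> G" "x = Q ** x0 ** P" by auto
  obtain y0 where y0: "y0 \<in> G" "x0 ** y0 = mat 1" "y0 ** x0 = mat 1" using G x0 by (auto simp: KK_group_def)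
  have "Q ** mat 1 ** P = mat 1" using PQ by (simp add: KK_inverses_def)
  then show "\<exists>y\<in>(\<lambda>x. Q ** x ** P) ` G. x ** y = mat 1 \<and> y ** x = mat 1"
    using x0 y0 by (intro bexI[of _ "Q ** y0 ** P"]) (simp_all add: conj_mult[OF PQ])
qed

lemma rationalizable_conj_by:
  assumes "rationalizable (conj_by P Q G)" "KK_inverses P Q"
  shows "rationalizable G"
proof -
  obtain P' Q' where PQ': "KK_inverses P' Q'" "\<forall>x\<in>conj_by P Q G. entries_in \<rat> (Q' ** x ** P')"
    using assms(1) by (auto simp: rationalizable_def)
  then show ?thesis
    unfolding rationalizable_def
    by (intro exI[of _ "P ** P'"] exI[of _ "Q' ** Q"] conjI KK_inverses_mult assms(2))
      (auto simp: conj_by_def matrix_mul_assoc)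
qed

lemma KK_group_period:
  assumes G: "KK_group G" and x: "x \<in> G"
  obtains n where "has_period n x"
proof -
  define p where "p k = (((**) x) ^^ k) (mat 1)" for k
  have pG: "p k \<in> G" for k
    using G x by (induction k) (auto simp: p_def KK_group_def)
  have pv: "p k *v v = (((*v) x) ^^ k) v" for k v
    by (induction k) (simp_all add: p_def flip: matrix_vector_mul_assoc)
  have "\<not> inj p"
  proof
    assume "inj p"
    then have "infinite (range p)" by (simp add: finite_image_iff)
    moreover have "range p \<subseteq> G" using pG by auto
    ultimately show False using G finite_subset by (auto simp: KK_group_def)
  qed
  then obtain i j where ij: "i < j" "p i = p j" by (metis injI linorder_neqE_nat)
  have p_add: "p (i + k) = p i ** p k" for i k
    by (induction i) (simp_all add: p_def matrix_mul_assoc)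
  obtain y where "y ** p i = mat 1" using G pG[of i] unfolding KK_group_def by blast
  moreover have "p i ** p (j - i) = p i" using ij p_add[of i "j - i"] by simp
  ultimately have "p (j - i) = mat 1" by (metis matrix_mul_assoc matrix_mul_lid)
  then have "has_period (j - i) x"
    using ij(1) by (auto simp: has_period_def simp flip: pv)
  then show ?thesis by (rule that)
qed

section \<open>The invariant Hermitian form\<close>

lemma KK_group_bij_right_mult:
  assumes G: "KK_group G" and x: "x \<in> G"
  shows "bij_betw (\<lambda>z. z ** x) G G"
proof -
  obtain y where y: "y \<in> G" "x ** y = mat 1" "y ** x = mat 1" using G x by (auto simp: KK_group_def)
  show ?thesis
    by (rule bij_betwI[of _ _ _ "\<lambda>z. z ** y"])
      (use G x y in \<open>auto simp: KK_group_def simp flip: matrix_mul_assoc\<close>)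
qed

definition herm :: "(complex^3^3) set \<Rightarrow> complex^3 \<Rightarrow> complex^3 \<Rightarrow> complex" where
  "herm G v w = (\<Sum>x\<in>G. \<Sum>i\<in>UNIV. cnj ((x *v v) $ i) * (x *v w) $ i)"

lemma herm_linear:
  "herm G v (w + w') = herm G v w + herm G v w'"
  "herm G v (w - w') = herm G v w - herm G v w'"
  "herm G v (c *s w) = c * herm G v w"
  "herm G v 0 = 0"
  by (simp_all add: herm_def matrix_vector_right_distrib matrix_vector_mult_diff_distrib vector_scalar_commute
      sum.distrib sum_subtractf sum_distrib_left algebra_simps)

lemma herm_cnj: "herm G w v = cnj (herm G v w)"
  by (simp add: herm_def mult.commute)

lemma herm_coordinates: "herm G v w = (\<Sum>j\<in>UNIV. herm G v (axis j 1) * w $ j)"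
proof -
  have "w = (w $ 1) *s axis 1 1 + (w $ 2) *s axis 2 1 + (w $ 3) *s axis 3 1"
    by (simp add: vec_eq_iff forall_3 axis_def)
  then have "herm G v w = herm G v ((w $ 1) *s axis 1 1 + (w $ 2) *s axis 2 1 + (w $ 3) *s axis 3 1)"
    by simp
  then show ?thesis by (simp add: herm_linear sum_3 mult.commute)
qed

lemma herm_self_nz:
  assumes G: "KK_group G" and "v \<noteq> 0"
  shows "herm G v v \<noteq> 0"
proof -
  define N where "N x = (\<Sum>i\<in>UNIV. (norm ((x *v v) $ i))\<^sup>2)" for x :: "complex^3^3"
  have herm_N: "herm G v v = of_real (\<Sum>x\<in>G. N x)"
    by (simp add: herm_def N_def complex_norm_square mult.commute del: of_real_power)
  have "(\<Sum>x\<in>G. N x) > 0"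
  proof (rule sum_pos2[of G "mat 1"])
    obtain i where "v $ i \<noteq> 0" using assms(2) by (auto simp: vec_eq_iff)
    then show "N (mat 1) > 0" unfolding N_def by (intro sum_pos2[of _ i]) auto
  qed (use G in \<open>auto simp: KK_group_def N_def intro: sum_nonneg\<close>)
  then show ?thesis unfolding herm_N of_real_eq_0_iff by simp
qed

lemma herm_invariant:
  assumes G: "KK_group G" and x: "x \<in> G"
  shows "herm G (x *v v) (x *v w) = herm G v w"
proof -
  from sum.reindex_bij_betw[OF KK_group_bij_right_mult[OF assms], of "\<lambda>z. \<Sum>i\<in>UNIV. cnj ((z *v v) $ i) * (z *v w) $ i"]
  show ?thesis by (simp add: herm_def matrix_vector_mul_assoc)
qed

lemma herm_KK:
  assumes G: "KK_group G" and "\<And>i. v $ i \<in> KK" "\<And>i. w $ i \<in> KK"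
  shows "herm G v w \<in> KK"
proof -
  have "(x *v u) $ i \<in> KK" if "x \<in> G" "\<And>i. u $ i \<in> KK" for x u i
    using G that by (auto simp: KK_group_def entries_in_def matrix_vector_mult_def)
  then show ?thesis unfolding herm_def using assms by (intro KK_sum KK_closed(3) KK_cnj) auto
qed

text \<open>The columns of \<open>P\<close> are orthogonal for the invariant form, so the (i, j)
  entry of the conjugated x is the form of p_i and x p_j divided by the nonzero value of the form at
  p_i. Moving x to the other side as its inverse swaps the indices; without normalization only the
  vanishing of entries is compared.\<close>

lemma orthogonal_basis:
  assumes G: "KK_group G"
    and v: "\<And>i. v $ i \<in> KK" "v \<noteq> 0" and w: "\<And>i. w $ i \<in> KK" "\<And>c. w \<noteq> c *s v"
  obtains P Q c where "KK_inverses P Q" "\<And>i. P $ i $ 1 = v $ i" "\<And>i. P $ i $ 2 = w $ i - c * v $ i"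
    "\<And>x y i j. x \<in> G \<Longrightarrow> y \<in> G \<Longrightarrow> x ** y = mat 1 \<Longrightarrow>
       (Q ** x ** P) $ i $ j = 0 \<longleftrightarrow> (Q ** y ** P) $ j $ i = 0"
proof -
  define c where "c = herm G v w / herm G v v"
  define w' where "w' = w - c *s v"
  have vv: "herm G v v \<noteq> 0" using herm_self_nz[OF G v(2)] .
  have vw': "herm G v w' = 0" using vv by (simp add: w'_def herm_linear c_def)
  have w'0: "w' \<noteq> 0" using w(2)[of c] by (simp add: w'_def)
  have cK: "c \<in> KK" unfolding c_def by (intro KK_closed(4) herm_KK G v w)
  have w'K: "w' $ i \<in> KK" for i
    unfolding w'_def by (simp add: cK v(1) w(1))
  define a where "a j = herm G v (axis j 1)" for j
  define b where "b j = herm G w' (axis j 1)" for j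
  have ax: "axis j (1::complex) $ i \<in> KK" for i j :: 3 by (simp add: axis_def)
  have abK: "a j \<in> KK" "b j \<in> KK" for j
    unfolding a_def b_def by (intro herm_KK G v w'K ax)+
  \<comment> \<open>The cross product of the coefficient vectors of the two functionals given by v
    and w', hence in the kernel of both.\<close>
  define z :: "complex^3" where "z = vector [a 2 * b 3 - a 3 * b 2, a 3 * b 1 - a 1 * b 3, a 1 * b 2 - a 2 * b 1]"
  have ha: "herm G v u = a 1 * u $ 1 + a 2 * u $ 2 + a 3 * u $ 3"
   and hb: "herm G w' u = b 1 * u $ 1 + b 2 * u $ 2 + b 3 * u $ 3" for u
    using herm_coordinates[of G v u] herm_coordinates[of G w' u] by (simp_all add: sum_3 a_def b_def)
  have vz: "herm G v z = 0" and wz: "herm G w' z = 0"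
    unfolding ha hb by (simp_all add: z_def algebra_simps)
  have zK: "z $ i \<in> KK" for i
    using exhaust_3[of i] abK by (auto simp: z_def)
  have z0: "z \<noteq> 0"
  proof
    assume "z = 0"
    then have cr: "a 2 * b 3 = a 3 * b 2" "a 3 * b 1 = a 1 * b 3" "a 1 * b 2 = a 2 * b 1"
      by (simp_all add: z_def vec_eq_iff forall_3)
    \<comment> \<open>A vanishing cross product makes the two functionals proportional; evaluated at
      w', which is orthogonal to v, this contradicts definiteness.\<close>
    have eq: "herm G v v * herm G w' u = herm G w' v * herm G v u" for u
      unfolding ha hb using cr by algebra
    have "herm G v v * herm G w' w' = 0" unfolding eq vw' by simp
    then show False using vv herm_self_nz[OF G w'0] by simp
  qed
  define p where "p j = (if j = 1 then v else if j = 2 then w' else z)" for j :: 3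
  have p0: "p j \<noteq> 0" for j using v(2) w'0 z0 by (simp add: p_def)
  have orth: "herm G (p i) (p j) = 0" if "i \<noteq> j" for i j
  proof -
    have "herm G w' v = 0" "herm G z v = 0" "herm G z w' = 0"
      using herm_cnj[of G w' v] herm_cnj[of G z v] herm_cnj[of G z w'] vw' vz wz by simp_all
    then show ?thesis
      using that vw' vz wz exhaust_3[of i] exhaust_3[of j] by (auto simp: p_def)
  qed
  define P :: "complex^3^3" where "P = (\<chi> i j. p j $ i)"
  have Pu: "P *v u = u $ 1 *s p 1 + u $ 2 *s p 2 + u $ 3 *s p 3" for u
    by (simp add: P_def mat_expand mult.commute)
  have hP: "herm G (p i) (P *v u) = herm G (p i) (p i) * u $ i" for i u
    unfolding Pu using exhaust_3[of i] by (auto simp: herm_linear orth)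
  have PK: "entries_in KK P"
    using v(1) w'K zK by (auto simp: entries_in_def P_def p_def)
  have "det P \<noteq> 0"
  proof (rule kernel_0_imp_det_nz)
    fix u assume "P *v u = 0"
    then have "herm G (p i) (p i) * u $ i = 0" for i
      using hP[of i u] by (simp add: herm_linear)
    then show "u = 0" using herm_self_nz[OF G p0] by (simp add: vec_eq_iff)
  qed
  then obtain Q where PQ: "KK_inverses P Q" using det_nz_imp_KK_inverses[OF PK] by blast
  have Pe: "P *v axis j 1 = p j" for j
    unfolding Pu using exhaust_3[of j] by (auto simp: axis_def)
  have hx: "herm G (p i) (x *v p j) = herm G (p i) (p i) * (Q ** x ** P) $ i $ j" for i j x
  proof -
    have "x *v p j = P *v ((Q ** x ** P) *v axis j 1)"
      by (simp add: matrix_vector_mul_assoc matrix_mul_assoc KK_inverses_cancel(1)[OF PQ] flip: Pe)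
        (use PQ in \<open>simp add: KK_inverses_def\<close>)
    then show ?thesis by (simp only: hP) (simp add: matrix_vector_mult_def axis_def if_distrib cong: if_cong)
  qed
  show ?thesis
  proof (rule that[OF PQ])
    show "P $ i $ 1 = v $ i" "P $ i $ 2 = w $ i - c * v $ i" for i
      by (simp_all add: P_def p_def w'_def)
    fix x y i j assume x: "x \<in> G" and y: "y \<in> G" and xy: "x ** y = mat 1"
    have yx: "y ** x = mat 1" using xy matrix_left_right_inverse[of x y] by simp
    have "herm G (p i) (x *v p j) = herm G (y *v p i) (p j)"
      using herm_invariant[OF G y, of "p i" "x *v p j"] by (simp add: matrix_vector_mul_assoc yx)
    then have "herm G (p i) (x *v p j) = 0 \<longleftrightarrow> herm G (p j) (y *v p i) = 0"
      using herm_cnj[of G "p j" "y *v p i"] by simp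
    then show "(Q ** x ** P) $ i $ j = 0 \<longleftrightarrow> (Q ** y ** P) $ j $ i = 0"
      unfolding hx using herm_self_nz[OF G p0] by simp
  qed
qed

section \<open>A criterion for rationality\<close>

lemma entries_in_Rats_inverse_3:
  assumes A: "entries_in \<rat> (A :: complex^3^3)"
  shows "entries_in \<rat> (inverse_3 A)"
proof -
  have ent: "A $ i $ j \<in> \<rat>" for i j using A by (simp add: entries_in_def)
  have "det A \<in> \<rat>" unfolding det_3 by (intro Rats_add Rats_diff Rats_mult ent)
  then show ?thesis
    unfolding entries_in_def inverse_3_def forall_3
    by (simp add: adjugate_3_def) (intro conjI Rats_diff Rats_mult Rats_divide ent)
qed

text \<open>Conjugation by \<open>L\<close> gives L x L^-1 = (L x C)(L C)^-1, a product of rational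
  matrices, although neither \<open>L\<close> nor \<open>C\<close> has to be rational.\<close>

lemma rationalizable_if_products_rational:
  assumes one: "mat 1 \<in> G" and L: "entries_in KK L" "det L \<noteq> 0" and C: "entries_in KK C" "det C \<noteq> 0"
    and rat: "\<And>x. x \<in> G \<Longrightarrow> entries_in \<rat> (L ** x ** C)"
  shows "rationalizable G"
proof -
  obtain L' C' where LL: "KK_inverses L L'" and CC: "KK_inverses C C'"
    using det_nz_imp_KK_inverses L C by metis
  have M: "entries_in \<rat> (L ** C)" using rat[OF one] by simp
  define N where "N = inverse_3 (L ** C)"
  have "det (L ** C) \<noteq> 0" using L C by (simp add: det_mul)
  then have N: "entries_in \<rat> N" "L ** C ** N = mat 1"
    using entries_in_Rats_inverse_3[OF M] mult_inverse_3 by (simp_all only: N_def)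
  have "N = C' ** (L' ** (L ** C ** N))"
    by (simp add: matrix_mul_assoc KK_inverses_cancel[OF LL] KK_inverses_cancel[OF CC])
      (use CC LL in \<open>simp add: KK_inverses_def KK_inverses_cancel flip: matrix_mul_assoc\<close>)
  then have N': "N = C' ** L'" by (simp add: N(2))
  have "entries_in \<rat> (L ** x ** L')" if "x \<in> G" for x
  proof -
    have "L ** x ** L' = (L ** x ** C) ** N"
      unfolding N' by (simp add: matrix_mul_assoc KK_inverses_cancel[OF CC])
    then show ?thesis
      using rat[OF that] N(1) by (simp add: entries_in_def matrix_matrix_mult_def sum_3)
  qed
  then show ?thesis
    unfolding rationalizable_def using KK_inverses_sym[OF LL] by blast
qed

lemma trace_conj:
  assumes "KK_inverses P Q" shows "trace (Q ** x ** P) = trace x"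
proof -
  have "trace (Q ** x ** P) = trace (P ** (Q ** x))" by (rule trace_mul_sym)
  then show ?thesis by (simp add: KK_inverses_cancel[OF assms])
qed

lemma det_conj:
  assumes "KK_inverses P Q" shows "det (Q ** x ** P) = det x"
proof -
  have "det Q * det P = 1"
    using assms det_mul[of Q P] by (simp add: KK_inverses_def)
  then show ?thesis by (simp add: det_mul mult_ac)
qed

text \<open>Up to the factor \<open>2 - d u\<close>, the matrix \<open>A\<^sup>2 - u A + 1\<close> is the projection to the first coordinate.\<close>

lemma trace_eigenprojection:
  fixes A X :: "'a::idom^3^3"
  assumes "A$2$1 = 0" "A$3$1 = 0" "A$1$2 = 0" "A$1$3 = 0" "A$1$1 = d" "d * d = 1" "det A = d" "trace A = d + u"
  shows "trace (X ** (A ** A)) - u * trace (X ** A) + trace X = (2 - u * d) * X$1$1"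
proof -
  have t: "A$2$2 + A$3$3 = u" using assms by (simp add: trace_def sum_3)
  have "d * (A$2$2 * A$3$3 - A$2$3 * A$3$2) = d * 1" using assms by (simp add: det_3 algebra_simps)
  then have dt: "A$2$2 * A$3$3 - A$2$3 * A$3$2 = 1"
    using assms(6) by (metis mult_cancel_left mult_zero_left zero_neq_one)
  have "trace (X ** (A ** A)) - u * trace (X ** A) + trace X - (2 - u * d) * X$1$1
    = (X$2$2 + X$3$3) * (1 - (A$2$2 * A$3$3 - A$2$3 * A$3$2)) + (d * d - 1) * X$1$1"
    unfolding t[symmetric] using assms(1-5)
    by (simp add: trace_def sum_3 matrix_matrix_mult_def algebra_simps)
  then show ?thesis by (simp add: dt assms(6))
qed

lemma KK_group_trace_int:
  assumes "KK_group G" "x \<in> G" shows "trace x \<in> \<int>"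
proof -
  obtain n where n: "has_period n x" using KK_group_period[OF assms] .
  show ?thesis
    by (rule KK_period_char_poly[OF _ n]) (use assms in \<open>auto simp: KK_group_def\<close>)
qed

text \<open>The polynomial X^2 - u X + 1 is the cofactor of X - d in the characteristic polynomial,
  so its value at \<open>A\<close> maps into the eigenspace. The trace of that value is 2 - d u,
  which is nonzero, so some standard basis vector has a nonzero image.\<close>

lemma simple_eigenvector:
  assumes A: "entries_in KK A" and d: "det A = of_int d" "d = 1 \<or> d = -1" and t: "trace A = of_int (d + u)"
    and m: "minor_sum A = of_int (1 + d * u)" and du: "d * u \<noteq> 2"
  obtains v where "v \<noteq> 0" "\<And>i. v $ i \<in> KK" "A *v v = of_int d *s v"
proof -
  define f where "f w = A *v (A *v w) - of_int u *s (A *v w) + w" for w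
  have eig: "A *v f w = of_int d *s f w" for w
    using Cayley_Hamilton_3[of A w] unfolding d t m f_def
    by (simp add: matrix_vector_right_distrib matrix_vector_mult_diff_distrib vector_scalar_commute
        vec_eq_iff algebra_simps)
  have "f (axis 1 1) $ 1 + f (axis 2 1) $ 2 + f (axis 3 1) $ 3
      = trace A * trace A - 2 * minor_sum A - of_int u * trace A + 3"
    unfolding f_def by (simp add: trace_def minor_sum_def mat_expand axis_def algebra_simps)
  also have "\<dots> = of_int (2 - d * u)"
    unfolding t m using d(2) by (auto simp: algebra_simps)
  finally have sm: "f (axis 1 1) $ 1 + f (axis 2 1) $ 2 + f (axis 3 1) $ 3 = of_int (2 - d * u)" .
  have "\<exists>j. f (axis j 1) \<noteq> 0"
  proof (rule ccontr)
    assume "\<not> ?thesis"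
    then have "of_int (2 - d * u) = (0::complex)" unfolding sm[symmetric] by simp
    then show False using du by (simp only: of_int_eq_0_iff)
  qed
  then obtain j where j: "f (axis j 1) \<noteq> 0" by blast
  have "(A *v w) $ i \<in> KK" if "\<And>i. w $ i \<in> KK" for w i
    using A that by (auto simp: entries_in_def matrix_vector_mult_def)
  moreover have "axis j (1::complex) $ i \<in> KK" for i by (simp add: axis_def)
  ultimately have "f (axis j 1) $ i \<in> KK" for i
    unfolding f_def by (auto intro!: KK_closed(1-3))
  then show ?thesis using that j eig by blast
qed

section \<open>Eigenvectors for simple rational eigenvalues\<close>

lemma KK_group_eigenvalue:
  assumes "KK_group G" "x \<in> G" "x *v v = c *s v" "v \<noteq> 0" "c \<in> KK"
  shows "c = 1 \<or> c = -1"
proof -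
  obtain n where "has_period n x" using KK_group_period[OF assms(1,2)] .
  then show ?thesis
    using eigenvalue_root_of_unity[OF _ assms(3,4)] KK_root_of_unity[OF assms(5)] by (auto simp: has_period_def)
qed

lemma KK_group_charD:
  assumes G: "KK_group G" and x: "x \<in> G"
  obtains d u :: int where "d = 1 \<or> d = -1" "-2 \<le> u" "u \<le> 2" "det x = of_int d"
    "trace x = of_int (d + u)" "minor_sum x = of_int (1 + d * u)"
    "d * u = 2 \<Longrightarrow> x = mat (of_int d)"
proof -
  obtain n where "has_period n x" using KK_group_period[OF assms] .
  moreover have "entries_in KK x" using assms by (simp add: KK_group_def)
  ultimately show ?thesis using KK_period_char_poly that by metis
qed

lemma column_eq_axis: "(A ** P) $ i $ j = (A *v (P *v axis j 1)) $ i"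
  by (simp add: matrix_vector_mul_assoc) (simp add: matrix_vector_mult_def axis_def if_distrib cong: if_cong)

lemma conj_column:
  assumes "KK_inverses P Q" "x *v (P *v axis j 1) = P *v a"
  shows "(Q ** x ** P) $ i $ j = a $ i"
  using assms(1) by (simp add: column_eq_axis assms(2) matrix_vector_mul_assoc KK_inverses_cancel[OF assms(1)]
      flip: matrix_vector_mul_assoc) (simp add: KK_inverses_def assms(2) matrix_vector_mul_assoc)

lemma mult_axis: "(P *v axis j (1::'a::semiring_1)) $ i = P $ i $ j"
  by (simp add: matrix_vector_mult_def axis_def if_distrib cong: if_cong)

text \<open>If \<open>v\<close> is not a common eigenvector, choose a basis \<open>v, y v, z v\<close> of the span of the orbit of \<open>v\<close>. The entries
  \<open>(x\<^sub>i x y\<^sub>j)\<^sub>1\<^sub>1\<close> are rational by the trace formula for the projection to \<open>v\<close>, so the group is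
  rational in a suitable basis.\<close>

lemma simple_eigenvector_common:
  assumes G: "KK_group G" and nonrat: "\<not> rationalizable G"
    and g: "g \<in> G" "d = 1 \<or> d = -1" "det g = of_int d" "trace g = of_int (d + u)" "d * u \<noteq> 2"
    and v: "v \<noteq> 0" "\<And>i. v $ i \<in> KK" "g *v v = of_int d *s v"
    and y: "y \<in> G"
  shows "\<exists>c. y *v v = c *s v"
proof (rule ccontr)
  assume "\<not> ?thesis"
  then have yv: "\<And>c. y *v v \<noteq> c *s v" by blast
  have closed: "x ** x' \<in> G" if "x \<in> G" "x' \<in> G" for x x' using that G by (simp add: KK_group_def)
  have one: "mat 1 \<in> G" using G by (simp add: KK_group_def)
  have yvK: "(y *v v) $ i \<in> KK" for i
    using G y v(2) by (auto simp: KK_group_def entries_in_def matrix_vector_mult_def)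
  obtain P Q c where PQ: "KK_inverses P Q" and P1: "\<And>i. P $ i $ 1 = v $ i"
    and P2: "\<And>i. P $ i $ 2 = (y *v v) $ i - c * v $ i"
    and zero: "\<And>x y i j. x \<in> G \<Longrightarrow> y \<in> G \<Longrightarrow> x ** y = mat 1 \<Longrightarrow>
       (Q ** x ** P) $ i $ j = 0 \<longleftrightarrow> (Q ** y ** P) $ j $ i = 0"
    using orthogonal_basis[OF G v(2,1) yvK yv] by metis
  have Pv: "P *v axis 1 1 = v" using P1 by (simp add: vec_eq_iff mult_axis)
  have Pw: "P *v axis 2 1 = y *v v - c *s v" using P2 by (simp add: vec_eq_iff mult_axis)
  define X where "X x = Q ** x ** P" for x
  note zeroX = zero[folded X_def]
  have X_mult: "X x ** X x' = X (x ** x')" for x x'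
    unfolding X_def by (rule conj_mult[OF PQ])
  have d2: "of_int d * of_int d = (1::complex)" using g(2) by auto
  obtain h where h: "h \<in> G" "g ** h = mat 1" "h ** g = mat 1" using G g(1) by (auto simp: KK_group_def)
  have hv: "h *v v = of_int d *s v"
  proof -
    have "v = h *v (g *v v)" by (simp add: matrix_vector_mul_assoc h)
    then have "v = of_int d *s (h *v v)" by (simp add: v(3) vector_scalar_commute)
    then have "of_int d *s v = (of_int d * of_int d) *s (h *v v)" by (metis vector_smult_assoc)
    then show ?thesis by (simp add: d2)
  qed
  have Pa: "P *v (a *s axis 1 1) = a *s v" for a by (simp add: vector_scalar_commute Pv)
  have g1: "X g $ i $ 1 = (of_int d *s axis 1 1) $ i" and h1: "X h $ i $ 1 = (of_int d *s axis 1 1) $ i" for i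
    unfolding X_def by (rule conj_column[OF PQ], simp add: Pv v(3) hv Pa)+
  have g0: "X g $ 2 $ 1 = 0" "X g $ 3 $ 1 = 0" "X g $ 1 $ 1 = of_int d" "X h $ 2 $ 1 = 0" "X h $ 3 $ 1 = 0"
    by (simp_all add: g1 h1 axis_def)
  \<comment> \<open>The inverse \<open>h\<close> also fixes the line, and its zero pattern is the
    transpose of that of \<open>g\<close>; so the first row of \<open>X g\<close> vanishes off the
    diagonal as well, as the projection formula demands.\<close>
  have g0': "X g $ 1 $ 2 = 0" "X g $ 1 $ 3 = 0"
    using zeroX[OF g(1) h(1,2)] g0 by blast+
  have rat: "X x $ 1 $ 1 \<in> \<rat>" if x: "x \<in> G" for x
  proof -
    have tr: "trace (X x) \<in> \<int>" if "x \<in> G" for x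
      unfolding X_def trace_conj[OF PQ] by (rule KK_group_trace_int[OF G that])
    have "trace (X x ** (X g ** X g)) - of_int u * trace (X x ** X g) + trace (X x) = (2 - of_int u * of_int d) * X x $ 1 $ 1"
      by (rule trace_eigenprojection)
        (use g0 g0' d2 in \<open>simp_all add: X_def det_conj[OF PQ] trace_conj[OF PQ] g(3,4)\<close>)
    then have "(2 - of_int u * of_int d) * X x $ 1 $ 1 \<in> \<int>"
      unfolding X_mult using tr closed x g(1) by (metis Ints_add Ints_diff Ints_mult Ints_of_int)
    then have "of_int (2 - u * d) * X x $ 1 $ 1 \<in> \<rat>" using Ints_subset_Rats by auto
    then have "(of_int (2 - u * d) * X x $ 1 $ 1) / of_int (2 - u * d) \<in> \<rat>" by (intro Rats_divide) auto
    moreover have "of_int (2 - u * d) \<noteq> (0::complex)"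
      using g(5) by (simp only: of_int_eq_0_iff) (simp add: mult.commute)
    ultimately show ?thesis by simp
  qed
  obtain yi where yi: "yi \<in> G" "y ** yi = mat 1" "yi ** y = mat 1" using G y by (auto simp: KK_group_def)
  have y1: "X y $ i $ 1 = (c *s axis 1 1 + axis 2 1) $ i" for i
    unfolding X_def by (rule conj_column[OF PQ]) (simp add: matrix_vector_right_distrib Pa Pv Pw)
  have Y: "X y $ 1 $ 1 = c" "X y $ 2 $ 1 = 1" "X y $ 3 $ 1 = 0" by (simp_all add: y1 axis_def)
  have Yi: "X yi $ 1 $ 2 \<noteq> 0" "X yi $ 1 $ 3 = 0"
    using zeroX[OF y yi(1,2), of 2 1] zeroX[OF y yi(1,2), of 3 1] Y by auto
  have XK: "X x $ i $ j \<in> KK" if "x \<in> G" for x i j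
    using KK_group_conj_by[OF G PQ] that by (auto simp: KK_group_def conj_by_def entries_in_def X_def)
  have GX: "conj_by P Q G = X ` G" by (simp add: conj_by_def X_def)
  have ratX: "rationalizable (X ` G)"
  \<comment> \<open>The orbit of v spans either the plane of the first two basis vectors or the
    whole space. In the first case the third basis vector spans an invariant line with eigenvalues
    +-1.\<close>
  proof (cases "\<forall>x\<in>G. X x $ 3 $ 1 = 0")
    case True
    have zeros: "X x $ 3 $ 1 = 0" "X x $ 3 $ 2 = 0" "X x $ 1 $ 3 = 0" "X x $ 2 $ 3 = 0" if x: "x \<in> G" for x
    proof -
      have *: "X x $ 3 $ 1 = 0 \<and> X x $ 3 $ 2 = 0" if "x \<in> G" for x
      proof -
        have "(X x ** X y) $ 3 $ 1 = 0" unfolding X_mult using True closed[OF that y] by blast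
        then show ?thesis using True that Y by (simp add: matrix_matrix_mult_def sum_3)
      qed
      obtain xi where "xi \<in> G" "x ** xi = mat 1" using G x by (auto simp: KK_group_def)
      with * x zeroX[OF x this] show "X x $ 3 $ 1 = 0" "X x $ 3 $ 2 = 0" "X x $ 1 $ 3 = 0" "X x $ 2 $ 3 = 0"
        by blast+
    qed
    \<comment> \<open>The first two rows of \<open>L\<close> are the first rows of 1 and
      \<open>X yi\<close>, the first two columns of \<open>C\<close> the first columns of 1 and
      \<open>X y\<close>; thus the entries of the upper left block of the product are (1, 1) entries
      of elements of the group.\<close>
    define L :: "complex^3^3" where "L = vector [vector [1, 0, 0], vector [X yi $ 1 $ 1, X yi $ 1 $ 2, 0], vector [0, 0, 1]]"
    define C :: "complex^3^3" where "C = vector [vector [1, c, 0], vector [0, 1, 0], vector [0, 0, 1]]"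
    show ?thesis
    proof (rule rationalizable_if_products_rational[of _ L C])
      show "entries_in KK L" "entries_in KK C"
        using XK[OF yi(1)] XK[OF y, of 1 1] Y by (simp_all add: entries_in_def forall_3 L_def C_def)
      show "det L \<noteq> 0" "det C \<noteq> 0" using Yi by (simp_all add: det_3 L_def C_def)
      have "X (mat 1) = mat 1" unfolding X_def using PQ by (simp add: KK_inverses_def)
      then show "mat 1 \<in> X ` G" using one by force
      fix x' assume "x' \<in> X ` G"
      then obtain x where x: "x \<in> G" "x' = X x" by auto
      have "X x *v axis 3 1 = X x $ 3 $ 3 *s axis 3 1"
        using zeros[OF x(1)] by (simp add: vec_eq_iff mult_axis forall_3) (simp add: axis_def)
      then have "X x $ 3 $ 3 = 1 \<or> X x $ 3 $ 3 = -1"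
        using KK_group_eigenvalue[OF KK_group_conj_by[OF G PQ, unfolded GX], of "X x" "axis 3 1"] x(1) XK
        by auto
      then have e33: "X x $ 3 $ 3 \<in> \<rat>" by auto
      have "(L ** X x ** C) $ 1 $ 1 = X x $ 1 $ 1" "(L ** X x ** C) $ 1 $ 2 = (X x ** X y) $ 1 $ 1"
        "(L ** X x ** C) $ 2 $ 1 = (X yi ** X x) $ 1 $ 1" "(L ** X x ** C) $ 2 $ 2 = (X yi ** X x ** X y) $ 1 $ 1"
        "(L ** X x ** C) $ 3 $ 3 = X x $ 3 $ 3" "(L ** X x ** C) $ 1 $ 3 = 0" "(L ** X x ** C) $ 2 $ 3 = 0"
        "(L ** X x ** C) $ 3 $ 1 = 0" "(L ** X x ** C) $ 3 $ 2 = 0"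
        using zeros[OF x(1)] Y Yi by (simp_all add: L_def C_def matrix_matrix_mult_def sum_3 algebra_simps)
      then show "entries_in \<rat> (L ** x' ** C)"
        unfolding x(2) entries_in_def forall_3 X_mult using rat closed x(1) y yi(1) e33 by simp
    qed
  next
    case False
    then obtain z where z: "z \<in> G" "X z $ 3 $ 1 \<noteq> 0" by blast
    \<comment> \<open>With a third translate \<open>z\<close> all rows of \<open>L\<close> and all
      columns of \<open>C\<close> are first rows and first columns of group elements, so every entry
      of L x C is a (1, 1) entry.\<close>
    obtain zi where zi: "zi \<in> G" "z ** zi = mat 1" "zi ** z = mat 1" using G z by (auto simp: KK_group_def)
    have Zi: "X zi $ 1 $ 3 \<noteq> 0" using zeroX[OF z(1) zi(1,2), of 3 1] z by auto
    define L :: "complex^3^3" where "L = vector [vector [1, 0, 0], vector [X yi $ 1 $ 1, X yi $ 1 $ 2, 0],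
        vector [X zi $ 1 $ 1, X zi $ 1 $ 2, X zi $ 1 $ 3]]"
    define C :: "complex^3^3" where "C = vector [vector [1, c, X z $ 1 $ 1], vector [0, 1, X z $ 2 $ 1], vector [0, 0, X z $ 3 $ 1]]"
    show ?thesis
    proof (rule rationalizable_if_products_rational[of _ L C])
      show "entries_in KK L" "entries_in KK C"
        using XK[OF yi(1)] XK[OF zi(1)] XK[OF z(1)] XK[OF y, of 1 1] Y by (simp_all add: entries_in_def forall_3 L_def C_def)
      show "det L \<noteq> 0" "det C \<noteq> 0" using Yi z(2) Zi by (simp_all add: det_3 L_def C_def)
      have "X (mat 1) = mat 1" unfolding X_def using PQ by (simp add: KK_inverses_def)
      then show "mat 1 \<in> X ` G" using one by force
      fix x' assume "x' \<in> X ` G"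
      then obtain x where x: "x \<in> G" "x' = X x" by auto
      have "(L ** X x ** C) $ 1 $ 1 = X x $ 1 $ 1" "(L ** X x ** C) $ 1 $ 2 = (X x ** X y) $ 1 $ 1"
        "(L ** X x ** C) $ 1 $ 3 = (X x ** X z) $ 1 $ 1"
        "(L ** X x ** C) $ 2 $ 1 = (X yi ** X x) $ 1 $ 1" "(L ** X x ** C) $ 2 $ 2 = (X yi ** X x ** X y) $ 1 $ 1"
        "(L ** X x ** C) $ 2 $ 3 = (X yi ** X x ** X z) $ 1 $ 1"
        "(L ** X x ** C) $ 3 $ 1 = (X zi ** X x) $ 1 $ 1" "(L ** X x ** C) $ 3 $ 2 = (X zi ** X x ** X y) $ 1 $ 1"
        "(L ** X x ** C) $ 3 $ 3 = (X zi ** X x ** X z) $ 1 $ 1"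
        using Y Yi by (simp_all add: L_def C_def matrix_matrix_mult_def sum_3 algebra_simps)
      then show "entries_in \<rat> (L ** x' ** C)"
        unfolding x(2) entries_in_def forall_3 X_mult using rat closed x(1) y yi(1) z(1) zi(1) by simp
    qed
  qed
  have "rationalizable G"
    by (rule rationalizable_conj_by[OF _ PQ]) (simp add: GX ratX)
  with nonrat show False by blast
qed

section \<open>Block-diagonal matrices and the block form of nonrational groups\<close>

definition blk :: "complex \<Rightarrow> complex^2^2 \<Rightarrow> complex^3^3" where
  "blk c M = vector [vector [c, 0, 0], vector [0, M$1$1, M$1$2], vector [0, M$2$1, M$2$2]]"

lemma blk_entries [simp]:
  "blk c M $ 1 $ 1 = c" "blk c M $ 1 $ 2 = 0" "blk c M $ 1 $ 3 = 0"
  "blk c M $ 2 $ 1 = 0" "blk c M $ 2 $ 2 = M$1$1" "blk c M $ 2 $ 3 = M$1$2"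
  "blk c M $ 3 $ 1 = 0" "blk c M $ 3 $ 2 = M$2$1" "blk c M $ 3 $ 3 = M$2$2"
  by (simp_all add: blk_def)

lemma blk_mult: "blk c M ** blk c' M' = blk (c * c') (M ** M')"
  by (simp add: mat_expand)

lemma blk_inject [simp]: "blk c M = blk c' M' \<longleftrightarrow> c = c' \<and> M = M'"
  by (auto simp: vec_eq_iff forall_3 forall_2)

lemma blk_1: "blk 1 (mat 1) = mat 1"
  by (simp add: mat_expand)

lemma det_blk: "det (blk c M) = c * det M"
  by (simp add: det_3 det_2 algebra_simps)

lemma trace_blk: "trace (blk c M) = c + trace M"
  by (simp add: trace_def sum_3 sum_2)

lemma entries_in_blk: "entries_in KK (blk c M) \<longleftrightarrow> c \<in> KK \<and> entries_in KK M"
  by (auto simp: entries_in_def forall_3 forall_2)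

lemma blk_if_zeros:
  assumes "A$1$2 = 0" "A$1$3 = 0" "A$2$1 = 0" "A$3$1 = 0"
  obtains c M where "A = blk c M"
  by (rule that[of "A$1$1" "vector [vector [A$2$2, A$2$3], vector [A$3$2, A$3$3]]"])
    (use assms in \<open>simp add: vec_eq_iff forall_3\<close>)

lemma nonrational_block_form:
  assumes G: "KK_group G" and nonrat: "\<not> rationalizable G"
  obtains P Q where "KK_inverses P Q"
    "\<And>x. x \<in> G \<Longrightarrow> \<exists>c M. Q ** x ** P = blk c M \<and> (c = 1 \<or> c = -1) \<and> det M = 1"
proof -
  have "\<exists>g\<in>G. \<forall>d. g \<noteq> mat (of_int d)"
  proof (rule ccontr)
    assume *: "\<not> (\<exists>g\<in>G. \<forall>d. g \<noteq> mat (of_int d))"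
    have "entries_in \<rat> (mat 1 ** x ** mat 1)" if x: "x \<in> G" for x
    proof -
      obtain d where "x = mat (of_int d)" using * x by blast
      then show ?thesis by (simp add: entries_in_def) (simp add: mat_def)
    qed
    moreover have "KK_inverses (mat 1) (mat 1)" by (simp add: KK_inverses_def)
    ultimately show False using nonrat unfolding rationalizable_def by blast
  qed
  then obtain g where g: "g \<in> G" "\<And>d. g \<noteq> mat (of_int d)" by blast
  obtain d u :: int where du: "d = 1 \<or> d = -1" "det g = of_int d" "trace g = of_int (d + u)"
    "minor_sum g = of_int (1 + d * u)" "d * u \<noteq> 2"
    using KK_group_charD[OF G g(1)] g(2) by metis
  have gK: "entries_in KK x" if "x \<in> G" for x using G that by (simp add: KK_group_def)
  obtain v where v: "v \<noteq> 0" "\<And>i. v $ i \<in> KK" "g *v v = of_int d *s v"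
    using simple_eigenvector[OF gK[OF g(1)] du(2,1,3,4,5)] by blast
  have common: "\<exists>c. y *v v = c *s v" if "y \<in> G" for y
    by (rule simple_eigenvector_common[OF G nonrat g(1) du(1,2,3,5) v that])
  have "\<exists>j. \<forall>c. axis j 1 \<noteq> c *s v"
  proof (rule ccontr)
    assume "\<not> ?thesis"
    then obtain a b where "axis 1 1 = a *s v" "axis 2 1 = b *s v" by metis
    then have "a * v $ 1 = 1" "a * v $ 2 = 0" "b * v $ 2 = 1" "b * v $ 1 = 0"
      by (simp_all add: vec_eq_iff forall_3 axis_def)
    then show False by auto
  qed
  then obtain j where j: "\<And>c. axis j 1 \<noteq> c *s v" by blast
  have jK: "axis j (1::complex) $ i \<in> KK" for i by (simp add: axis_def)
  obtain P Q c where PQ: "KK_inverses P Q" and P1: "\<And>i. P $ i $ 1 = v $ i"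
    and zero: "\<And>x y i j. x \<in> G \<Longrightarrow> y \<in> G \<Longrightarrow> x ** y = mat 1 \<Longrightarrow>
       (Q ** x ** P) $ i $ j = 0 \<longleftrightarrow> (Q ** y ** P) $ j $ i = 0"
    using orthogonal_basis[OF G v(2,1) jK j] by metis
  \<comment> \<open>Formulated for an arbitrary base change because it is applied to two bases: the
    one chosen above and the one adapted to a second eigenvector.\<close>
  have first: "(Q ** x ** P) $ i $ 1 = 0 \<and> (Q ** x ** P) $ 1 $ i = 0"
    if "KK_inverses P Q" "\<And>i. P $ i $ 1 = v $ i" "x \<in> G" "i \<noteq> 1"
      "\<And>x y i j. x \<in> G \<Longrightarrow> y \<in> G \<Longrightarrow> x ** y = mat 1 \<Longrightarrow>
       (Q ** x ** P) $ i $ j = 0 \<longleftrightarrow> (Q ** y ** P) $ j $ i = 0" for P Q x i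
  proof -
    have Pv: "P *v axis 1 1 = v" using that(2) by (simp add: vec_eq_iff mult_axis)
    have *: "(Q ** x ** P) $ i $ 1 = 0" if x: "x \<in> G" for x
    proof -
      obtain a where "x *v v = a *s v" using common[OF x] by blast
      then have "x *v (P *v axis 1 1) = P *v (a *s axis 1 1)" by (simp add: vector_scalar_commute Pv)
      from conj_column[OF \<open>KK_inverses P Q\<close> this, of i] show ?thesis using \<open>i \<noteq> 1\<close> by (simp add: axis_def)
    qed
    obtain y where "y \<in> G" "x ** y = mat 1" using G \<open>x \<in> G\<close> by (auto simp: KK_group_def)
    then show ?thesis using * that(3,5) by blast
  qed
  have eig: "a = 1 \<or> a = -1" if "KK_inverses P Q" "x \<in> G" "(Q ** x ** P) *v axis i 1 = a *s axis i 1" for P Q x a i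
  proof -
    have GP: "KK_group (conj_by P Q G)" by (rule KK_group_conj_by[OF G that(1)])
    have xP: "Q ** x ** P \<in> conj_by P Q G" using that(2) by (simp add: conj_by_def)
    have "(Q ** x ** P) $ i $ i = a"
      using arg_cong[OF that(3), of "\<lambda>v. v $ i"] by (simp add: mult_axis)
    then have "a \<in> KK" using GP xP by (auto simp: KK_group_def entries_in_def)
    then show ?thesis using KK_group_eigenvalue[OF GP xP that(3)] by simp
  qed
  show ?thesis
  proof (rule that[OF PQ])
    fix x assume x: "x \<in> G"
    have "(Q ** x ** P) $ i $ 1 = 0 \<and> (Q ** x ** P) $ 1 $ i = 0" if "i \<noteq> 1" for i
      by (rule first[OF PQ P1 x that zero])
    from this[of 2] this[of 3] obtain a M where aM: "Q ** x ** P = blk a M"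
      using blk_if_zeros[of "Q ** x ** P"] by auto
    have "(Q ** x ** P) *v axis 1 1 = a *s axis 1 1"
      unfolding aM by (simp add: vec_eq_iff forall_3 mult_axis) (simp add: axis_def)
    then have a: "a = 1 \<or> a = -1" by (rule eig[OF PQ x])
    obtain d u :: int where du: "d = 1 \<or> d = -1" "det x = of_int d" "trace x = of_int (d + u)"
      "minor_sum x = of_int (1 + d * u)" "d * u = 2 \<Longrightarrow> x = mat (of_int d)"
      using KK_group_charD[OF G x] by metis
    have adM: "a * det M = of_int d" using det_conj[OF PQ, of x] by (simp add: aM det_blk du(2))
    have "det M = 1"
    \<comment> \<open>If det M = -1, then x acts on v by -det x. Its simple eigenvector for det x is
      therefore a second line, and it is common to the whole group by the same argument as
      v.\<close>
    proof (rule ccontr)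
      assume "det M \<noteq> 1"
      then have ad: "a = - of_int d" using adM a du(1) by auto
      have Pv: "P *v axis 1 1 = v" using P1 by (simp add: vec_eq_iff mult_axis)
      have xv: "x *v v = - of_int d *s v"
      proof -
        obtain b where b: "x *v v = b *s v" using common[OF x] by blast
        then have "x *v (P *v axis 1 1) = P *v (b *s axis 1 1)" by (simp add: vector_scalar_commute Pv)
        from conj_column[OF PQ this, of 1] have "a = b" by (simp add: aM axis_def)
        then show ?thesis using b ad by simp
      qed
      have du2: "d * u \<noteq> 2"
      proof
        assume "d * u = 2"
        then have "x *v v = of_int d *s v" using du(5) by (simp add: mat_expand)
        then have "of_int d *s v = - of_int d *s v" using xv by simp
        then have "of_int (2 * d) *s v = 0" by (simp add: vec_eq_iff)
        then show False using du(1) v(1) by (auto simp: vec_eq_iff)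
      qed
      obtain v' where v': "v' \<noteq> 0" "\<And>i. v' $ i \<in> KK" "x *v v' = of_int d *s v'"
        using simple_eigenvector[OF gK[OF x] du(2,1,3,4) du2] by blast
      have common': "\<exists>c. y *v v' = c *s v'" if "y \<in> G" for y
        by (rule simple_eigenvector_common[OF G nonrat x du(1,2,3) du2 v' that])
      have indep: "v' \<noteq> b *s v" for b
      proof
        assume v'b: "v' = b *s v"
        then have "x *v v' = b *s (x *v v)" by (simp add: vector_scalar_commute)
        then have "of_int d *s v' = b *s (- of_int d *s v)" by (simp only: v'(3) xv)
        also have "\<dots> = - of_int d *s v'" by (simp add: v'b vec_eq_iff)
        finally have "of_int d *s v' = - of_int d *s v'" .
        then have "of_int (2 * d) *s v' = 0" by (simp add: vec_eq_iff)
        then show False using du(1) v'(1) by (auto simp: vec_eq_iff)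
      qed
      obtain P' Q' c' where PQ': "KK_inverses P' Q'" and P1': "\<And>i. P' $ i $ 1 = v $ i"
        and P2': "\<And>i. P' $ i $ 2 = v' $ i - c' * v $ i"
        and zero': "\<And>x y i j. x \<in> G \<Longrightarrow> y \<in> G \<Longrightarrow> x ** y = mat 1 \<Longrightarrow>
           (Q' ** x ** P') $ i $ j = 0 \<longleftrightarrow> (Q' ** y ** P') $ j $ i = 0"
        using orthogonal_basis[OF G v(2,1) v'(2) indep] by metis
      have Pv': "P' *v axis 1 1 = v" "P' *v axis 2 1 = v' - c' *s v"
        using P1' P2' by (simp_all add: vec_eq_iff mult_axis)
      have "entries_in \<rat> (Q' ** y ** P')" if y: "y \<in> G" for y
      proof -
        have f: "(Q' ** y ** P') $ i $ 1 = 0 \<and> (Q' ** y ** P') $ 1 $ i = 0" if "i \<noteq> 1" for i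
          by (rule first[OF PQ' P1' y that zero'])
        \<comment> \<open>The first two columns of \<open>P'\<close> span both common eigenlines, so
          this plane is invariant; the entry (2, 3) then vanishes by the zero pattern of the
          inverse.\<close>
        have f32: "(Q' ** y ** P') $ 3 $ 2 = 0" if y: "y \<in> G" for y
        proof -
          obtain b where b: "y *v v' = b *s v'" using common'[OF y] by blast
          obtain b' where b': "y *v v = b' *s v" using common[OF y] by blast
          have "y *v (P' *v axis 2 1) = P' *v ((c' * (b - b')) *s axis 1 1 + b *s axis 2 1)"
            unfolding matrix_vector_right_distrib vector_scalar_commute Pv' matrix_vector_mult_diff_distrib b b'
            by (simp add: vec_eq_iff algebra_simps)
          from conj_column[OF PQ' this, of 3] show ?thesis by (simp add: axis_def)
        qed
        obtain yi where "yi \<in> G" "y ** yi = mat 1" using G y by (auto simp: KK_group_def)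
        then have f23: "(Q' ** y ** P') $ 2 $ 3 = 0" using zero'[OF y] f32 by blast
        have "(Q' ** y ** P') *v axis i 1 = (Q' ** y ** P') $ i $ i *s axis i 1" for i
          using exhaust_3[of i] f f32[OF y] f23
          by (auto simp: vec_eq_iff forall_3 mult_axis) (auto simp: axis_def)
        then have "(Q' ** y ** P') $ i $ i = 1 \<or> (Q' ** y ** P') $ i $ i = -1" for i
          by (rule eig[OF PQ' y])
        then have "(Q' ** y ** P') $ i $ i \<in> \<rat>" for i by (metis Rats_1 Rats_minus_iff)
        then show ?thesis using f f32[OF y] f23 by (simp add: entries_in_def forall_3)
      qed
      then show False using nonrat PQ' by (auto simp: rationalizable_def)
    qed
    then show "\<exists>c M. Q ** x ** P = blk c M \<and> (c = 1 \<or> c = -1) \<and> det M = 1"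
      using aM a by blast
  qed
qed

section \<open>Finite subgroups of the special linear group of degree two\<close>

definition inv2 :: "'a::comm_ring_1^2^2 \<Rightarrow> 'a^2^2" where
  "inv2 M = vector [vector [M$2$2, - M$1$2], vector [- M$2$1, M$1$1]]"

lemma vector2_entries [simp]:
  "(vector [vector [a, b], vector [c, d]] :: 'a::zero^2^2) $ 1 $ 1 = a"
  "(vector [vector [a, b], vector [c, d]] :: 'a::zero^2^2) $ 1 $ 2 = b"
  "(vector [vector [a, b], vector [c, d]] :: 'a::zero^2^2) $ 2 $ 1 = c"
  "(vector [vector [a, b], vector [c, d]] :: 'a::zero^2^2) $ 2 $ 2 = d"
  by simp_all

lemma trace_2: "trace (M :: 'a::semiring_1^2^2) = M$1$1 + M$2$2"
  by (simp add: trace_def sum_2)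

lemma inv2_mult: "inv2 M ** M = mat (det M)" "M ** inv2 M = mat (det M)"
  by (simp_all add: mat_expand inv2_def det_2 algebra_simps)

lemma inv2_unique: "det M = 1 \<Longrightarrow> M ** N = mat 1 \<Longrightarrow> N = inv2 M"
  using inv2_mult(1)[of M] by (metis matrix_mul_assoc matrix_mul_lid matrix_mul_rid)

text \<open>Finiteness is replaced by its consequences for traces, with +-1 as the only elements of
  trace +-2. No bound on the size is needed to classify such sets.\<close>

definition sl2_set :: "(complex^2^2) set \<Rightarrow> bool" where
  "sl2_set H \<longleftrightarrow> mat 1 \<in> H \<and> (\<forall>x\<in>H. \<forall>y\<in>H. x ** y \<in> H) \<and> (\<forall>x\<in>H. inv2 x \<in> H) \<and>
     (\<forall>x\<in>H. det x = 1 \<and> entries_in KK x) \<and>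
     (\<forall>x\<in>H. trace x \<in> {-2, -1, 0, 1, 2} \<and> (trace x = 2 \<longrightarrow> x = mat 1) \<and> (trace x = -2 \<longrightarrow> x = - mat 1))"

lemma trace_mult_inv2: "trace (x ** y) + trace (inv2 x ** y) = trace x * trace (y :: 'a::comm_ring_1^2^2)"
  by (simp add: mat_expand inv2_def trace_2 algebra_simps)

lemma trace_square_2: "trace (x ** x) = trace x * trace x - 2 * det (x :: 'a::comm_ring_1^2^2)"
  by (simp add: mat_expand trace_2 det_2 algebra_simps)

lemma trace_minus: "trace (- x) = - trace (x :: 'a::ring_1^'n^'n)"
  by (simp add: trace_def sum_negf)

lemma trace0_square:
  fixes x :: "'a::idom^2^2"
  assumes "trace x = 0" "det x = 1" shows "x ** x = - mat 1"
proof -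
  from assms have "x$2$2 = - x$1$1" "x$1$1 * x$2$2 - x$1$2 * x$2$1 = 1"
    by (simp_all add: trace_2 det_2 add_eq_0_iff)
  then show ?thesis by (simp add: mat_expand) algebra
qed

lemma matrix_minus_mult: "- A ** B = - (A ** (B :: 'a::ring_1^'n^'m))" "A ** - B = - (A ** (B :: 'a::ring_1^'n^'m))"
  by (simp_all add: vec_eq_iff matrix_matrix_mult_def sum_negf)

text \<open>In the last case \<open>a\<close> and \<open>b\<close> generate the quaternion group (\<open>u = 0\<close>) or the dicyclic group of order \<open>12\<close>
  (\<open>u = -1\<close>).\<close>

lemma sl2_set_cases:
  assumes H: "sl2_set H"
  obtains (scalar) "\<And>x. x \<in> H \<Longrightarrow> x = mat 1 \<or> x = - mat 1"
  | (cyclic) a u where "a \<in> H" "trace a = u" "u \<in> {-1, 0, 1}"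
      "\<And>x. x \<in> H \<Longrightarrow> \<exists>p\<in>\<rat>. \<exists>q\<in>\<rat>. x = mat p + mat q ** a"
  | (pair) a b u where "a \<in> H" "b \<in> H" "trace a = u" "u \<in> {-1, 0}" "trace b = 0" "trace (a ** b) = 0"
proof -
  have mult: "x ** y \<in> H" if "x \<in> H" "y \<in> H" for x y using H that by (simp add: sl2_set_def)
  have inv: "inv2 x \<in> H" if "x \<in> H" for x using H that by (simp add: sl2_set_def)
  have det1: "det x = 1" if "x \<in> H" for x using H that by (simp add: sl2_set_def)
  have tr: "trace x \<in> {-2, -1, 0, 1, 2}" if "x \<in> H" for x using H that unfolding sl2_set_def by blast
  have tr2: "x = mat 1" if "x \<in> H" "trace x = 2" for x using H that by (simp add: sl2_set_def)
  have trm2: "x = - mat 1" if "x \<in> H" "trace x = -2" for x using H that by (simp add: sl2_set_def)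
  have lin: "\<exists>p\<in>\<rat>. \<exists>q\<in>\<rat>. x = mat p + mat q ** a"
    if "x \<in> {mat 1, - mat 1, a, - a, inv2 a, - inv2 a}" "trace a \<in> {-1, 0, 1}" for x a :: "complex^2^2"
  proof -
    have ta: "a$2$2 = trace a - a$1$1" by (simp add: trace_2)
    have "trace a \<in> \<rat>" using that(2) by auto
    have "x = mat 1 + mat 0 ** a \<or> x = mat (-1) + mat 0 ** a \<or> x = mat 0 + mat 1 ** a \<or>
        x = mat 0 + mat (-1) ** a \<or> x = mat (trace a) + mat (-1) ** a \<or> x = mat (- trace a) + mat 1 ** a"
      using that(1) by (auto simp: mat_expand inv2_def ta)
    then show ?thesis using \<open>trace a \<in> \<rat>\<close>
      by (elim disjE; intro bexI) (assumption | simp)+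
  qed
  show ?thesis
  proof (cases "\<exists>i\<in>H. trace i = 0")
    case False
    show ?thesis
    proof (cases "\<forall>x\<in>H. x = mat 1 \<or> x = - mat 1")
      case True then show ?thesis using scalar by blast
    next
      case False': False
      then obtain a where a: "a \<in> H" "a \<noteq> mat 1" "a \<noteq> - mat 1" by blast
      have tr_pm: "trace x \<in> {-1, 1}" if "x \<in> H" "x \<noteq> mat 1" "x \<noteq> - mat 1" for x
        using tr[OF that(1)] tr2[OF that(1)] trm2[OF that(1)] that False by auto
      have "x \<in> {mat 1, - mat 1, a, - a, inv2 a, - inv2 a}" if x: "x \<in> H" for x
      proof (cases "x = mat 1 \<or> x = - mat 1")
        case False
        \<comment> \<open>A parity argument: tr(a x) + tr(a^-1 x) = tr a tr x is odd, while two
          elements other than +-1 have odd traces with even sum. So one of the two products is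
          +-1.\<close>
        have odd: "trace (a ** x) + trace (inv2 a ** x) \<in> {-1, 1}"
          unfolding trace_mult_inv2 using tr_pm[OF a] tr_pm[OF x] False by auto
        have "a ** x \<in> {mat 1, - mat 1} \<or> inv2 a ** x \<in> {mat 1, - mat 1}"
        proof (rule ccontr)
          assume "\<not> ?thesis"
          then have "trace (a ** x) \<in> {-1, 1}" "trace (inv2 a ** x) \<in> {-1, 1}"
            using tr_pm[of "a ** x"] tr_pm[of "inv2 a ** x"] mult inv a x by auto
          then show False using odd by auto
        qed
        moreover have "x = inv2 a ** (a ** x)" "x = a ** (inv2 a ** x)"
          by (simp_all add: matrix_mul_assoc inv2_mult det1[OF a(1)])
        ultimately show ?thesis
          by (elim disjE insertE) (auto simp: matrix_minus_mult)
      qed auto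
      then show ?thesis
        using cyclic[of a "trace a"] a(1) tr_pm[OF a] lin by blast
    qed
  next
    case True
    then obtain i where i: "i \<in> H" "trace i = 0" by blast
    have ii: "i ** i = - mat 1" using trace0_square i det1 by blast
    have m1: "- mat 1 \<in> H" using mult[OF i(1) i(1)] ii by simp
    have neg: "- x \<in> H" if "x \<in> H" for x using mult[OF m1 that] by (simp add: matrix_minus_mult)
    have iix: "i ** (i ** x) = - x" for x by (simp add: matrix_mul_assoc ii matrix_minus_mult)
    show ?thesis
    proof (cases "\<exists>j\<in>H. trace j = 0 \<and> j \<noteq> i \<and> j \<noteq> - i")
      case True
      then obtain j where j: "j \<in> H" "trace j = 0" "j \<noteq> i" "j \<noteq> - i" by blast
      have ij: "i ** j \<in> H" using mult i j by blast
      have "trace (i ** j) \<noteq> 2" "trace (i ** j) \<noteq> -2"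
        using tr2[OF ij] trm2[OF ij] iix[of j] j(3,4) by (auto simp: matrix_minus_mult)
      then consider "trace (i ** j) = 0" | "trace (i ** j) = 1" | "trace (i ** j) = -1"
        using tr[OF ij] by auto
      then show ?thesis
      proof cases
        case 1 then show ?thesis using pair[of i j 0] i j by simp
      next
        case 2
        \<comment> \<open>The trace of i j i equals that of i i j = -j, which is 0; so
          \<open>i\<close> is a suitable second member for i j, and the sign only moves the trace of
          the first member from 1 to -1.\<close>
        have "trace (- (i ** j) ** i) = trace (i ** (i ** j)) * -1"
          by (simp add: mat_expand trace_2 algebra_simps)
        then have "trace (- (i ** j) ** i) = 0" using j(2) by (simp add: iix trace_2 add_eq_0_iff2)
        moreover have "trace (- (i ** j)) = -1" using 2 by (simp add: trace_2 algebra_simps)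
        ultimately show ?thesis using pair[of "- (i ** j)" i "-1"] neg[OF ij] i by simp
      next
        case 3
        have "trace ((i ** j) ** i) = trace (i ** (i ** j))"
          by (simp add: mat_expand trace_2 algebra_simps)
        then have "trace ((i ** j) ** i) = 0" using j(2) by (simp add: iix trace_2 add_eq_0_iff2)
        then show ?thesis using pair[of "i ** j" i "-1"] ij i 3 by simp
      qed
    next
      case False
      have "x \<in> {mat 1, - mat 1, i, - i}" if x: "x \<in> H" for x
      proof (rule ccontr)
        assume nx: "x \<notin> {mat 1, - mat 1, i, - i}"
        have tx: "trace x \<in> {-1, 1}"
          using tr[OF x] tr2[OF x] trm2[OF x] nx False x by auto
        have ix: "i ** x \<in> H" using mult i x by blast
        have "i ** x \<noteq> mat 1" "i ** x \<noteq> - mat 1" "i ** x \<noteq> i" "i ** x \<noteq> - i"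
          using iix[of x] nx ii by (auto simp: matrix_minus_mult)
        then have tix: "trace (i ** x) \<in> {-1, 1}"
          using tr[OF ix] tr2[OF ix] trm2[OF ix] False ix by auto
        \<comment> \<open>The conjugate of \<open>i\<close> by \<open>x\<close> has trace 0, so it
          is +-i and tr(i y) = +-2. Expanding by trace identities gives -(tr x)^2 - (tr(i x))^2 + 2
          = 0 instead.\<close>
        define y where "y = x ** (i ** inv2 x)"
        have yH: "y \<in> H" unfolding y_def using mult inv i x by blast
        have "trace y = trace i * det x" unfolding y_def
          by (simp add: mat_expand trace_2 det_2 inv2_def algebra_simps)
        then have "y = i \<or> y = - i" using False yH i(2) by auto
        then have "trace (i ** y) = -2 \<or> trace (i ** y) = 2" by (auto simp: ii matrix_minus_mult trace_2 mat_def)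
        moreover have "trace (i ** y) = trace x * trace (i ** (i ** x)) - trace ((i ** x) ** (i ** x))"
          unfolding y_def by (simp add: mat_expand trace_2 inv2_def algebra_simps)
        moreover have "trace ((i ** x) ** (i ** x)) = trace (i ** x) * trace (i ** x) - 2"
          unfolding trace_square_2 det1[OF ix] by simp
        ultimately show False using tx tix by (auto simp: iix trace_minus)
      qed
      then show ?thesis
        using cyclic[of i 0] i lin[of _ i] by blast
    qed
  qed
qed

text \<open>The expression is the determinant with columns w and a w. If it vanished, w would be an
  eigenvector whose eigenvalue in K satisfies l^2 - u l + 1 = 0, of discriminant -4 or -3.\<close>

lemma no_KK_eigenvector:
  fixes a :: "complex^2^2"
  assumes a: "entries_in KK a" "det a = 1" "trace a \<in> {-1, 0, 1}"
    and w: "w \<noteq> 0" "\<And>i. w $ i \<in> KK"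
  shows "w $ 1 * (a *v w) $ 2 - w $ 2 * (a *v w) $ 1 \<noteq> 0"
proof
  assume eq: "w $ 1 * (a *v w) $ 2 - w $ 2 * (a *v w) $ 1 = 0"
  have aK: "a $ i $ j \<in> KK" for i j using a(1) by (simp add: entries_in_def)
  define av where "av = a *v w"
  have av: "av $ 1 = a$1$1 * w$1 + a$1$2 * w$2" "av $ 2 = a$2$1 * w$1 + a$2$2 * w$2"
    by (simp_all add: av_def mat_expand)
  have avK: "av $ i \<in> KK" for i using exhaust_2[of i] aK w(2) by (auto simp: av)
  define u where "u = trace a"
  have a22: "a$2$2 = u - a$1$1" by (simp add: u_def trace_2)
  obtain l where l: "l \<in> KK" "av $ 1 = l * w $ 1" "av $ 2 = l * w $ 2"
  proof (cases "w $ 1 = 0")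
    case True
    then have "w $ 2 \<noteq> 0" using w(1) by (auto simp: vec_eq_iff forall_2)
    then show ?thesis using eq True avK w(2)
      by (intro that[of "av $ 2 / w $ 2"]) (auto simp flip: av_def)
  next
    case False
    then show ?thesis using eq avK w(2)
      by (intro that[of "av $ 1 / w $ 1"]) (auto simp: field_simps simp flip: av_def)
  qed
  have dt: "a$1$1 * (u - a$1$1) - a$1$2 * a$2$1 = 1" using a(2) by (simp add: det_2 a22)
  have "(l * l - u * l + 1) * w $ 1 = 0" "(l * l - u * l + 1) * w $ 2 = 0"
    using l(2,3) dt unfolding av a22 by algebra+
  then have ll: "l * l - u * l + 1 = 0" using w(1) by (auto simp: vec_eq_iff forall_2)
  have "u = -1 \<or> u = 0 \<or> u = 1" using a(3) by (auto simp: u_def)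
  then show False
  proof (elim disjE)
    assume u: "u = 0"
    then have "l * l = -1" using ll by (simp add: add_eq_0_iff2)
    then show False using KK_no_sqrt(1)[OF l(1)] by simp
  next
    assume u: "u = -1"
    have "(2 * l + 1) * (2 * l + 1) = -3" using ll unfolding u by algebra
    moreover have "2 * l + 1 \<in> KK" using l(1) by auto
    ultimately show False using KK_no_sqrt(2) by blast
  next
    assume u: "u = 1"
    have "(2 * l - 1) * (2 * l - 1) = -3" using ll unfolding u by algebra
    moreover have "2 * l - 1 \<in> KK" using l(1) by auto
    ultimately show False using KK_no_sqrt(2) by blast
  qed
qed

section \<open>Krylov bases and the normal form of a pair\<close>

definition companion :: "complex \<Rightarrow> complex^2^2" where
  "companion u = vector [vector [0, -1], vector [1, u]]"

text \<open>The second column is forced by the first when both \<open>b\<close> and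
  \<open>a ** b\<close> have trace 0. The determinant is -(p^2 + u p q + q^2), which is the origin
  of the norm equation.\<close>

definition partner :: "complex \<Rightarrow> complex \<Rightarrow> complex \<Rightarrow> complex^2^2" where
  "partner u p q = vector [vector [p, u * p + q], vector [q, - p]]"

definition krylov :: "complex^2^2 \<Rightarrow> complex^2 \<Rightarrow> complex^2^2" where
  "krylov a w = vector [vector [w $ 1, (a *v w) $ 1], vector [w $ 2, (a *v w) $ 2]]"

lemma krylov_KK:
  assumes "entries_in KK a" "\<And>i. w $ i \<in> KK" shows "entries_in KK (krylov a w)"
  using assms by (auto simp: entries_in_def forall_2 krylov_def matrix_vector_mult_def sum_2)

lemma krylov_companion:
  assumes "det a = 1" shows "a ** krylov a w = krylov a w ** companion (trace a)"
proof -
  have a: "a$1$1 * a$2$2 - a$1$2 * a$2$1 = 1" using assms by (simp add: det_2)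
  show ?thesis using a
    by (simp add: mat_expand krylov_def companion_def trace_2) algebra
qed

lemma krylov_partner:
  assumes a: "det a = 1" and b: "trace b = 0" "trace (a ** b) = 0" and w: "b *v w = p *s w + q *s (a *v w)"
  shows "b ** krylov a w = krylov a w ** partner (trace a) p q"
proof -
  have "a$1$1 * a$2$2 - a$1$2 * a$2$1 = 1" "b$2$2 = - b$1$1"
    "a$1$1 * b$1$1 + a$1$2 * b$2$1 + a$2$1 * b$1$2 + a$2$2 * b$2$2 = 0"
    "b$1$1 * w$1 + b$1$2 * w$2 = p * w$1 + q * (a$1$1 * w$1 + a$1$2 * w$2)"
    "b$2$1 * w$1 + b$2$2 * w$2 = p * w$2 + q * (a$2$1 * w$1 + a$2$2 * w$2)"
    using assms by (auto simp: mat_expand det_2 trace_2 add_eq_0_iff2 algebra_simps)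
  then show ?thesis
    by (simp add: mat_expand krylov_def partner_def trace_2) algebra
qed

text \<open>The sought w lies in the kernel of E = b - p - q a. The norm equation makes det E = 0,
  and tr E = -(2 p + u q) is nonzero, so the kernel is a line over K; w and a w are independent
  because a has no eigenvector there.\<close>

lemma normal_form_pair:
  assumes a: "entries_in KK a" "det a = 1" "trace a = u" "u \<in> {-1, 0, 1}"
    and b: "entries_in KK b" "det b = 1" "trace b = 0" "trace (a ** b) = 0"
    and pq: "p \<in> KK" "q \<in> KK" "p * p + u * p * q + q * q = -1" "2 * p + u * q \<noteq> 0"
  obtains C where "entries_in KK C" "det C \<noteq> 0" "a ** C = C ** companion u" "b ** C = C ** partner u p q"
proof -
  have aK: "a $ i $ j \<in> KK" and bK: "b $ i $ j \<in> KK" for i j using a b by (auto simp: entries_in_def)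
  define e11 where "e11 = b$1$1 - p - q * a$1$1"
  define e12 where "e12 = b$1$2 - q * a$1$2"
  define e21 where "e21 = b$2$1 - q * a$2$1"
  define e22 where "e22 = b$2$2 - p - q * a$2$2"
  have deta: "a$1$1 * a$2$2 - a$1$2 * a$2$1 = 1" and detb: "b$1$1 * b$2$2 - b$1$2 * b$2$1 = 1"
    and tra: "a$1$1 + a$2$2 = u" and trb: "b$1$1 + b$2$2 = 0"
    and trab: "a$1$1 * b$1$1 + a$1$2 * b$2$1 + (a$2$1 * b$1$2 + a$2$2 * b$2$2) = 0"
    using a b by (simp_all add: det_2 trace_2 matrix_matrix_mult_def sum_2)
  have det0: "e11 * e22 - e12 * e21 = 0"
    unfolding e11_def e12_def e21_def e22_def using deta detb tra trb trab pq(3) by algebra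
  have tr0: "e11 + e22 \<noteq> 0"
  proof
    assume "e11 + e22 = 0"
    then have "2 * p + u * q = 0" unfolding e11_def e22_def using tra trb by algebra
    then show False using pq(4) by simp
  qed
  have eK: "e11 \<in> KK" "e12 \<in> KK" "e21 \<in> KK" "e22 \<in> KK"
    unfolding e11_def e12_def e21_def e22_def using aK bK pq by blast+
  \<comment> \<open>As the trace of E is nonzero, at least one diagonal entry is, and a column of
    the adjugate with a nonzero entry serves as kernel vector.\<close>
  obtain w :: "complex^2" where w: "w \<noteq> 0" "\<And>i. w $ i \<in> KK"
    "e11 * w $ 1 + e12 * w $ 2 = 0" "e21 * w $ 1 + e22 * w $ 2 = 0"
  proof (cases "e22 = 0")
    case False
    have "\<forall>i. (vector [e22, - e21] :: complex^2) $ i \<in> KK" using eK by (simp add: forall_2)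
    note K = this[rule_format]
    show ?thesis
      by (rule that[OF _ K]) (use False det0 in \<open>auto simp: vec_eq_iff forall_2 algebra_simps\<close>)
  next
    case True
    have "\<forall>i. (vector [- e12, e11] :: complex^2) $ i \<in> KK" using eK by (simp add: forall_2)
    note K = this[rule_format]
    show ?thesis
      by (rule that[OF _ K]) (use True tr0 det0 in \<open>auto simp: vec_eq_iff forall_2 algebra_simps\<close>)
  qed
  have bw: "b *v w = p *s w + q *s (a *v w)"
    using w(3,4) by (simp add: mat_expand e11_def e12_def e21_def e22_def algebra_simps)
  show ?thesis
  proof (rule that[of "krylov a w"])
    show "entries_in KK (krylov a w)" by (rule krylov_KK[OF a(1) w(2)])
    show "det (krylov a w) \<noteq> 0"
      using no_KK_eigenvector[of a w] a w(1,2) by (simp add: det_2 krylov_def mult.commute)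
    show "a ** krylov a w = krylov a w ** companion u" using krylov_companion[OF a(2)] a(3) by simp
    show "b ** krylov a w = krylov a w ** partner u p q" using krylov_partner[OF a(2) b(3,4) bw] a(3) by simp
  qed
qed

section \<open>Groups of block-diagonal matrices and their projection to the plane\<close>

definition blk_group :: "(complex^3^3) set \<Rightarrow> bool" where
  "blk_group G \<longleftrightarrow> KK_group G \<and> (\<forall>x\<in>G. \<exists>c M. x = blk c M \<and> (c = 1 \<or> c = -1) \<and> det M = 1)"

lemma conj_byI: "x \<in> G \<Longrightarrow> Q ** x ** P \<in> conj_by P Q G"
  by (simp add: conj_by_def)

lemma matrix_add_rdistrib: "(A + B) ** C = A ** C + B ** (C :: 'a::semiring_1^'n^'m)"
  by (simp add: vec_eq_iff matrix_matrix_mult_def distrib_right sum.distrib)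

definition blk_proj :: "(complex^3^3) set \<Rightarrow> (complex^2^2) set" where
  "blk_proj G = {M. \<exists>c. blk c M \<in> G}"

lemma blk_groupD:
  assumes "blk_group G" "blk c M \<in> G"
  shows "c = 1 \<or> c = -1" "det M = 1" "entries_in KK M" "blk c (inv2 M) \<in> G"
proof -
  obtain c' M' where "blk c M = blk c' M'" "c' = 1 \<or> c' = -1" "det M' = 1"
    using assms unfolding blk_group_def by blast
  then show 1: "c = 1 \<or> c = -1" "det M = 1" by simp_all
  have G: "KK_group G" using assms by (simp add: blk_group_def)
  then show "entries_in KK M" using assms(2) by (auto simp: KK_group_def entries_in_blk)
  obtain y where y: "y \<in> G" "blk c M ** y = mat 1" using G assms(2) by (auto simp: KK_group_def)
  then obtain c' M' where y': "y = blk c' M'" using assms(1) by (auto simp: blk_group_def)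
  have "c * c' = 1" "M ** M' = mat 1" using y(2) by (simp_all add: y' blk_mult flip: blk_1)
  moreover have "c * c = 1" using 1(1) by auto
  then have "c' = c * (c * c')" by (simp flip: mult.assoc)
  ultimately have "M' = inv2 M" "c' = c" using inv2_unique[OF 1(2)] by simp_all
  then show "blk c (inv2 M) \<in> G" using y(1) y' by simp
qed

lemma blk_group_mult:
  assumes "blk_group G" "blk c M \<in> G" "blk c' M' \<in> G"
  shows "blk (c * c') (M ** M') \<in> G"
  using assms by (auto simp: blk_group_def KK_group_def simp flip: blk_mult)

lemma blk_group_one: "blk_group G \<Longrightarrow> blk 1 (mat 1) \<in> G"
  by (simp add: blk_1 blk_group_def KK_group_def)

lemma square_zero_2:
  fixes M :: "'a::idom^2^2"
  assumes "det M = 1" "e * e = 1" "trace M = 2 * e"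
  shows "M *v (M *v w - e *s w) = e *s (M *v w - e *s w)"
proof -
  have "M$2$2 = 2 * e - M$1$1" "M$1$1 * M$2$2 - M$1$2 * M$2$1 = 1"
    using assms by (simp_all add: trace_2 det_2 algebra_simps)
  then show ?thesis using assms(2) by (simp add: mat_expand) algebra
qed

text \<open>Because det M = 1, the determinant of the block matrix is its first entry, so the
  integer \<open>u\<close> of the characteristic polynomial is the trace of M. At trace +-2 the
  matrix M -+ 1 squares to zero, and the exclusion of Jordan blocks applies after embedding the
  plane as the last two coordinates.\<close>

lemma blk_group_trace:
  assumes G: "blk_group G" and M: "blk c M \<in> G"
  shows "trace M \<in> {-2, -1, 0, 1, 2}" "trace M = 2 \<Longrightarrow> M = mat 1" "trace M = -2 \<Longrightarrow> M = - mat 1"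
proof -
  have KG: "KK_group G" using G by (simp add: blk_group_def)
  note D = blk_groupD[OF G M]
  obtain d u :: int where du: "-2 \<le> u" "u \<le> 2" "det (blk c M) = of_int d" "trace (blk c M) = of_int (d + u)"
    using KK_group_charD[OF KG M] by metis
  have "trace M = of_int u" using du(3,4) by (simp add: det_blk trace_blk D(2))
  moreover have "u = -2 \<or> u = -1 \<or> u = 0 \<or> u = 1 \<or> u = 2" using du(1,2) by linarith
  ultimately show "trace M \<in> {-2, -1, 0, 1, 2}" by auto
  have *: "M = mat e" if "trace M = 2 * e" "e * e = 1" for e
  proof -
    obtain n where n: "has_period n (blk c M)" using KK_group_period[OF KG M] .
    define emb :: "complex^2 \<Rightarrow> complex^3" where "emb w = vector [0, w $ 1, w $ 2]" for w
    have bm: "blk c M *v emb w = emb (M *v w)" for w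
      by (simp add: mat_expand emb_def)
    have "M *v w - e *s w = 0" for w
    proof -
      define y where "y = M *v w - e *s w"
      have "emb y = 0"
      proof (rule periodic_no_Jordan_block[OF n, of "emb w" e])
        show "blk c M *v emb w = e *s emb w + emb y"
          unfolding bm by (simp add: y_def emb_def vec_eq_iff forall_3)
        show "blk c M *v emb y = e *s emb y"
          unfolding bm y_def square_zero_2[OF D(2) that(2,1)] by (simp add: emb_def vec_eq_iff forall_3 algebra_simps)
      qed
      then have "y = 0" by (simp add: emb_def vec_eq_iff forall_3 forall_2)
      then show ?thesis by (simp add: y_def)
    qed
    then have "M *v w = mat e *v w" for w by (simp add: vec_eq_iff forall_2 mat_def matrix_vector_mult_def sum_2)
    then show ?thesis by (simp add: matrix_eq)
  qed
  show "M = mat 1" if "trace M = 2" using *[of 1] that by simp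
  show "M = - mat 1" if "trace M = -2" using *[of "-1"] that by (simp add: mat_expand)
qed

lemma sl2_set_blk_proj:
  assumes G: "blk_group G" shows "sl2_set (blk_proj G)"
  unfolding sl2_set_def
proof (intro conjI ballI impI)
  show "mat 1 \<in> blk_proj G" using blk_group_one[OF G] by (auto simp: blk_proj_def)
  fix x assume "x \<in> blk_proj G"
  then obtain c where c: "blk c x \<in> G" by (auto simp: blk_proj_def)
  show "inv2 x \<in> blk_proj G" "det x = 1" "entries_in KK x"
    using blk_groupD[OF G c] by (auto simp: blk_proj_def)
  show "trace x \<in> {-2, -1, 0, 1, 2}" "trace x = 2 \<Longrightarrow> x = mat 1" "trace x = -2 \<Longrightarrow> x = - mat 1"
    by (fact blk_group_trace[OF G c])+
  fix y assume "y \<in> blk_proj G"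
  then obtain c' where "blk c' y \<in> G" by (auto simp: blk_proj_def)
  from blk_group_mult[OF G c this] show "x ** y \<in> blk_proj G" by (auto simp: blk_proj_def)
qed

lemma conj_by_blk:
  assumes C: "entries_in KK C" "det C \<noteq> 0"
  obtains C' where "KK_inverses (blk 1 C) (blk 1 C')" "C ** C' = mat 1" "C' ** C = mat 1"
proof -
  define C' where "C' = (\<chi> i j. inv2 C $ i $ j / det C)"
  have CC: "C ** C' = mat 1"
    using C(2) by (simp add: mat_expand C'_def inv2_def det_2 add_divide_distrib[symmetric] diff_divide_distrib[symmetric] algebra_simps)
  have CK: "C $ i $ j \<in> KK" for i j using C(1) by (simp add: entries_in_def)
  have "det C \<in> KK" unfolding det_2 using CK by blast
  then have "entries_in KK C'"
    using CK by (simp add: entries_in_def forall_2 C'_def inv2_def KK_closed(4,5))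
  then show ?thesis
    using CC matrix_left_right_inverse[of C C'] C(1)
    by (intro that[of C']) (simp_all add: KK_inverses_def entries_in_blk blk_mult blk_1)
qed

lemma blk_conj_blk: "blk 1 C' ** blk c M ** blk 1 C = blk c (C' ** M ** C)"
  by (simp add: blk_mult)

lemma blk_group_conj_by:
  assumes G: "blk_group G" and C: "KK_inverses (blk 1 C) (blk 1 C')" "C' ** C = mat 1"
  shows "blk_group (conj_by (blk 1 C) (blk 1 C') G)"
proof -
  have "det C' * det C = 1" using det_mul[of C' C] C(2) by simp
  then have d: "det (C' ** M ** C) = det M" for M by (simp add: det_mul mult_ac)
  show ?thesis
    unfolding blk_group_def
  proof (intro conjI ballI)
    show "KK_group (conj_by (blk 1 C) (blk 1 C') G)"
      using KK_group_conj_by[OF _ C(1)] G by (simp add: blk_group_def)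
    fix x assume "x \<in> conj_by (blk 1 C) (blk 1 C') G"
    then obtain y where y: "y \<in> G" "x = blk 1 C' ** y ** blk 1 C" by (auto simp: conj_by_def)
    then obtain c M where "y = blk c M" "c = 1 \<or> c = -1" "det M = 1" using G by (auto simp: blk_group_def)
    then have "x = blk c (C' ** M ** C)" "c = 1 \<or> c = -1" "det (C' ** M ** C) = 1"
      using y(2) d by (simp_all add: blk_conj_blk)
    then show "\<exists>c M. x = blk c M \<and> (c = 1 \<or> c = -1) \<and> det M = 1" by blast
  qed
qed

text \<open>In a Krylov basis of \<open>a\<close>, started at any vector, \<open>a\<close> becomes a
  rational companion matrix, and with it the whole rational span of 1 and \<open>a\<close>.\<close>

lemma blk_group_cyclic_rationalizable:
  assumes G: "blk_group G" and a: "a \<in> blk_proj G" "trace a = u" "u \<in> {-1, 0, 1}"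
    and lin: "\<And>x. x \<in> blk_proj G \<Longrightarrow> \<exists>p\<in>\<rat>. \<exists>q\<in>\<rat>. x = mat p + mat q ** a"
  shows "rationalizable G"
proof -
  have aK: "entries_in KK a" "det a = 1" using a(1) blk_groupD(2,3)[OF G] by (auto simp: blk_proj_def)
  define w :: "complex^2" where "w = vector [1, 0]"
  have wK: "w $ i \<in> KK" for i using exhaust_2[of i] by (auto simp: w_def)
  have w0: "w \<noteq> 0" by (simp add: w_def vec_eq_iff forall_2)
  define C where "C = krylov a w"
  have CK: "entries_in KK C" unfolding C_def by (rule krylov_KK[OF aK(1) wK])
  have dC: "det C \<noteq> 0"
    using no_KK_eigenvector[OF aK _ w0 wK] a(2,3) by (simp add: C_def det_2 krylov_def mult.commute)
  obtain C' where C': "KK_inverses (blk 1 C) (blk 1 C')" "C ** C' = mat 1" "C' ** C = mat 1"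
    using conj_by_blk[OF CK dC] .
  have aC: "a ** C = C ** companion u" unfolding C_def using krylov_companion[OF aK(2)] a(2) by simp
  have "entries_in \<rat> (blk 1 C' ** x ** blk 1 C)" if x: "x \<in> G" for x
  proof -
    obtain c M where cM: "x = blk c M" "c = 1 \<or> c = -1" using G x by (auto simp: blk_group_def)
    then have "M \<in> blk_proj G" using x by (auto simp: blk_proj_def)
    then obtain p q where pq: "p \<in> \<rat>" "q \<in> \<rat>" "M = mat p + mat q ** a" using lin by blast
    have comm: "mat r ** A = A ** mat r" for r and A :: "complex^2^2" by (simp add: mat_expand mult.commute)
    have "M ** C = C ** mat p + mat q ** (a ** C)"
      unfolding pq(3) matrix_add_rdistrib by (simp only: matrix_mul_assoc comm[of p])
    also have "mat q ** (a ** C) = C ** (mat q ** companion u)"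
      unfolding aC comm[of q] by (simp only: matrix_mul_assoc)
    finally have "M ** C = C ** (mat p + mat q ** companion u)"
      by (simp add: matrix_add_ldistrib)
    then have "C' ** M ** C = (C' ** C) ** (mat p + mat q ** companion u)"
      by (simp only: flip: matrix_mul_assoc)
    then have "C' ** M ** C = mat p + mat q ** companion u"
      by (simp add: C'(3))
    then have "blk 1 C' ** x ** blk 1 C = blk c (mat p + mat q ** companion u)"
      by (simp add: cM(1) blk_conj_blk)
    moreover have "c \<in> \<rat>" "u \<in> \<rat>" using cM(2) a(3) by auto
    ultimately show ?thesis
      using pq by (simp add: entries_in_def forall_3 companion_def mat_expand)
  qed
  then show ?thesis unfolding rationalizable_def using C'(1) by blast
qed

text \<open>With s^2 = -19: (s - 1)^2 + (s + 1)^2 = -36 gives the first pair. For the second, p^2 -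
  p q + q^2 = (p - q/2)^2 + 3 q^2 / 4, and q = -1/2 leaves the square of s/4.\<close>

definition pQ :: complex where "pQ = (sq19 - 1) / 6"
definition qQ :: complex where "qQ = (sq19 + 1) / 6"
definition pD :: complex where "pD = (sq19 - 1) / 4"
definition qD :: complex where "qD = - 1 / 2"

lemma norm_equations:
  "pQ * pQ + qQ * qQ = -1" "pD * pD - pD * qD + qD * qD = -1"
proof -
  have s: "sq19 * sq19 = -19" by (rule sq19_sq)
  show "pQ * pQ + qQ * qQ = -1" "pD * pD - pD * qD + qD * qD = -1"
    by (simp_all add: pQ_def qQ_def pD_def qD_def field_simps s)
qed

lemma pq_KK: "pQ \<in> KK" "qQ \<in> KK" "pD \<in> KK" "qD \<in> KK"
  unfolding pQ_def qQ_def pD_def qD_def by (auto intro!: KK_closed(4))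

lemma pq_nz: "2 * pQ \<noteq> 0" "2 * pD - qD \<noteq> 0"
proof -
  have "sq19 \<noteq> 1" "sq19 \<noteq> 0" by (auto simp: sq19 complex_eq_iff)
  then show "2 * pQ \<noteq> 0" "2 * pD - qD \<noteq> 0"
    by (simp_all add: pQ_def pD_def qD_def field_simps)
qed

definition standard_params :: "(complex \<times> complex \<times> complex) set" where
  "standard_params = {(0, pQ, qQ), (-1, pD, qD)}"

lemma cube_1:
  fixes a :: "'a::idom^2^2"
  assumes "det a = 1" "trace a = -1" shows "a ** (a ** a) = mat 1"
proof -
  have "a$2$2 = - 1 - a$1$1" "a$1$1 * a$2$2 - a$1$2 * a$2$1 = 1"
    using assms by (simp_all add: trace_2 det_2 algebra_simps)
  then show ?thesis by (simp add: mat_expand) algebra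
qed

lemma nonrational_normal_form:
  assumes G: "KK_group G" and nonrat: "\<not> rationalizable G"
  obtains (normal) P Q u p q c where "KK_inverses P Q" "blk_group (conj_by P Q G)" "(u, p, q) \<in> standard_params"
    "blk 1 (companion u) \<in> conj_by P Q G" "blk c (partner u p q) \<in> conj_by P Q G"
proof -
  obtain P Q where PQ: "KK_inverses P Q"
    "\<And>x. x \<in> G \<Longrightarrow> \<exists>c M. Q ** x ** P = blk c M \<and> (c = 1 \<or> c = -1) \<and> det M = 1"
    using nonrational_block_form[OF G nonrat] by metis
  define G' where "G' = conj_by P Q G"
  have G': "blk_group G'"
    using KK_group_conj_by[OF G PQ(1)] PQ(2) by (auto simp: blk_group_def G'_def conj_by_def)
  have nonrat': "\<not> rationalizable G'" using rationalizable_conj_by[OF _ PQ(1)] nonrat by (auto simp: G'_def)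
  have finish: thesis if ab: "blk 1 a \<in> G'" "blk c b \<in> G'" "trace a = u" "trace b = 0" "trace (a ** b) = 0"
    and u: "(u, p, q) \<in> standard_params" for a b u c p q
  proof -
    have pq: "p \<in> KK" "q \<in> KK" "p * p + u * p * q + q * q = -1" "2 * p + u * q \<noteq> 0" "u \<in> {-1, 0, 1}"
      using u pq_KK pq_nz norm_equations by (auto simp: standard_params_def)
    obtain C where C: "entries_in KK C" "det C \<noteq> 0" "a ** C = C ** companion u" "b ** C = C ** partner u p q"
      using normal_form_pair[OF blk_groupD(3,2)[OF G' ab(1)] ab(3) pq(5) blk_groupD(3,2)[OF G' ab(2)] ab(4,5) pq(1-4)] .
    obtain C' where C': "KK_inverses (blk 1 C) (blk 1 C')" "C ** C' = mat 1" "C' ** C = mat 1"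
      using conj_by_blk[OF C(1,2)] .
    have "C' ** a ** C = (C' ** C) ** companion u" "C' ** b ** C = (C' ** C) ** partner u p q"
      by (simp_all only: C(3,4) flip: matrix_mul_assoc)
    then have "C' ** a ** C = companion u" "C' ** b ** C = partner u p q"
      by (simp_all add: C'(3))
    then have std: "blk 1 C' ** blk 1 a ** blk 1 C = blk 1 (companion u)"
        "blk 1 C' ** blk c b ** blk 1 C = blk c (partner u p q)"
      by (simp_all add: blk_conj_blk)
    have "blk 1 (companion u) \<in> conj_by (blk 1 C) (blk 1 C') G'"
        "blk c (partner u p q) \<in> conj_by (blk 1 C) (blk 1 C') G'"
      using conj_byI[OF ab(1), of "blk 1 C'" "blk 1 C"] conj_byI[OF ab(2), of "blk 1 C'" "blk 1 C"]
      unfolding std by simp_all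
    moreover have "blk_group (conj_by (blk 1 C) (blk 1 C') G')" by (rule blk_group_conj_by[OF G' C'(1,3)])
    ultimately show thesis
      using normal[of "P ** blk 1 C" "blk 1 C' ** Q" u p q c] KK_inverses_mult[OF PQ(1) C'(1)] u
      by (simp add: G'_def conj_by_conj_by)
  qed
  have H: "sl2_set (blk_proj G')" by (rule sl2_set_blk_proj[OF G'])
  from H show thesis
  proof (cases rule: sl2_set_cases)
    case scalar
    have "entries_in \<rat> (mat 1 ** x ** mat 1)" if x: "x \<in> G'" for x
    proof -
      obtain c M where cM: "x = blk c M" "c = 1 \<or> c = -1" using G' x by (auto simp: blk_group_def)
      then have "M = mat 1 \<or> M = - mat 1" using scalar x by (auto simp: blk_proj_def)
      then show ?thesis using cM by (auto simp: entries_in_def forall_3) (auto simp: mat_def)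
    qed
    moreover have "KK_inverses (mat 1) (mat 1)" by (simp add: KK_inverses_def)
    ultimately show thesis using nonrat' unfolding rationalizable_def by blast
  next
    case (cyclic a u)
    then show thesis using blk_group_cyclic_rationalizable[OF G'] nonrat' by blast
  next
    case (pair a b u)
    obtain c c' where c: "blk c a \<in> G'" "blk c' b \<in> G'" using pair(1,2) by (auto simp: blk_proj_def)
    note ca = blk_groupD[OF G' c(1)] and cb = blk_groupD[OF G' c(2)]
    have ba: "trace (b ** a) = 0" using pair(6) trace_mul_sym[of a b] by simp
    show thesis
    proof (cases "u = 0")
      case True
      have par: "(0, pQ, qQ) \<in> standard_params" by (simp add: standard_params_def)
      \<comment> \<open>Signs multiply, so one of a, b, a b carries sign 1. Any two of them form a
        quaternion pair, hence the one with sign 1 can be taken as first member.\<close>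
      consider "c = 1" | "c' = 1" | "c * c' = 1" using ca(1) cb(1) by auto
      then show thesis
      proof cases
        case 1 then show thesis using finish[OF _ c(2) _ pair(5,6) par] c(1) pair(3) True by simp
      next
        case 2 then show thesis using finish[OF _ c(1) pair(5) _ ba par] c(2) pair(3) True by simp
      next
        case 3
        have ab: "blk 1 (a ** b) \<in> G'" using blk_group_mult[OF G' c] 3 by simp
        have "trace (a ** b ** a) = trace (a ** (a ** b))" by (rule trace_mul_sym)
        also have "\<dots> = 0"
          using trace0_square[of a] pair(3,5) True ca(2) by (simp add: matrix_mul_assoc matrix_minus_mult trace_minus)
        finally show thesis using finish[OF ab c(1) pair(6) _ _ par] pair(3) True by simp
      qed
    next
      case False
      then have u: "u = -1" using pair(4) by auto
      have par: "(-1, pD, qD) \<in> standard_params" by (simp add: standard_params_def)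
      \<comment> \<open>Since a^3 = 1, the fourth power of the block matrix returns a and makes its
        sign 1.\<close>
      have "blk (c * (c * (c * c))) (a ** (a ** (a ** a))) \<in> G'"
        using blk_group_mult[OF G'] c(1) by blast
      then have "blk 1 a \<in> G'" using cube_1[of a] pair(3) u ca(1,2) by auto
      then show thesis using finish[OF _ c(2) _ pair(5,6) par] pair(3) u by simp
    qed
  qed
qed

section \<open>Quaternions and the groups $Q_8$ and SL(2,3)\<close>

text \<open>If \<open>p\<^sup>2 + q\<^sup>2 = -1\<close>, the matrices \<open>((0,-1),(1,0))\<close> and \<open>((p,q),(q,-p))\<close> satisfy the relations of the quaternion
  units \<open>i\<close> and \<open>j\<close>.\<close>

definition qmat :: "'a \<Rightarrow> 'a \<Rightarrow> 'a \<Rightarrow> 'a \<Rightarrow> 'a \<Rightarrow> 'a \<Rightarrow> 'a::comm_ring_1^2^2" where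
  "qmat p q a b c d = vector [vector [a + c * p - d * q, - b + c * q + d * p],
     vector [b + c * q + d * p, a - c * p + d * q]]"

lemma qmat_mult:
  fixes p q :: "'a::comm_ring_1"
  assumes "p * p + q * q = -1"
  shows "qmat p q a b c d ** qmat p q a' b' c' d' = qmat p q
     (a * a' - b * b' - c * c' - d * d') (a * b' + b * a' + c * d' - d * c')
     (a * c' - b * d' + c * a' + d * b') (a * d' + b * c' - c * b' + d * a')"
proof -
  have e: "q * q = - 1 - p * p" using assms by (simp add: eq_diff_eq add.commute)
  have e': "q * (q * x) = - x - p * (p * x)" for x
    using arg_cong[OF e, of "\<lambda>z. z * x"] by (simp add: algebra_simps)
  show ?thesis
    by (simp add: mat_expand qmat_def algebra_simps e e')
qed

lemma det_qmat:
  fixes p q :: "'a::comm_ring_1"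
  assumes "p * p + q * q = -1"
  shows "det (qmat p q a b c d) = a * a + b * b + c * c + d * d"
proof -
  have e: "q * q = - 1 - p * p" using assms by (simp add: eq_diff_eq add.commute)
  have e': "q * (q * x) = - x - p * (p * x)" for x
    using arg_cong[OF e, of "\<lambda>z. z * x"] by (simp add: algebra_simps)
  show ?thesis
    by (simp add: det_2 qmat_def algebra_simps e e')
qed

lemma qmat_inject:
  fixes p q :: "'a::field_char_0"
  assumes "p * p + q * q = -1"
  shows "qmat p q a b c d = qmat p q a' b' c' d' \<longleftrightarrow> a = a' \<and> b = b' \<and> c = c' \<and> d = d'"
proof
  assume eq: "qmat p q a b c d = qmat p q a' b' c' d'"
  have e: "a + c * p - d * q = a' + c' * p - d' * q" "- b + c * q + d * p = - b' + c' * q + d' * p"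
    "b + c * q + d * p = b' + c' * q + d' * p" "a - c * p + d * q = a' - c' * p + d' * q"
    using eq by (simp_all add: qmat_def vec_eq_iff forall_2)
  have "2 * (a - a') = 0" using e(1,4) by algebra
  moreover have "2 * (b - b') = 0" using e(2,3) by algebra
  moreover have "2 * (c - c') = 0" using e assms by algebra
  moreover have "2 * (d - d') = 0" using e assms by algebra
  ultimately show "a = a' \<and> b = b' \<and> c = c' \<and> d = d'" by simp
qed simp

abbreviation QM :: "complex \<Rightarrow> complex \<Rightarrow> complex \<Rightarrow> complex \<Rightarrow> complex^2^2" where
  "QM \<equiv> qmat pQ qQ"

lemmas QM_mult = qmat_mult[OF norm_equations(1)]
lemmas QM_inject = qmat_inject[OF norm_equations(1)]
lemmas det_QM = det_qmat[OF norm_equations(1)]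

lemma QM_KK: "a \<in> KK \<Longrightarrow> b \<in> KK \<Longrightarrow> c \<in> KK \<Longrightarrow> d \<in> KK \<Longrightarrow> entries_in KK (QM a b c d)"
  using pq_KK by (auto simp: entries_in_def forall_2 qmat_def)

lemma companion_QM: "companion 0 = QM 0 1 0 0" and partner_QM: "partner 0 pQ qQ = QM 0 0 1 0"
  by (simp_all add: qmat_def companion_def partner_def)

lemma QM_1: "QM 1 0 0 0 = mat 1" and QM_m1: "QM (-1) 0 0 0 = - mat 1"
  by (simp_all add: qmat_def mat_expand)

text \<open>The elements of the group of order \<open>24\<close> of units of the Hurwitz order are \<open>(a + b i + c j + d k)/2\<close>.\<close>

definition hurwitz :: "int_quaternion set" where
  "hurwitz = {(a, b, c, d). a * a + b * b + c * c + d * d = 4}"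

definition hurwitz_even :: "int_quaternion set" where
  "hurwitz_even = {(2,0,0,0), (-2,0,0,0), (0,2,0,0), (0,-2,0,0), (0,0,2,0), (0,0,-2,0), (0,0,0,2), (0,0,0,-2)}"

definition signs :: "int set" where "signs = {1, -1}"

definition hurwitz_odd :: "int_quaternion set" where
  "hurwitz_odd = signs \<times> signs \<times> signs \<times> signs"

lemma hurwitz_eq: "hurwitz = hurwitz_even \<union> hurwitz_odd"
proof
  show "hurwitz_even \<union> hurwitz_odd \<subseteq> hurwitz"
    by (auto simp: hurwitz_def hurwitz_even_def hurwitz_odd_def signs_def)
  show "hurwitz \<subseteq> hurwitz_even \<union> hurwitz_odd"
  proof
    fix t assume "t \<in> hurwitz"
    then obtain a b c d where t: "t = (a, b, c, d)" "a * a + b * b + c * c + d * d = 4"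
      by (auto simp: hurwitz_def)
    have sq: "x * x = 0 \<and> x = 0 \<or> x * x = 1 \<and> (x = 1 \<or> x = -1) \<or> x * x = 4 \<and> (x = 2 \<or> x = -2) \<or> x * x > 4" for x :: int
    proof (cases "\<bar>x\<bar> \<le> 2")
      case True
      then have "x = -2 \<or> x = -1 \<or> x = 0 \<or> x = 1 \<or> x = 2" by linarith
      then show ?thesis by auto
    next
      case False
      then have "3 * 3 \<le> \<bar>x\<bar> * \<bar>x\<bar>" by (intro mult_mono) auto
      then show ?thesis by simp
    qed
    have sums: "A = 4 \<and> B = 0 \<and> C = 0 \<and> D = 0 \<or> A = 0 \<and> B = 4 \<and> C = 0 \<and> D = 0 \<or>
      A = 0 \<and> B = 0 \<and> C = 4 \<and> D = 0 \<or> A = 0 \<and> B = 0 \<and> C = 0 \<and> D = 4 \<or>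
      A = 1 \<and> B = 1 \<and> C = 1 \<and> D = 1"
      if "A + B + C + D = 4" "A = 0 \<or> A = 1 \<or> A \<ge> 4" "B = 0 \<or> B = 1 \<or> B \<ge> 4"
        "C = 0 \<or> C = 1 \<or> C \<ge> 4" "D = 0 \<or> D = 1 \<or> D \<ge> 4" for A B C D :: int
      using that by presburger
    have sq': "x * x = 0 \<or> x * x = 1 \<or> x * x \<ge> 4" "x * x = 0 \<Longrightarrow> x = 0" "x * x = 1 \<Longrightarrow> x \<in> signs"
      "x * x = 4 \<Longrightarrow> x = 2 \<or> x = -2" for x :: int
      using sq[of x] by (auto simp: signs_def)
    show "t \<in> hurwitz_even \<union> hurwitz_odd"
      using sums[OF t(2) sq'(1)[of a] sq'(1)[of b] sq'(1)[of c] sq'(1)[of d]]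
    proof (elim disjE conjE)
      assume "a * a = 1" "b * b = 1" "c * c = 1" "d * d = 1"
      then show ?thesis using sq'(3) by (simp add: t(1) hurwitz_odd_def)
    qed (auto dest: sq'(2,4) simp: t(1) hurwitz_even_def)
  qed
qed

fun halve :: "int_quaternion \<Rightarrow> int_quaternion" where
  "halve (a, b, c, d) = (a div 2, b div 2, c div 2, d div 2)"

text \<open>Elements are stored as twice the unit, so the quaternion product of two of them is twice
  too large.\<close>

definition hurwitz_group :: "int_quaternion monoid" where
  "hurwitz_group = \<lparr>carrier = hurwitz, monoid.mult = (\<lambda>x y. halve (quaternion_mult x y)), one = (2, 0, 0, 0)\<rparr>"

fun fT :: "int_quaternion \<Rightarrow> complex^2^2" where
  "fT (a, b, c, d) = QM (of_int a / 2) (of_int b / 2) (of_int c / 2) (of_int d / 2)"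

fun fQ :: "int_quaternion \<Rightarrow> complex^2^2" where
  "fQ (a, b, c, d) = QM (of_int a) (of_int b) (of_int c) (of_int d)"

lemma fT_inj: "fT x = fT y \<longleftrightarrow> x = y" and fQ_inj: "fQ x = fQ y \<longleftrightarrow> x = y"
  by (cases x; cases y; simp add: QM_inject)+

lemma fQ_mult: "fQ (quaternion_mult x y) = fQ x ** fQ y"
  by (cases x; cases y) (simp add: QM_mult)

text \<open>The four coordinates of an element share a parity, so every coordinate of a product is a
  signed sum of four terms of equal parity.\<close>

lemma halve_exact:
  assumes "x \<in> hurwitz" "y \<in> hurwitz"
  obtains a b c d where "quaternion_mult x y = (2 * a, 2 * b, 2 * c, 2 * d)"
proof -
  obtain a b c d where x: "x = (a, b, c, d)" "even a \<and> even b \<and> even c \<and> even d \<or> odd a \<and> odd b \<and> odd c \<and> odd d"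
    using assms(1) by (auto simp: hurwitz_eq hurwitz_even_def hurwitz_odd_def signs_def)
  obtain a' b' c' d' where y: "y = (a', b', c', d')" "even a' \<and> even b' \<and> even c' \<and> even d' \<or> odd a' \<and> odd b' \<and> odd c' \<and> odd d'"
    using assms(2) by (auto simp: hurwitz_eq hurwitz_even_def hurwitz_odd_def signs_def)
  obtain e f g h where efgh: "quaternion_mult x y = (e, f, g, h)" by (metis prod_cases4)
  then have "even e" "even f" "even g" "even h" using x y by auto
  then show ?thesis using that efgh by (auto elim!: evenE)
qed

lemma fT_mult:
  assumes "x \<in> hurwitz" "y \<in> hurwitz"
  shows "fT (halve (quaternion_mult x y)) = fT x ** fT y"
proof -
  obtain a b c d where h: "quaternion_mult x y = (2 * a, 2 * b, 2 * c, 2 * d)" using halve_exact[OF assms] .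
  have "fT x ** fT y = (case quaternion_mult x y of (a, b, c, d) \<Rightarrow>
      QM (of_int a / 4) (of_int b / 4) (of_int c / 4) (of_int d / 4))"
    by (cases x; cases y) (simp add: QM_mult add_divide_distrib diff_divide_distrib)
  then show ?thesis unfolding h by simp
qed

lemma det_fT: "x \<in> hurwitz \<Longrightarrow> det (fT x) = 1"
proof -
  assume "x \<in> hurwitz"
  then obtain a b c d where x: "x = (a, b, c, d)" "a * a + b * b + c * c + d * d = 4" by (auto simp: hurwitz_def)
  have "of_int (a * a + b * b + c * c + d * d) = (4::complex)" unfolding x(2) by simp
  then show ?thesis by (simp add: x(1) det_QM field_simps)
qed

lemma hurwitz_mult_closed:
  assumes "x \<in> hurwitz" "y \<in> hurwitz" shows "halve (quaternion_mult x y) \<in> hurwitz"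
proof -
  obtain a b c d where h: "halve (quaternion_mult x y) = (a, b, c, d)" by (metis prod_cases4)
  have "det (QM (of_int a / 2) (of_int b / 2) (of_int c / 2) (of_int d / 2)) = 1"
    using det_fT assms fT_mult[OF assms] by (simp add: h det_mul)
  then have "of_int (a * a + b * b + c * c + d * d) = (of_int 4 :: complex)"
    by (simp add: det_QM field_simps)
  then show ?thesis unfolding h hurwitz_def by (simp only: of_int_eq_iff) simp
qed

text \<open>Associativity is not formal because of the integer division; it is inherited from
  matrices through the injective map \<open>fT\<close>.\<close>

lemma group_hurwitz: "group hurwitz_group"
proof (rule groupI)
  show "\<one>\<^bsub>hurwitz_group\<^esub> \<in> carrier hurwitz_group" by (simp add: hurwitz_group_def hurwitz_def)
  fix x y z assume x: "x \<in> carrier hurwitz_group"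
  show "\<one>\<^bsub>hurwitz_group\<^esub> \<otimes>\<^bsub>hurwitz_group\<^esub> x = x"
    by (cases x) (simp add: hurwitz_group_def)
  show "\<exists>y\<in>carrier hurwitz_group. y \<otimes>\<^bsub>hurwitz_group\<^esub> x = \<one>\<^bsub>hurwitz_group\<^esub>"
  proof -
    obtain a b c d where abcd: "x = (a, b, c, d)" "a * a + b * b + c * c + d * d = 4"
      using x by (auto simp: hurwitz_group_def hurwitz_def)
    then show ?thesis
      by (intro bexI[of _ "(a, - b, - c, - d)"]) (simp_all add: hurwitz_group_def hurwitz_def algebra_simps)
  qed
  assume y: "y \<in> carrier hurwitz_group"
  show "x \<otimes>\<^bsub>hurwitz_group\<^esub> y \<in> carrier hurwitz_group"
    using x y hurwitz_mult_closed by (simp add: hurwitz_group_def)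
  assume z: "z \<in> carrier hurwitz_group"
  have "fT (x \<otimes>\<^bsub>hurwitz_group\<^esub> y \<otimes>\<^bsub>hurwitz_group\<^esub> z) = fT (x \<otimes>\<^bsub>hurwitz_group\<^esub> (y \<otimes>\<^bsub>hurwitz_group\<^esub> z))"
    using x y z by (simp add: hurwitz_group_def fT_mult hurwitz_mult_closed matrix_mul_assoc)
  then show "x \<otimes>\<^bsub>hurwitz_group\<^esub> y \<otimes>\<^bsub>hurwitz_group\<^esub> z = x \<otimes>\<^bsub>hurwitz_group\<^esub> (y \<otimes>\<^bsub>hurwitz_group\<^esub> z)"
    by (simp only: fT_inj)
qed

text \<open>Reduction modulo \<open>3\<close>, where \<open>1/2 = -1\<close> and \<open>p = q = 1\<close> solves \<open>p\<^sup>2 + q\<^sup>2 = -1\<close>.\<close>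

fun hurwitz_mod_3 :: "int_quaternion \<Rightarrow> 3^2^2" where
  "hurwitz_mod_3 (a, b, c, d) = qmat 1 1 (- of_int a) (- of_int b) (- of_int c) (- of_int d)"

lemma exhaust_mod_3: "x = 0 \<or> x = 1 \<or> x = (2 :: 3)"
  using exhaust_3[of x] by auto

lemma hurwitz_mod_3_mult:
  assumes "x \<in> hurwitz" "y \<in> hurwitz"
  shows "hurwitz_mod_3 (halve (quaternion_mult x y)) = hurwitz_mod_3 x ** hurwitz_mod_3 y"
proof -
  have one: "(1::3) * 1 + 1 * 1 = -1" by simp
  obtain a b c d where h: "quaternion_mult x y = (2 * a, 2 * b, 2 * c, 2 * d)" using halve_exact[OF assms] .
  have "hurwitz_mod_3 x ** hurwitz_mod_3 y = (case quaternion_mult x y of (a, b, c, d) \<Rightarrow>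
      qmat 1 1 (of_int a) (of_int b) (of_int c) (of_int d))"
    by (cases x; cases y) (simp add: qmat_mult[OF one])
  then have 1: "hurwitz_mod_3 x ** hurwitz_mod_3 y = qmat 1 1 (of_int (2 * a)) (of_int (2 * b)) (of_int (2 * c)) (of_int (2 * d))"
    unfolding h by (simp only: prod.case)
  have 2: "of_int (2 * e) = - (of_int e :: 3)" for e :: int
  proof -
    have "(2 :: 3) = -1" by simp
    then show ?thesis by (simp only: of_int_mult of_int_numeral mult_minus1)
  qed
  have "halve (2 * a, 2 * b, 2 * c, 2 * d) = (a, b, c, d)" by simp
  then show ?thesis unfolding h 1 2 by (simp only: hurwitz_mod_3.simps)
qed

lemma qmat_minus: "qmat 1 1 (- a) (- b) (- c) (- d) = vector [vector [- a - c + d, b - c - d],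
    vector [- b - c - d, - a + c - d :: 'a::comm_ring_1]]"
  by (simp add: qmat_def)

lemma coordinate_identities:
  fixes w x y z :: "'a::comm_ring_1"
  shows "- (w + z) - - (w - z + (x + y)) + - (x + y - (w - z)) = w - (z + z + z)"
    "y - x - - (w - z + (x + y)) - - (x + y - (w - z)) = x + (y + y + y)"
    "- (y - x) - - (w - z + (x + y)) - - (x + y - (w - z)) = y + (x + x + x)"
    "- (w + z) + - (w - z + (x + y)) - - (x + y - (w - z)) = z - (w + w + w)"
  by (simp_all add: algebra_simps)

text \<open>Modulo 3 a sum of four squares counts the nonzero coordinates. Determinant 1 thus means
  one or four of them are nonzero, and these are exactly the two shapes of elements of
  \<open>hurwitz\<close>.\<close>

lemma hurwitz_mod_3_bij: "bij_betw hurwitz_mod_3 hurwitz {A. det A = 1}"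
proof -
  have one: "(1::3) * 1 + 1 * 1 = -1" by simp
  have thrice: "u + u + u = 0" for u :: 3 using exhaust_mod_3[of u] by (elim disjE) simp_all
  have sq: "u * u = (if u = 0 then 0 else 1)" for u :: 3 using exhaust_mod_3[of u] by (elim disjE) simp_all
  define g where "g x = (if x = 0 then 0 else if x = 1 then 1 else -1 :: int)" for x :: 3
  have g_sq: "g u * g u = (if u = 0 then 0 else 1)" for u by (simp add: g_def)
  have of_g: "of_int (g u) = u" "of_int (-2 * g u) = u" for u
    using exhaust_mod_3[of u] by (elim disjE; simp add: g_def)+
  \<comment> \<open>The coordinates of M with respect to the negated units 1, i, j, k of
    \<open>qmat 1 1\<close>, where -1 plays the part of 1/2.\<close>
  define coords where "coords M = (M$1$1 + M$2$2, M$2$1 - M$1$2, - (M$1$1 - M$2$2 + (M$1$2 + M$2$1)), - (M$1$2 + M$2$1 - (M$1$1 - M$2$2)))"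
    for M :: "3^2^2"
  \<comment> \<open>Four nonzero residues lift to +-1. A single one lifts to +-2, with the opposite
    sign because 2 = -1 modulo 3.\<close>
  define lift where "lift a b c d = (if a \<noteq> 0 \<and> b \<noteq> 0 \<and> c \<noteq> 0 \<and> d \<noteq> 0 then (g a, g b, g c, g d)
    else (-2 * g a, -2 * g b, -2 * g c, -2 * g d))" for a b c d
  define h where "h M = (case coords M of (a, b, c, d) \<Rightarrow> lift a b c d)" for M
  have coords_qmat: "coords (qmat 1 1 (- a) (- b) (- c) (- d)) = (a, b, c, d)" for a b c d
  proof -
    have "coords (qmat 1 1 (- a) (- b) (- c) (- d)) = (- a - a, - b - b, c + c + (c + c), d + d + (d + d))"
      unfolding coords_def qmat_def vector2_entries prod.inject mult_1_right by (simp add: add_ac)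
    moreover have "- u - u = u" "u + u + (u + u) = u" for u :: 3
      using exhaust_mod_3[of u] by (elim disjE; simp)+
    ultimately show ?thesis by (simp only:)
  qed
  have M: "M = qmat 1 1 (- a) (- b) (- c) (- d)" if c: "coords M = (a, b, c, d)" for M a b c d
  proof -
    define w x y z where "w = M$1$1" and "x = M$1$2" and "y = M$2$1" and "z = M$2$2"
    have abcd: "a = w + z" "b = y - x" "c = - (w - z + (x + y))" "d = - (x + y - (w - z))"
      using c by (simp_all add: coords_def w_def x_def y_def z_def)
    have e: "- a - c + d = w" "b - c - d = x" "- b - c - d = y" "- a + c - d = z"
      unfolding abcd coordinate_identities thrice by (rule diff_zero add_0_right)+
    show ?thesis
      unfolding qmat_minus e by (simp only: vec_eq_iff forall_2 vector2_entries w_def x_def y_def z_def simp_thms)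
  qed
  show ?thesis
  proof (rule bij_betwI[of _ _ _ h])
    show "hurwitz_mod_3 \<in> hurwitz \<rightarrow> {A. det A = 1}"
    proof
      fix t assume "t \<in> hurwitz"
      then obtain a b c d where t: "t = (a, b, c, d)" "a * a + b * b + c * c + d * d = 4" by (auto simp: hurwitz_def)
      have "det (hurwitz_mod_3 t) = of_int (a * a + b * b + c * c + d * d)"
        by (simp add: t(1) det_qmat[OF one])
      also have "\<dots> = 1" unfolding t(2) by simp
      finally show "hurwitz_mod_3 t \<in> {A. det A = 1}" by simp
    qed
    have hM: "h M \<in> hurwitz \<and> hurwitz_mod_3 (h M) = M" if "det M = 1" for M
    proof -
      obtain a b c d where abcd: "coords M = (a, b, c, d)" by (metis prod_cases4)
      have hM: "h M = lift a b c d" by (simp add: h_def abcd)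
      have n: "a * a + b * b + c * c + d * d = 1"
        using that unfolding M[OF abcd] det_qmat[OF one] by simp
      have "lift a b c d \<in> hurwitz"
        using n unfolding sq by (simp add: lift_def hurwitz_def g_sq split: if_splits)
      moreover have "hurwitz_mod_3 (lift a b c d) = M"
        unfolding M[OF abcd] by (simp only: lift_def if_distrib[of hurwitz_mod_3] hurwitz_mod_3.simps of_g if_cancel)
      ultimately show ?thesis by (simp add: hM)
    qed
    show "h \<in> {A. det A = 1} \<rightarrow> hurwitz" using hM by blast
    show "hurwitz_mod_3 (h M) = M" if "M \<in> {A. det A = 1}" for M using hM that by blast
    show "h (hurwitz_mod_3 t) = t" if t: "t \<in> hurwitz" for t
    proof -
      obtain a b c d where abcd: "t = (a, b, c, d)" by (metis prod_cases4)
      have "lift (of_int a) (of_int b) (of_int c) (of_int d) = (a, b, c, d)"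
      proof -
        define k where "k i = g (of_int i)" for i
        have k: "k 0 = 0" "k 1 = 1" "k (-1) = -1" "k 2 = -1" "k (-2) = 1"
          unfolding k_def g_def by simp_all
        have nz: "of_int i \<noteq> (0::3) \<longleftrightarrow> k i \<noteq> 0" for i unfolding k_def g_def by simp
        show ?thesis
          using t unfolding abcd hurwitz_eq hurwitz_even_def hurwitz_odd_def signs_def lift_def nz k_def[symmetric]
          by (auto simp: k)
      qed
      then show ?thesis by (simp only: abcd h_def hurwitz_mod_3.simps coords_qmat prod.case)
    qed
  qed
qed

lemma SL_2_3_iso: "hurwitz_group \<cong> SL_2_3"
  unfolding is_iso_def
proof (rule ex_in_conv[THEN iffD1], rule exI[of _ hurwitz_mod_3], rule isoI)
  show "hurwitz_mod_3 \<in> hom hurwitz_group SL_2_3"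
    using hurwitz_mod_3_bij by (intro homI) (auto simp: hurwitz_group_def SL_2_3_def hurwitz_mod_3_mult bij_betw_def)
  show "bij_betw hurwitz_mod_3 (carrier hurwitz_group) (carrier SL_2_3)"
    using hurwitz_mod_3_bij by (simp add: hurwitz_group_def SL_2_3_def)
qed

section \<open>The group of order $12$\<close>

abbreviation rD :: "complex^2^2" where "rD \<equiv> companion (-1)"
abbreviation sD :: "complex^2^2" where "sD \<equiv> partner (-1) pD qD"

lemma dicyclic_relations:
  "rD ** (rD ** rD) = mat 1" "sD ** sD = - mat 1" "sD ** rD = (rD ** rD) ** sD"
  "det rD = 1" "det sD = 1" "trace rD = -1" "trace sD = 0" "trace (rD ** sD) = 0"
proof -
  note n = norm_equations(2)
  show "sD ** sD = - mat 1" using n by (simp add: mat_expand partner_def) algebra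
  show "det sD = 1" using n by (simp add: det_2 partner_def) algebra
  show "rD ** (rD ** rD) = mat 1" "det rD = 1" "trace rD = -1" "trace sD = 0"
    by (simp_all add: mat_expand companion_def partner_def trace_2 det_2)
  show "sD ** rD = (rD ** rD) ** sD" "trace (rD ** sD) = 0"
    by (simp_all add: mat_expand companion_def partner_def trace_2)
qed

definition powr3 :: "int \<Rightarrow> complex^2^2" where
  "powr3 n = (if n = 0 then mat 1 else if n = 1 then rD else rD ** rD)"

definition powr4 :: "int \<Rightarrow> complex^2^2" where
  "powr4 h = (if h = 0 then mat 1 else if h = 1 then sD else if h = 2 then - mat 1 else - sD)"

definition fD :: "int \<times> int \<Rightarrow> complex^2^2" where
  "fD x = powr3 (fst x) ** powr4 (snd x)"

lemma carrier_C3_sdp_C4: "carrier C3_sdp_C4 = {0, 1, 2} \<times> {0, 1, 2, 3}"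
proof -
  have "{0..<3} = {0, 1, 2 :: int}" "{0..<4} = {0, 1, 2, 3 :: int}" by auto
  then show ?thesis
    by (simp add: C3_sdp_C4_def semidirect_prod_def carrier_integer_mod_group)
qed

lemma mult_C3_sdp_C4:
  assumes "x \<in> carrier C3_sdp_C4" "y \<in> carrier C3_sdp_C4"
  shows "x \<otimes>\<^bsub>C3_sdp_C4\<^esub> y = ((fst x + (if even (snd x) then fst y else - fst y)) mod 3, (snd x + snd y) mod 4)"
proof -
  have y: "fst y \<in> carrier (integer_mod_group 3)"
    using assms(2) by (auto simp: carrier_C3_sdp_C4 carrier_integer_mod_group)
  obtain n h n' h' where xy: "x = (n, h)" "y = (n', h')" by (metis surj_pair)
  have "inv\<^bsub>integer_mod_group 3\<^esub> n' = (- n') mod 3"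
    using y xy by simp
  then show ?thesis
    unfolding xy by (simp add: C3_sdp_C4_def semidirect_prod_def mod_add_right_eq del: inv_integer_mod_group)
qed

lemma powr3_mult:
  assumes "n \<in> {0,1,2}" "n' \<in> {0,1,2}"
  shows "powr3 n ** powr3 n' = powr3 ((n + n') mod 3)"
proof -
  define r where "r = rD"
  have p: "powr3 0 = mat 1" "powr3 1 = r" "powr3 2 = r ** r" by (simp_all add: powr3_def r_def)
  have r: "r ** (r ** r) = mat 1" using dicyclic_relations(1) by (simp add: r_def)
  have r': "(r ** r) ** r = mat 1" using r by (simp only: matrix_mul_assoc)
  have "(r ** r) ** (r ** r) = r ** (r ** (r ** r))" by (simp only: matrix_mul_assoc)
  then have r'': "(r ** r) ** (r ** r) = r" by (simp add: r)
  show ?thesis using assms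
    by (elim insertE emptyE; hypsubst) (simp_all add: p r r' r'')
qed

lemma powr4_mult:
  assumes "h \<in> {0,1,2,3}" "h' \<in> {0,1,2,3}"
  shows "powr4 h ** powr4 h' = powr4 ((h + h') mod 4)"
proof -
  define s where "s = sD"
  have p: "powr4 0 = mat 1" "powr4 1 = s" "powr4 2 = - mat 1" "powr4 3 = - s" by (simp_all add: powr4_def s_def)
  have s: "s ** s = - mat 1" using dicyclic_relations(2) by (simp add: s_def)
  show ?thesis using assms
    by (elim insertE emptyE; hypsubst) (simp_all add: p s matrix_minus_mult)
qed

lemma powr4_powr3:
  assumes "h \<in> {0,1,2,3}" "n \<in> {0,1,2}"
  shows "powr4 h ** powr3 n = powr3 ((if even h then n else - n) mod 3) ** powr4 h"
proof -
  have 1: "sD ** rD = (rD ** rD) ** sD" by (rule dicyclic_relations)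
  have "sD ** (rD ** rD) = (rD ** (rD ** rD)) ** (rD ** sD)"
  proof -
    have "sD ** (rD ** rD) = (sD ** rD) ** rD" by (simp only: matrix_mul_assoc)
    also have "\<dots> = (rD ** rD) ** (sD ** rD)" by (subst 1) (simp only: matrix_mul_assoc)
    finally show ?thesis unfolding 1 by (simp only: matrix_mul_assoc)
  qed
  then have 2: "sD ** (rD ** rD) = rD ** sD" using dicyclic_relations(1) by simp
  have p: "powr3 0 = mat 1" "powr3 1 = rD" "powr3 2 = rD ** rD"
      "powr4 0 = mat 1" "powr4 1 = sD" "powr4 2 = - mat 1" "powr4 3 = - sD"
    by (simp_all add: powr3_def powr4_def)
  show ?thesis using assms
    by (elim insertE emptyE; hypsubst) (simp_all only: p 1 2 matrix_minus_mult matrix_mul_lid matrix_mul_rid minus_minus,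
      simp_all add: p 1 2 matrix_minus_mult)
qed

lemma fD_mult:
  assumes "x \<in> carrier C3_sdp_C4" "y \<in> carrier C3_sdp_C4"
  shows "fD (x \<otimes>\<^bsub>C3_sdp_C4\<^esub> y) = fD x ** fD y"
proof -
  obtain n h n' h' where xy: "x = (n, h)" "y = (n', h')" by (metis surj_pair)
  have r: "n \<in> {0,1,2}" "h \<in> {0,1,2,3}" "n' \<in> {0,1,2}" "h' \<in> {0,1,2,3}"
    using assms by (auto simp: xy carrier_C3_sdp_C4)
  define k where "k = (if even h then n' else - n') mod 3"
  have k: "k \<in> {0,1,2}" unfolding k_def using r(3) by auto
  have "fD x ** fD y = powr3 n ** (powr4 h ** powr3 n') ** powr4 h'"
    by (simp add: fD_def xy matrix_mul_assoc)
  also have "\<dots> = (powr3 n ** powr3 k) ** (powr4 h ** powr4 h')"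
    unfolding powr4_powr3[OF r(2,3), folded k_def] by (simp only: matrix_mul_assoc)
  also have "\<dots> = powr3 ((n + k) mod 3) ** powr4 ((h + h') mod 4)"
    by (simp only: powr3_mult[OF r(1) k] powr4_mult[OF r(2,4)])
  finally show ?thesis
    unfolding mult_C3_sdp_C4[OF assms] by (simp add: fD_def xy k_def mod_add_right_eq)
qed

text \<open>Among the twelve images only the identity has trace 2.\<close>

lemma fD_eq_1:
  assumes "x \<in> carrier C3_sdp_C4" "fD x = mat 1" shows "x = (0, 0)"
proof -
  have "trace (fD x) = 2" by (simp add: assms(2) trace_2 mat_def)
  moreover have "trace (fD y) \<noteq> 2" if y: "y \<in> {0,1,2} \<times> {0,1,2,3}" "y \<noteq> (0,0)" for y
    using y by (auto simp: fD_def powr3_def powr4_def mat_expand companion_def partner_def trace_2)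
  ultimately show ?thesis using assms(1) carrier_C3_sdp_C4 by blast
qed

lemma fD_inj: "inj_on fD (carrier C3_sdp_C4)"
proof (rule inj_onI)
  interpret group C3_sdp_C4 by (rule group_C3_sdp_C4)
  fix x y assume x: "x \<in> carrier C3_sdp_C4" and y: "y \<in> carrier C3_sdp_C4" and eq: "fD x = fD y"
  have one: "\<one>\<^bsub>C3_sdp_C4\<^esub> = (0, 0)" by (simp add: C3_sdp_C4_def semidirect_prod_def)
  have "fD (inv\<^bsub>C3_sdp_C4\<^esub> y \<otimes>\<^bsub>C3_sdp_C4\<^esub> x) = fD (inv\<^bsub>C3_sdp_C4\<^esub> y \<otimes>\<^bsub>C3_sdp_C4\<^esub> y)"
    using fD_mult[OF inv_closed[OF y] x] fD_mult[OF inv_closed[OF y] y] by (simp only: eq)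
  also have "\<dots> = mat 1" using y by (simp add: one) (simp add: fD_def powr3_def powr4_def)
  finally have "inv\<^bsub>C3_sdp_C4\<^esub> y \<otimes>\<^bsub>C3_sdp_C4\<^esub> x = \<one>\<^bsub>C3_sdp_C4\<^esub>"
    unfolding one using x y by (intro fD_eq_1) auto
  then show "x = y" using x y by (metis inv_equality inv_inv inv_closed)
qed

section \<open>Trace coordinates\<close>

text \<open>The quaternion units are orthogonal for the trace form, with tr(1) = 2 and tr(i^2) =
  tr(j^2) = tr(k^2) = -2; this explains the factor 1/2 and the signs.\<close>

lemma QM_expand:
  "x = QM (trace x / 2) (- trace (x ** QM 0 1 0 0) / 2) (- trace (x ** QM 0 0 1 0) / 2) (- trace (x ** QM 0 0 0 1) / 2)"
proof -
  have n: "pQ * pQ + qQ * qQ = -1" by (rule norm_equations)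
  have e: "qQ * qQ = - 1 - pQ * pQ" using n by algebra
  have e': "qQ * (qQ * y) = - y - pQ * (pQ * y)" for y using n by algebra
  show ?thesis
    by (simp add: mat_expand qmat_def trace_2 field_simps e e')
qed

lemma sl2_set_trace_int:
  assumes "sl2_set H" "x \<in> H"
  obtains m :: int where "trace x = of_int m" "m \<in> {-2, -1, 0, 1, 2}"
proof -
  have "trace x \<in> {-2, -1, 0, 1, 2}" using assms unfolding sl2_set_def by blast
  then have "\<exists>m::int. trace x = of_int m \<and> m \<in> {-2, -1, 0, 1, 2}"
    by (elim insertE emptyE) (auto intro: exI[of _ "-2"] exI[of _ "-1"] exI[of _ 0] exI[of _ 1] exI[of _ 2])
  then show ?thesis using that by blast
qed

lemma sl2_set_hurwitz:
  assumes H: "sl2_set H" and IJ: "QM 0 1 0 0 \<in> H" "QM 0 0 1 0 \<in> H" and x: "x \<in> H"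
  shows "\<exists>t\<in>hurwitz. x = fT t"
proof -
  have mult: "x ** y \<in> H" if "x \<in> H" "y \<in> H" for x y using H that by (simp add: sl2_set_def)
  have K: "QM 0 0 0 1 \<in> H" using mult[OF IJ] by (simp add: QM_mult)
  obtain m where m: "trace x = of_int m" using sl2_set_trace_int[OF H x] by blast
  obtain n where n: "trace (x ** QM 0 1 0 0) = of_int n" using sl2_set_trace_int[OF H mult[OF x IJ(1)]] by blast
  obtain r where r: "trace (x ** QM 0 0 1 0) = of_int r" using sl2_set_trace_int[OF H mult[OF x IJ(2)]] by blast
  obtain t where t: "trace (x ** QM 0 0 0 1) = of_int t" using sl2_set_trace_int[OF H mult[OF x K]] by blast
  have eq: "x = fT (m, -n, -r, -t)"
    using QM_expand[of x] by (simp add: m n r t)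
  have "det x = 1" using H x by (simp add: sl2_set_def)
  then have "of_int (m * m + n * n + r * r + t * t) = (of_int 4 :: complex)"
    unfolding eq by (simp add: det_QM field_simps)
  then have "m * m + n * n + r * r + t * t = 4" by (simp only: of_int_eq_iff)
  then show ?thesis using eq by (intro bexI[of _ "(m, -n, -r, -t)"]) (auto simp: hurwitz_def)
qed

text \<open>For the trace form the plane of 1, r is orthogonal to that of s, r s. The Gram
  determinant of 1, r is -3, which is the source of the denominators and of the factor 3 before the
  determinant.\<close>

lemma dicyclic_expand:
  fixes x :: "complex^2^2"
  defines "m \<equiv> trace x" and "n \<equiv> trace (x ** rD)" and "r \<equiv> trace (x ** sD)" and "t \<equiv> trace (x ** (rD ** sD))"
  shows "x = mat ((m - n) / 3) + mat (- (m + 2 * n) / 3) ** rD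
     + (mat (- (2 * r + t) / 3) + mat (- (r + 2 * t) / 3) ** rD) ** sD" (is ?A)
    "3 * det x = m * m + m * n + n * n + (r * r + r * t + t * t)" (is ?B)
proof -
  have n: "pD * pD - pD * qD + qD * qD = -1" by (rule norm_equations)
  have e: "qD * qD = - 1 - pD * pD + pD * qD" using n by algebra
  have e': "qD * (qD * y) = - y - pD * (pD * y) + pD * (qD * y)" for y using n by algebra
  show ?A
    unfolding m_def n_def r_def t_def
    by (simp add: mat_expand companion_def partner_def trace_2 field_simps e e')
  show ?B
    unfolding m_def n_def r_def t_def
    by (simp add: det_2 mat_expand companion_def partner_def trace_2 algebra_simps e e')
qed

text \<open>The vectors of norm 1 are left unlisted: in a decomposition of 3 the other summand would
  be 2, a value that does not occur.\<close>

lemma hexagonal_norm_cases: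
  fixes m n :: int
  assumes "m \<in> {-2, -1, 0, 1, 2}" "n \<in> {-2, -1, 0, 1, 2}"
  shows "m * m + m * n + n * n = 0 \<and> m = 0 \<and> n = 0 \<or> m * m + m * n + n * n = 1 \<or>
    m * m + m * n + n * n = 3 \<and> (m, n) \<in> {(2, -1), (-2, 1), (1, 1), (-1, -1), (1, -2), (-1, 2)} \<or>
    m * m + m * n + n * n > 3"
  using assms by (elim insertE emptyE; simp)

text \<open>The two summands of \<open>3 det x\<close> are values of the form \<open>m\<^sup>2 + m n + n\<^sup>2\<close>, which does not represent \<open>2\<close>.\<close>

lemma sl2_set_dicyclic:
  assumes H: "sl2_set H" and rs: "rD \<in> H" "sD \<in> H" and x: "x \<in> H"
  shows "\<exists>t\<in>carrier C3_sdp_C4. x = fD t"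
proof -
  have mult: "x ** y \<in> H" if "x \<in> H" "y \<in> H" for x y using H that by (simp add: sl2_set_def)
  obtain m where m: "trace x = of_int m" "m \<in> {-2, -1, 0, 1, 2}" using sl2_set_trace_int[OF H x] by blast
  obtain n where n: "trace (x ** rD) = of_int n" "n \<in> {-2, -1, 0, 1, 2}"
    using sl2_set_trace_int[OF H mult[OF x rs(1)]] by blast
  obtain r where r: "trace (x ** sD) = of_int r" "r \<in> {-2, -1, 0, 1, 2}"
    using sl2_set_trace_int[OF H mult[OF x rs(2)]] by blast
  obtain t where t: "trace (x ** (rD ** sD)) = of_int t" "t \<in> {-2, -1, 0, 1, 2}"
    using sl2_set_trace_int[OF H mult[OF x mult[OF rs]]] by blast
  define V where "V a b = mat ((of_int a - of_int b) / 3) + mat (- (of_int a + 2 * of_int b) / 3) ** rD" for a b :: int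
  define W where "W a b = mat (- (2 * of_int a + of_int b) / 3) + mat (- (of_int a + 2 * of_int b) / 3) ** rD" for a b :: int
  have eq: "x = V m n + W r t ** sD"
    unfolding V_def W_def by (rule dicyclic_expand(1)[of x, unfolded m n r t])
  have V0: "V 0 0 = 0" "W 0 0 = 0" by (simp_all add: V_def W_def mat_expand)
  have V: "V 2 (-1) = mat 1" "V (-2) 1 = - mat 1" "V 1 1 = - rD" "V (-1) (-1) = rD"
      "V 1 (-2) = - (rD ** rD)" "V (-1) 2 = rD ** rD"
    and W: "W 2 (-1) = - mat 1" "W (-2) 1 = mat 1" "W 1 1 = - mat 1 - rD" "W (-1) (-1) = mat 1 + rD"
      "W 1 (-2) = rD" "W (-1) 2 = - rD"
    by (simp_all add: V_def W_def mat_expand companion_def)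
  have rr: "mat 1 + rD = - (rD ** rD)" "- mat 1 - rD = rD ** rD" by (simp_all add: mat_expand companion_def)
  have "det x = 1" using H x by (simp add: sl2_set_def)
  then have "of_int (m * m + m * n + n * n + (r * r + r * t + t * t)) = (of_int 3 :: complex)"
    using dicyclic_expand(2)[of x] by (simp add: m n r t)
  then have s3: "(m * m + m * n + n * n) + (r * r + r * t + t * t) = 3" by (simp only: of_int_eq_iff)
  have pos: "m * m + m * n + n * n \<ge> 0" "r * r + r * t + t * t \<ge> 0"
    using hexagonal_norm_cases[OF m(2) n(2)] hexagonal_norm_cases[OF r(2) t(2)] by linarith+
  have "r = 0 \<and> t = 0 \<and> (m, n) \<in> {(2, -1), (-2, 1), (1, 1), (-1, -1), (1, -2), (-1, 2)} \<or>
    m = 0 \<and> n = 0 \<and> (r, t) \<in> {(2, -1), (-2, 1), (1, 1), (-1, -1), (1, -2), (-1, 2)}"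
    using hexagonal_norm_cases[OF m(2) n(2)] hexagonal_norm_cases[OF r(2) t(2)] s3 pos by linarith
  \<comment> \<open>Each of the two planes contributes its six vectors of norm 3.\<close>
  then have "x \<in> {mat 1, - mat 1, - rD, rD, - (rD ** rD), rD ** rD, - sD, sD, (rD ** rD) ** sD, - (rD ** rD) ** sD, rD ** sD, - rD ** sD}"
    unfolding eq by (elim disjE conjE insertE emptyE; simp add: V0 V W rr matrix_minus_mult)
  moreover have "mat 1 = fD (0, 0)" "- mat 1 = fD (0, 2)" "- rD = fD (1, 2)" "rD = fD (1, 0)"
    "- (rD ** rD) = fD (2, 2)" "rD ** rD = fD (2, 0)" "- sD = fD (0, 3)" "sD = fD (0, 1)"
    "(rD ** rD) ** sD = fD (2, 1)" "- (rD ** rD) ** sD = fD (2, 3)" "rD ** sD = fD (1, 1)" "- rD ** sD = fD (1, 3)"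
    by (simp_all add: fD_def powr3_def powr4_def matrix_minus_mult)
  ultimately have "x \<in> fD ` carrier C3_sdp_C4"
    unfolding carrier_C3_sdp_C4 by (elim insertE emptyE) (simp only: , rule imageI, simp)+
  then show ?thesis by blast
qed

section \<open>The eight groups\<close>

definition twisted :: "('a \<Rightarrow> complex) \<Rightarrow> ('a \<Rightarrow> complex^2^2) \<Rightarrow> 'a \<Rightarrow> complex^3^3" where
  "twisted e f x = blk (e x) (f x)"

definition doubled :: "('a \<Rightarrow> complex^2^2) \<Rightarrow> int \<times> 'a \<Rightarrow> complex^3^3" where
  "doubled f x = blk (if fst x = 0 then 1 else -1) (f (snd x))"

text \<open>The sign characters that yield the second class for each type: the kernel of
  \<open>signQ\<close> is the cyclic group generated by i, that of \<open>signD\<close> the cyclic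
  subgroup of order 6.\<close>

fun signQ :: "int_quaternion \<Rightarrow> complex" where
  "signQ (a, b, c, d) = (if c = 0 \<and> d = 0 then 1 else -1)"

definition signD :: "int \<times> int \<Rightarrow> complex" where
  "signD x = (if even (snd x) then 1 else -1)"

definition standard_groups :: "(complex^3^3) set list" where
  "standard_groups =
    [twisted (\<lambda>_. 1) fQ ` carrier Q8, twisted signQ fQ ` carrier Q8,
     twisted (\<lambda>_. 1) fD ` carrier C3_sdp_C4, twisted signD fD ` carrier C3_sdp_C4,
     doubled fQ ` ({0, 1} \<times> carrier Q8), doubled fD ` ({0, 1} \<times> carrier C3_sdp_C4),
     twisted (\<lambda>_. 1) fT ` hurwitz, doubled fT ` ({0, 1} \<times> hurwitz)]"

text \<open>Multiplying by diag(-1, 1, 1) shows that both signs occur over every matrix of the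
  projection.\<close>

lemma blk_group_full:
  assumes G: "blk_group G" and m1: "blk (-1) (mat 1) \<in> G" and proj: "blk_proj G = f ` S"
  shows "G = doubled f ` ({0, 1} \<times> S)"
proof
  show "G \<subseteq> doubled f ` ({0, 1} \<times> S)"
  proof
    fix x assume x: "x \<in> G"
    then obtain c M where cM: "x = blk c M" "c = 1 \<or> c = -1" using G by (auto simp: blk_group_def)
    then have "M \<in> f ` S" using x by (auto simp flip: proj simp: blk_proj_def)
    then obtain s where "s \<in> S" "M = f s" by blast
    then show "x \<in> doubled f ` ({0, 1} \<times> S)"
      using cM by (intro image_eqI[of _ _ "(if c = 1 then 0 else 1, s)"]) (auto simp: doubled_def)
  qed
  show "doubled f ` ({0, 1} \<times> S) \<subseteq> G"
  proof
    fix x assume "x \<in> doubled f ` ({0, 1} \<times> S)"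
    then obtain c s where x: "x = blk c (f s)" "c = 1 \<or> c = -1" "s \<in> S" by (auto simp: doubled_def)
    then have "f s \<in> blk_proj G" by (simp add: proj)
    then obtain c' where c': "blk c' (f s) \<in> G" by (auto simp: blk_proj_def)
    have "blk (- c') (f s) \<in> G" using blk_group_mult[OF G m1 c'] by simp
    then show "x \<in> G" using blk_groupD(1)[OF G c'] x c' by auto
  qed
qed

text \<open>Without diag(-1, 1, 1) the projection is injective: two signs over one matrix would
  produce it as a quotient. So the group is the graph of a sign function.\<close>

lemma blk_group_twisted:
  assumes G: "blk_group G" and m1: "blk (-1) (mat 1) \<notin> G" and proj: "blk_proj G = f ` S"
    and e: "\<And>s. s \<in> S \<Longrightarrow> e s = (if blk 1 (f s) \<in> G then 1 else -1)"
  shows "G = twisted e f ` S"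
proof
  show "G \<subseteq> twisted e f ` S"
  proof
    fix x assume x: "x \<in> G"
    then obtain c M where cM: "x = blk c M" "c = 1 \<or> c = -1" using G by (auto simp: blk_group_def)
    then have "M \<in> f ` S" using x by (auto simp flip: proj simp: blk_proj_def)
    then obtain s where s: "s \<in> S" "M = f s" by blast
    have "e s = c"
    proof (rule ccontr)
      assume "e s \<noteq> c"
      then have "c = -1" "blk 1 (f s) \<in> G" using e[OF s(1)] cM x s by (auto split: if_splits)
      then have "blk (-1) (f s ** inv2 (f s)) \<in> G"
        using blk_group_mult[OF G, of "-1" "f s" 1 "inv2 (f s)"] blk_groupD(4)[OF G, of 1 "f s"] x cM s by auto
      moreover have "det (f s) = 1" using blk_groupD(2)[OF G] x cM s by auto
      ultimately show False using m1 by (simp add: inv2_mult)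
    qed
    then show "x \<in> twisted e f ` S" using s cM by (auto simp: twisted_def)
  qed
  show "twisted e f ` S \<subseteq> G"
  proof
    fix x assume "x \<in> twisted e f ` S"
    then obtain s where s: "x = blk (e s) (f s)" "s \<in> S" by (auto simp: twisted_def)
    then have "f s \<in> blk_proj G" by (simp add: proj)
    then obtain c' where c': "blk c' (f s) \<in> G" by (auto simp: blk_proj_def)
    then show "x \<in> G" using blk_groupD(1)[OF G c'] e[OF s(2)] s(1) by (auto split: if_splits)
  qed
qed

text \<open>The odd elements of \<open>hurwitz\<close> form the two nontrivial cosets of the quaternion group, represented by
  \<open>w = (1 + i + j + k)/2\<close> and its inverse.\<close>

lemma inv2_fT: "inv2 (fT (a, b, c, d)) = fT (a, -b, -c, -d)"
  by (simp add: inv2_def qmat_def vec_eq_iff forall_2 algebra_simps)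

lemma hurwitz_odd_coset:
  assumes "t \<in> hurwitz_odd"
  shows "inv2 (fT t) ** fT (1, 1, 1, 1) \<in> fT ` hurwitz_even \<or> fT t ** fT (1, 1, 1, 1) \<in> fT ` hurwitz_even"
proof -
  obtain a b c d where t: "t = (a, b, c, d)" by (metis prod_cases4)
  have h: "(a, - b, - c, - d) \<in> hurwitz" "(a, b, c, d) \<in> hurwitz" "(1, 1, 1, 1) \<in> hurwitz"
    using assms by (auto simp: t hurwitz_odd_def signs_def hurwitz_def)
  have "halve (quaternion_mult (a, -b, -c, -d) (1, 1, 1, 1)) \<in> hurwitz_even \<or>
      halve (quaternion_mult (a, b, c, d) (1, 1, 1, 1)) \<in> hurwitz_even"
    using assms unfolding t hurwitz_odd_def signs_def
    by (elim SigmaE insertE emptyE; hypsubst; clarsimp simp: hurwitz_even_def)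
  then show ?thesis
    unfolding t inv2_fT fT_mult[OF h(1,3), symmetric] fT_mult[OF h(2,3), symmetric] by blast
qed

text \<open>Odd elements belong to \<open>N\<close> all together or not at all. This is used for the
  projection of the group and for the matrices that occur with sign 1.\<close>

lemma hurwitz_closure:
  assumes mult: "\<And>x y. x \<in> N \<Longrightarrow> y \<in> N \<Longrightarrow> x ** y \<in> N" and inv: "\<And>x. x \<in> N \<Longrightarrow> inv2 x \<in> N"
    and even: "fT ` hurwitz_even \<subseteq> N" and t: "t \<in> hurwitz_odd"
  shows "fT t \<in> N \<longleftrightarrow> fT (1, 1, 1, 1) \<in> N"
proof -
  define T where "T = fT t"
  define W where "W = fT (1, 1, 1, 1)"
  have dT: "det T = 1" and dW: "det W = 1"
    using det_fT[of t] t by (simp_all add: T_def W_def hurwitz_eq det_QM)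
  have "inv2 T ** W \<in> N \<or> T ** W \<in> N"
    using hurwitz_odd_coset[OF t] even unfolding T_def W_def by blast
  moreover have "W = T ** (inv2 T ** W)" "W = inv2 T ** (T ** W)" "T = (T ** W) ** inv2 W"
    by (simp_all add: matrix_mul_assoc inv2_mult dT) (simp add: inv2_mult dW flip: matrix_mul_assoc)
  moreover have "T = W ** inv2 (inv2 T ** W)"
  proof -
    have "det (inv2 T ** W) = 1" using dT dW by (simp add: det_mul) (simp add: det_2 inv2_def algebra_simps)
    then have "T = T ** ((inv2 T ** W) ** inv2 (inv2 T ** W))" by (simp add: inv2_mult)
    also have "\<dots> = (T ** inv2 T) ** W ** inv2 (inv2 T ** W)" by (simp only: matrix_mul_assoc)
    finally show ?thesis by (simp add: inv2_mult dT)
  qed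
  ultimately show ?thesis
    unfolding T_def[symmetric] W_def[symmetric] using mult inv by metis
qed

lemma fT_even: "fT ` hurwitz_even = fQ ` carrier Q8"
  by (simp add: hurwitz_even_def Q8_def)

lemma fQ_carrier_subset:
  assumes mult: "\<And>x y. x \<in> N \<Longrightarrow> y \<in> N \<Longrightarrow> x ** y \<in> N"
    and I: "QM 0 1 0 0 \<in> N" and J: "QM 0 0 1 0 \<in> N"
  shows "fQ ` carrier Q8 \<subseteq> N"
proof -
  have m1: "QM (-1) 0 0 0 \<in> N" using mult[OF I I] by (simp add: QM_mult)
  have K: "QM 0 0 0 1 \<in> N" using mult[OF I J] by (simp add: QM_mult)
  show ?thesis
    using m1 mult[OF m1 m1] I mult[OF m1 I] J mult[OF m1 J] K mult[OF m1 K]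
    by (simp add: Q8_def QM_mult)
qed

text \<open>The group is recovered from three data: its projection \<open>H\<close>, the subgroup
  \<open>N\<close> of matrices that occur with sign 1, and whether diag(-1, 1, 1) belongs to
  it.\<close>

lemma blk_group_standard:
  assumes G: "blk_group G" and par: "(u, p, q) \<in> standard_params"
    and a: "blk 1 (companion u) \<in> G" and b: "blk c (partner u p q) \<in> G"
  shows "G \<in> set standard_groups"
proof -
  define H where "H = blk_proj G"
  have H: "sl2_set H" unfolding H_def by (rule sl2_set_blk_proj[OF G])
  have Hm: "x ** y \<in> H" if "x \<in> H" "y \<in> H" for x y using H that by (simp add: sl2_set_def)
  have Hi: "inv2 x \<in> H" if "x \<in> H" for x using H that by (simp add: sl2_set_def)
  define N where "N = {M. blk 1 M \<in> G}"
  have Nm: "x ** y \<in> N" if "x \<in> N" "y \<in> N" for x y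
    using blk_group_mult[OF G, of 1 x 1 y] that by (simp add: N_def)
  have Ni: "inv2 x \<in> N" if "x \<in> N" for x using blk_groupD(4)[OF G] that by (simp add: N_def)
  have aH: "companion u \<in> H" and bH: "partner u p q \<in> H" and aN: "companion u \<in> N"
    using a b by (auto simp: H_def blk_proj_def N_def)
  have one: "mat 1 \<in> N" using blk_group_one[OF G] by (simp add: N_def)
  show ?thesis
  proof (cases "u = 0")
    case True
    then have "p = pQ" "q = qQ" using par by (auto simp: standard_params_def)
    then have I: "QM 0 1 0 0 \<in> H" "QM 0 1 0 0 \<in> N" and J: "QM 0 0 1 0 \<in> H" "blk c (QM 0 0 1 0) \<in> G"
      using aH bH aN b True by (simp_all add: companion_QM partner_QM)
    have QH: "fQ ` carrier Q8 \<subseteq> H" by (rule fQ_carrier_subset[OF Hm I(1) J(1)])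
    have H_hur: "H \<subseteq> fT ` hurwitz" using sl2_set_hurwitz[OF H I(1) J(1)] by blast
    have m1N: "QM (-1) 0 0 0 \<in> N" using Nm[OF I(2) I(2)] by (simp add: QM_mult)
    show ?thesis
    proof (cases "fT (1, 1, 1, 1) \<in> H")
      case False
      have H_eq: "H = fQ ` carrier Q8"
        using QH H_hur hurwitz_closure[of H, OF Hm Hi QH[folded fT_even]] False
        unfolding hurwitz_eq fT_even[symmetric] by blast
      show ?thesis
      proof (cases "blk (-1) (mat 1) \<in> G")
        case True
        then show ?thesis using blk_group_full[OF G True H_eq[unfolded H_def]] by (simp add: standard_groups_def)
      next
        case m1: False
        show ?thesis
        proof (cases "QM 0 0 1 0 \<in> N")
          case True
          have "fQ ` carrier Q8 \<subseteq> N" by (rule fQ_carrier_subset[OF Nm I(2) True])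
          then have "G = twisted (\<lambda>_. 1) fQ ` carrier Q8"
            by (intro blk_group_twisted[OF G m1 H_eq[unfolded H_def]]) (auto simp: N_def)
          then show ?thesis by (simp add: standard_groups_def)
        next
          \<comment> \<open>Since i and -1 lie in \<open>N\<close>, a single missing j excludes the
            whole coset -j, k, -k, for instance by k i = j.\<close>
          case JN: False
          have neg: "fQ (0, 0, -1, 0) \<notin> N"
            using Nm[OF m1N, of "fQ (0, 0, -1, 0)"] JN by (auto simp: QM_mult)
          have KN: "fQ (0, 0, 0, 1) \<notin> N"
            using Nm[of "fQ (0, 0, 0, 1)" "QM 0 1 0 0"] I(2) JN by (auto simp: QM_mult)
          have negK: "fQ (0, 0, 0, -1) \<notin> N"
            using Nm[OF m1N, of "fQ (0, 0, 0, -1)"] KN by (auto simp: QM_mult)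
          have pos: "fQ (1, 0, 0, 0) \<in> N" "fQ (0, 1, 0, 0) \<in> N" "fQ (-1, 0, 0, 0) \<in> N" "fQ (0, -1, 0, 0) \<in> N"
            using one I(2) m1N Nm[OF m1N I(2)] by (simp_all add: QM_mult QM_1)
          have "signQ s = (if fQ s \<in> N then 1 else -1)" if "s \<in> carrier Q8" for s
            using that pos neg KN negK JN unfolding Q8_def
            by (simp del: fQ.simps, elim disjE; hypsubst) (simp_all del: fQ.simps, simp)
          then have "G = twisted signQ fQ ` carrier Q8"
            by (intro blk_group_twisted[OF G m1 H_eq[unfolded H_def]]) (simp add: N_def)
          then show ?thesis by (simp add: standard_groups_def)
        qed
      qed
    next
      case WH: True
      define W where "W = fT (1, 1, 1, 1)"
      have "fT ` hurwitz_odd \<subseteq> H"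
        using hurwitz_closure[of H, OF Hm Hi QH[folded fT_even]] WH by blast
      then have H_eq: "H = fT ` hurwitz"
        using QH H_hur unfolding hurwitz_eq fT_even[symmetric] by blast
      show ?thesis
      proof (cases "blk (-1) (mat 1) \<in> G")
        case True
        then show ?thesis using blk_group_full[OF G True H_eq[unfolded H_def]] by (simp add: standard_groups_def)
      next
        case m1: False
        obtain d where d: "blk d W \<in> G" using WH by (auto simp: H_def blk_proj_def W_def)
        have d1: "d = 1 \<or> d = -1" using blk_groupD(1)[OF G d] .
        \<comment> \<open>The cube of W is -1, which has sign 1. As d^3 = d, the sign of W is itself
          1; otherwise diag(-1, 1, 1) would be in the group.\<close>
        have W3: "W ** (W ** W) = QM (-1) 0 0 0" by (simp add: W_def QM_mult)
        have "blk (d * (d * d)) (W ** (W ** W)) \<in> G"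
          using blk_group_mult[OF G d blk_group_mult[OF G d d]] .
        then have "blk d (QM (-1) 0 0 0) \<in> G" using d1 by (auto simp: W3)
        moreover have "blk 1 (QM (-1) 0 0 0) \<in> G" using m1N by (simp add: N_def)
        ultimately have "blk (d * 1) (QM (-1) 0 0 0 ** QM (-1) 0 0 0) \<in> G" by (rule blk_group_mult[OF G])
        then have "blk d (mat 1) \<in> G" by (simp add: QM_mult QM_1)
        then have "d = 1" using d1 m1 by auto
        then have WN: "W \<in> N" using d by (simp add: N_def)
        \<comment> \<open>Conjugation by W permutes i, j, k cyclically, so j inherits sign 1 from i.
          This rules out a twisted variant of SL(2,3).\<close>
        have "W ** (QM 0 1 0 0 ** inv2 W) = QM 0 0 1 0"
          by (simp add: W_def inv2_fT del: fT.simps) (simp add: QM_mult)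
        then have JN: "QM 0 0 1 0 \<in> N" using Nm[OF WN Nm[OF I(2) Ni[OF WN]]] by simp
        have QN: "fQ ` carrier Q8 \<subseteq> N" by (rule fQ_carrier_subset[OF Nm I(2) JN])
        then have "fT ` hurwitz \<subseteq> N"
          using hurwitz_closure[of N, OF Nm Ni QN[folded fT_even]] WN
          unfolding hurwitz_eq fT_even[symmetric] W_def by blast
        then have "G = twisted (\<lambda>_. 1) fT ` hurwitz"
          by (intro blk_group_twisted[OF G m1 H_eq[unfolded H_def]]) (auto simp: N_def)
        then show ?thesis by (simp add: standard_groups_def)
      qed
    qed
  next
    case False
    then have u: "u = -1" "p = pD" "q = qD" using par by (auto simp: standard_params_def)
    have r: "rD \<in> H" "rD \<in> N" and s: "sD \<in> H" "blk c sD \<in> G" using aH bH aN b u by simp_all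
    have oneH: "mat 1 \<in> H" using H by (simp add: sl2_set_def)
    have r3: "powr3 n \<in> H" "powr3 n \<in> N" for n
      using r one oneH Hm[OF r(1) r(1)] Nm[OF r(2) r(2)] by (simp_all add: powr3_def)
    have "blk (c * c) (sD ** sD) \<in> G" by (rule blk_group_mult[OF G s(2) s(2)])
    then have m1N: "- mat 1 \<in> N" using blk_groupD(1)[OF G s(2)] by (auto simp: dicyclic_relations N_def)
    then have m1H: "- mat 1 \<in> H" by (auto simp: N_def H_def blk_proj_def)
    have "- sD \<in> H" using Hm[OF m1H s(1)] by (simp add: matrix_minus_mult)
    then have "powr4 n \<in> H" for n
      using s(1) oneH m1H by (simp add: powr4_def)
    then have fDH: "fD x \<in> H" for x unfolding fD_def by (intro Hm r3(1))
    have H_eq: "H = fD ` carrier C3_sdp_C4"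
    proof
      show "H \<subseteq> fD ` carrier C3_sdp_C4"
      proof
        fix x assume "x \<in> H"
        from sl2_set_dicyclic[OF H r(1) s(1) this] show "x \<in> fD ` carrier C3_sdp_C4" by auto
      qed
    qed (auto intro: fDH)
    show ?thesis
    proof (cases "blk (-1) (mat 1) \<in> G")
      case True
      then show ?thesis using blk_group_full[OF G True H_eq[unfolded H_def]] by (simp add: standard_groups_def)
    next
      case m1: False
      have powr4_N: "powr4 h \<in> N" if "h \<in> {0,1,2,3}" "even h" for h
        using that one m1N by (auto simp: powr4_def)
      have neg: "- x \<in> N" if "x \<in> N" for x using Nm[OF m1N that] by (simp add: matrix_minus_mult)
      have powr4_N': "powr4 h \<in> N \<longleftrightarrow> sD \<in> N" if "h \<in> {0,1,2,3}" "odd h" for h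
        using that neg[of sD] neg[of "- sD"] by (auto simp: powr4_def)
      \<comment> \<open>The component of order 3 has sign 1 throughout, so membership depends on the
        component in the group of order 4 alone.\<close>
      have fD_N: "fD x \<in> N \<longleftrightarrow> powr4 (snd x) \<in> N" for x
      proof
        have d: "det (powr3 (fst x)) = 1" using r3(1)[of "fst x"] H by (auto simp: sl2_set_def)
        assume "fD x \<in> N"
        then have "inv2 (powr3 (fst x)) ** fD x \<in> N" by (intro Nm Ni r3(2))
        then show "powr4 (snd x) \<in> N" by (simp add: fD_def matrix_mul_assoc inv2_mult d)
      qed (auto simp: fD_def intro: Nm r3)
      show ?thesis
      proof (cases "sD \<in> N")
        case True
        have "fD x \<in> N" if "x \<in> carrier C3_sdp_C4" for x
          using that powr4_N[of "snd x"] powr4_N'[of "snd x"] True unfolding fD_N carrier_C3_sdp_C4 by auto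
        then have "G = twisted (\<lambda>_. 1) fD ` carrier C3_sdp_C4"
          by (intro blk_group_twisted[OF G m1 H_eq[unfolded H_def]]) (auto simp: N_def)
        then show ?thesis by (simp add: standard_groups_def)
      next
        case False
        have "signD x = (if fD x \<in> N then 1 else -1)" if "x \<in> carrier C3_sdp_C4" for x
          using that powr4_N[of "snd x"] powr4_N'[of "snd x"] False unfolding fD_N carrier_C3_sdp_C4 signD_def by auto
        then have "G = twisted signD fD ` carrier C3_sdp_C4"
          by (intro blk_group_twisted[OF G m1 H_eq[unfolded H_def]]) (simp add: N_def)
        then show ?thesis by (simp add: standard_groups_def)
      qed
    qed
  qed
qed

lemma nonrational_conj_standard:
  assumes "KK_group G" "\<not> rationalizable G"
  obtains P Q where "KK_inverses P Q" "conj_by P Q G \<in> set standard_groups"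
  using nonrational_normal_form[OF assms] blk_group_standard by metis

section \<open>The standard groups are not rational\<close>

definition bil :: "(complex^3^3) set \<Rightarrow> complex^3 \<Rightarrow> complex^3 \<Rightarrow> complex" where
  "bil G v w = (\<Sum>x\<in>G. \<Sum>i\<in>UNIV. (x *v v) $ i * (x *v w) $ i)"

lemma bil_linear:
  "bil G v (w + w') = bil G v w + bil G v w'" "bil G v (c *s w) = c * bil G v w"
  "bil G (v + v') w = bil G v w + bil G v' w" "bil G (c *s v) w = c * bil G v w"
  by (simp_all add: bil_def matrix_vector_right_distrib vector_scalar_commute
      sum.distrib sum_distrib_left algebra_simps)

lemma bil_sym: "bil G v w = bil G w v"
  by (simp add: bil_def mult.commute)

lemma bil_invariant:
  assumes G: "KK_group G" and x: "x \<in> G"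
  shows "bil G (x *v v) (x *v w) = bil G v w"
proof -
  from sum.reindex_bij_betw[OF KK_group_bij_right_mult[OF assms], of "\<lambda>z. \<Sum>i\<in>UNIV. (z *v v) $ i * (z *v w) $ i"]
  show ?thesis by (simp add: bil_def matrix_vector_mul_assoc)
qed

text \<open>A rational group preserves the symmetric bilinear form \<open>bil\<close>, which is nondegenerate because it is a
  positive definite Hermitian form twisted by complex conjugation. On the last two coordinates, however,
  the only symmetric form invariant under \<open>companion u\<close> and \<open>partner u p q\<close> is zero.\<close>

lemma not_rationalizable:
  assumes G: "KK_group G" and par: "(u, p, q) \<in> standard_params"
    and a: "blk 1 (companion u) \<in> G" and b: "blk c (partner u p q) \<in> G"
  shows "\<not> rationalizable G"
proof
  assume "rationalizable G"
  then obtain P Q where PQ: "KK_inverses P Q" and rat: "\<And>x. x \<in> G \<Longrightarrow> entries_in \<rat> (Q ** x ** P)"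
    by (auto simp: rationalizable_def)
  define R where "R = conj_by P Q G"
  have R: "KK_group R" unfolding R_def by (rule KK_group_conj_by[OF G PQ])
  have real: "cnj (y $ i $ j) = y $ i $ j" if "y \<in> R" for y i j
  proof -
    have "y $ i $ j \<in> \<rat>" using that rat by (auto simp: R_def conj_by_def entries_in_def)
    moreover have "cnj (of_rat q) = of_rat q" for q by (cases q) (simp add: of_rat_rat)
    ultimately show ?thesis by (auto elim!: Rats_cases)
  qed
  define B where "B v w = bil R (Q *v v) (Q *v w)" for v w
  have lin: "B v (w + w') = B v w + B v w'" "B v (c *s w) = c * B v w"
    "B (v + v') w = B v w + B v' w" "B (c *s v) w = c * B v w" for v v' w w' c
    by (simp_all add: B_def matrix_vector_right_distrib vector_scalar_commute bil_linear)
  have sym: "B v w = B w v" for v w unfolding B_def by (rule bil_sym)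
  have inv: "B (x *v v) (x *v w) = B v w" if "x \<in> G" for x v w
  proof -
    have xR: "Q ** x ** P \<in> R" unfolding R_def by (rule conj_byI[OF that])
    have "Q *v (x *v z) = (Q ** x ** P) *v (Q *v z)" for z
      by (simp add: matrix_vector_mul_assoc KK_inverses_cancel[OF PQ])
    then show ?thesis unfolding B_def using bil_invariant[OF R xR] by simp
  qed
  define e1 e2 e3 :: "complex^3" where "e1 = axis 1 1" and "e2 = axis 2 1" and "e3 = axis 3 1"
  note e = e1_def e2_def e3_def
  have X: "blk 1 (companion u) *v e1 = e1" "blk 1 (companion u) *v e2 = e3"
      "blk 1 (companion u) *v e3 = (-1) *s e2 + u *s e3"
    by (simp_all add: e vec_eq_iff forall_3 mult_axis companion_def) (simp_all add: axis_def)
  have Y: "blk c (partner u p q) *v e2 = p *s e2 + q *s e3"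
    by (simp_all add: e vec_eq_iff forall_3 mult_axis partner_def) (simp_all add: axis_def)
  have pq: "p * p + u * p * q + q * q = -1" and u2: "u = 0 \<or> u = -1"
    using par norm_equations by (auto simp: standard_params_def)
  have 1: "B e1 e2 = B e1 e3" using inv[OF a, of e1 e2] by (simp add: X)
  have "B e1 e3 = - B e1 e2 + u * B e1 e3" using inv[OF a, of e1 e3, unfolded X lin] by simp
  then have "(2 - u) * B e1 e2 = 0" using 1 by (simp add: algebra_simps)
  then have b12: "B e1 e2 = 0" using u2 by auto
  have 2: "B e2 e2 = B e3 e3" using inv[OF a, of e2 e2] by (simp add: X)
  have "B e2 e3 = - B e2 e3 + u * B e3 e3" using inv[OF a, of e2 e3, unfolded X lin] sym[of e3 e2] by simp
  then have 3: "2 * B e2 e3 = u * B e2 e2" using 2 by algebra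
  \<comment> \<open>Up to this point \<open>B\<close> on the plane of e2, e3 is a multiple of x^2 +
    u x y + y^2. Its value at the image p e2 + q e3 of e2 is -1 times that at e2, by the norm
    equation.\<close>
  have 4: "B e2 e2 = p * (p * B e2 e2) + q * (p * B e2 e3) + (p * (q * B e2 e3) + q * (q * B e3 e3))"
    using inv[OF b, of e2 e2, unfolded Y lin] sym[of e3 e2] by (simp add: algebra_simps)
  have "B e2 e2 = p * p * B e2 e2 + p * q * (2 * B e2 e3) + q * q * B e2 e2"
    using 4 by (simp add: algebra_simps flip: 2)
  also have "\<dots> = (p * p + u * p * q + q * q) * B e2 e2"
    unfolding 3 by (simp add: algebra_simps)
  finally have "B e2 e2 = - B e2 e2" unfolding pq by simp
  then have b22: "B e2 e2 = 0" by simp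
  then have b32: "B e3 e2 = 0" using 3 by (simp add: sym[of e3 e2])
  have B0: "B v e2 = 0" for v
  proof -
    have "v = (v $ 1) *s e1 + (v $ 2) *s e2 + (v $ 3) *s e3"
      by (simp add: vec_eq_iff forall_3 axis_def e)
    then have "B v e2 = B ((v $ 1) *s e1 + (v $ 2) *s e2 + (v $ 3) *s e3) e2" by simp
    then show ?thesis by (simp add: lin b12 b22 b32)
  qed
  define w where "w = Q *v e2"
  have "w \<noteq> 0"
  proof
    assume "w = 0"
    then have "P *v w = 0" by simp
    then have "e2 = 0" using PQ by (simp add: w_def matrix_vector_mul_assoc KK_inverses_def)
    then show False by (auto simp: e vec_eq_iff forall_3 axis_def)
  qed
  \<comment> \<open>Matrices in \<open>R\<close> have real entries, so conjugating the first
    argument turns the bilinear form into the Hermitian one, which is positive definite.\<close>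
  define w' :: "complex^3" where "w' = (\<chi> i. cnj (w $ i))"
  have yw: "(y *v w') $ i = cnj ((y *v w) $ i)" if "y \<in> R" for y i
    using real[OF that] by (simp add: matrix_vector_mult_def w'_def sum_3)
  have "herm R w w = bil R w' w"
    unfolding herm_def bil_def by (intro sum.cong refl) (simp add: yw)
  also have "\<dots> = B (P *v w') e2"
    using PQ by (simp add: B_def w_def matrix_vector_mul_assoc KK_inverses_def)
  also have "\<dots> = 0" by (rule B0)
  finally show False using herm_self_nz[OF R \<open>w \<noteq> 0\<close>] by simp
qed

section \<open>Models\<close>

definition sl2_model :: "('a, 'b) monoid_scheme \<Rightarrow> ('a \<Rightarrow> complex^2^2) \<Rightarrow> bool" where
  "sl2_model M f \<longleftrightarrow> group M \<and> finite (carrier M) \<and> inj_on f (carrier M) \<and> f \<one>\<^bsub>M\<^esub> = mat 1 \<and>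
     (\<forall>x\<in>carrier M. \<forall>y\<in>carrier M. f (x \<otimes>\<^bsub>M\<^esub> y) = f x ** f y) \<and>
     (\<forall>x\<in>carrier M. entries_in KK (f x) \<and> det (f x) = 1)"

lemma mult_GL: "x \<otimes>\<^bsub>(GL F)\<lparr>carrier := H\<rparr>\<^esub> y = x ** y" "x \<otimes>\<^bsub>GL F\<^esub> y = x ** y" "\<one>\<^bsub>GL F\<^esub> = mat 1"
  by (simp_all add: GL_def units_of_def mat_monoid_def)

lemma model_group:
  fixes M :: "('a, 'b) monoid_scheme" and \<phi> :: "'a \<Rightarrow> complex^3^3"
  assumes M: "group M" "finite (carrier M)" and inj: "inj_on \<phi> (carrier M)" and one: "\<phi> \<one>\<^bsub>M\<^esub> = mat 1"
    and mult: "\<And>x y. x \<in> carrier M \<Longrightarrow> y \<in> carrier M \<Longrightarrow> \<phi> (x \<otimes>\<^bsub>M\<^esub> y) = \<phi> x ** \<phi> y"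
    and ent: "\<And>x. x \<in> carrier M \<Longrightarrow> entries_in KK (\<phi> x)"
  shows "KK_group (\<phi> ` carrier M)" "(GL KK)\<lparr>carrier := \<phi> ` carrier M\<rparr> \<cong> M" "card (\<phi> ` carrier M) = card (carrier M)"
proof -
  interpret group M by fact
  show "KK_group (\<phi> ` carrier M)"
    unfolding KK_group_def
  proof (intro conjI ballI)
    show "mat 1 \<in> \<phi> ` carrier M" unfolding one[symmetric] by (rule imageI) simp
    fix x assume "x \<in> \<phi> ` carrier M"
    then obtain m where m: "m \<in> carrier M" "x = \<phi> m" by blast
    show "entries_in KK x" using m ent by simp
    show "\<exists>y\<in>\<phi> ` carrier M. x ** y = mat 1 \<and> y ** x = mat 1"
      using m mult[of m "inv\<^bsub>M\<^esub> m"] mult[of "inv\<^bsub>M\<^esub> m" m] one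
      by (intro bexI[of _ "\<phi> (inv\<^bsub>M\<^esub> m)"] conjI) simp_all
    fix y assume "y \<in> \<phi> ` carrier M"
    then obtain m' where m': "m' \<in> carrier M" "y = \<phi> m'" by blast
    show "x ** y \<in> \<phi> ` carrier M"
      unfolding m(2) m'(2) mult[OF m(1) m'(1), symmetric] using m(1) m'(1) by (intro imageI m_closed)
  qed (use M in simp)
  have "\<phi> \<in> iso M ((GL KK)\<lparr>carrier := \<phi> ` carrier M\<rparr>)"
  proof (rule isoI)
    show "\<phi> \<in> hom M ((GL KK)\<lparr>carrier := \<phi> ` carrier M\<rparr>)"
      by (rule homI) (simp_all add: mult_GL mult)
    show "bij_betw \<phi> (carrier M) (carrier ((GL KK)\<lparr>carrier := \<phi> ` carrier M\<rparr>))"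
      using inj by (simp add: bij_betw_def)
  qed
  then have "M \<cong> (GL KK)\<lparr>carrier := \<phi> ` carrier M\<rparr>" by (rule is_isoI)
  then show "(GL KK)\<lparr>carrier := \<phi> ` carrier M\<rparr> \<cong> M" by (rule iso_sym)
  show "card (\<phi> ` carrier M) = card (carrier M)" using inj by (rule card_image)
qed

lemma twisted_model:
  assumes M: "sl2_model M f" and e: "\<And>x. x \<in> carrier M \<Longrightarrow> e x = 1 \<or> e x = -1" "e \<one>\<^bsub>M\<^esub> = 1"
    "\<And>x y. x \<in> carrier M \<Longrightarrow> y \<in> carrier M \<Longrightarrow> e (x \<otimes>\<^bsub>M\<^esub> y) = e x * e y"
  shows "KK_group (twisted e f ` carrier M)" "(GL KK)\<lparr>carrier := twisted e f ` carrier M\<rparr> \<cong> M"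
    "card (twisted e f ` carrier M) = card (carrier M)"
proof -
  have gM: "group M" "finite (carrier M)" using M by (auto simp: sl2_model_def)
  have inj: "inj_on (twisted e f) (carrier M)"
    using M by (simp add: inj_on_def sl2_model_def twisted_def)
  have one: "twisted e f \<one>\<^bsub>M\<^esub> = mat 1" using M e(2) by (simp add: sl2_model_def twisted_def blk_1)
  have mult: "twisted e f (x \<otimes>\<^bsub>M\<^esub> y) = twisted e f x ** twisted e f y" if "x \<in> carrier M" "y \<in> carrier M" for x y
    using M e(3)[OF that] that by (simp add: sl2_model_def twisted_def blk_mult)
  have ent: "entries_in KK (twisted e f x)" if "x \<in> carrier M" for x
  proof -
    have "e x \<in> KK" using e(1)[OF that] by auto
    then show ?thesis using M that by (simp add: twisted_def entries_in_blk sl2_model_def)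
  qed
  from model_group[OF gM inj one mult ent]
  show "KK_group (twisted e f ` carrier M)" "(GL KK)\<lparr>carrier := twisted e f ` carrier M\<rparr> \<cong> M"
    "card (twisted e f ` carrier M) = card (carrier M)" by simp_all
qed

lemma carrier_C2: "carrier (integer_mod_group 2) = {0, 1}"
  by (auto simp: carrier_integer_mod_group)

lemma doubled_model:
  assumes M: "sl2_model M f"
  shows "KK_group (doubled f ` ({0, 1} \<times> carrier M))"
    "(GL KK)\<lparr>carrier := doubled f ` ({0, 1} \<times> carrier M)\<rparr> \<cong> integer_mod_group 2 \<times>\<times> M"
    "card (doubled f ` ({0, 1} \<times> carrier M)) = 2 * card (carrier M)"
proof -
  define C where "C = integer_mod_group 2 \<times>\<times> M"
  have carC: "carrier C = {0, 1} \<times> carrier M" by (simp add: C_def carrier_C2)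
  have "group M" using M by (simp add: sl2_model_def)
  then have C: "group C" unfolding C_def by (intro DirProd_group) simp_all
  have fin: "finite (carrier C)" unfolding carC using M by (simp add: sl2_model_def)
  have inj: "inj_on (doubled f) (carrier C)"
    unfolding carC using M by (auto simp: inj_on_def sl2_model_def doubled_def)
  have one: "doubled f \<one>\<^bsub>C\<^esub> = mat 1" using M by (simp add: C_def doubled_def sl2_model_def blk_1)
  have mult: "doubled f (x \<otimes>\<^bsub>C\<^esub> y) = doubled f x ** doubled f y" if "x \<in> carrier C" "y \<in> carrier C" for x y
  proof -
    obtain k m k' m' where xy: "x = (k, m)" "y = (k', m')" by (metis surj_pair)
    have "k \<in> {0, 1}" "k' \<in> {0, 1}" "m \<in> carrier M" "m' \<in> carrier M" using that by (auto simp: carC xy)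
    then show ?thesis using M by (auto simp: C_def xy doubled_def blk_mult sl2_model_def)
  qed
  have ent: "entries_in KK (doubled f x)" if "x \<in> carrier C" for x
    using that M unfolding carC by (auto simp: doubled_def entries_in_blk sl2_model_def)
  from model_group[OF C fin inj one mult ent]
  show "KK_group (doubled f ` ({0, 1} \<times> carrier M))"
    "(GL KK)\<lparr>carrier := doubled f ` ({0, 1} \<times> carrier M)\<rparr> \<cong> integer_mod_group 2 \<times>\<times> M"
    "card (doubled f ` ({0, 1} \<times> carrier M)) = 2 * card (carrier M)"
    using M by (simp_all add: carC flip: C_def) (simp add: card_cartesian_product)
qed

lemma sl2_model_Q8: "sl2_model Q8 fQ"
  unfolding sl2_model_def
proof (intro conjI ballI)
  show "inj_on fQ (carrier Q8)" by (simp add: inj_on_def fQ_inj)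
  show "fQ (x \<otimes>\<^bsub>Q8\<^esub> y) = fQ x ** fQ y" for x y by (simp add: Q8_def fQ_mult)
  show "entries_in KK (fQ x)" for x by (cases x) (auto intro!: QM_KK)
  show "det (fQ x) = 1" if "x \<in> carrier Q8" for x using that by (auto simp: Q8_def det_QM)
qed (rule group_Q8, simp_all add: Q8_def QM_1)

lemma sl2_model_hurwitz: "sl2_model hurwitz_group fT"
  unfolding sl2_model_def
proof (intro conjI ballI)
  show "inj_on fT (carrier hurwitz_group)" by (simp add: inj_on_def fT_inj)
  show "fT (x \<otimes>\<^bsub>hurwitz_group\<^esub> y) = fT x ** fT y"
    if "x \<in> carrier hurwitz_group" "y \<in> carrier hurwitz_group" for x y
    using that by (simp add: hurwitz_group_def fT_mult)
  show "entries_in KK (fT x)" for x by (cases x) (auto intro!: QM_KK)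
  show "det (fT x) = 1" if "x \<in> carrier hurwitz_group" for x
    using that by (simp add: hurwitz_group_def det_fT)
  show "finite (carrier hurwitz_group)"
    by (simp add: hurwitz_group_def hurwitz_eq hurwitz_even_def hurwitz_odd_def signs_def)
qed (rule group_hurwitz, simp_all add: hurwitz_group_def QM_1)

lemma sl2_model_dicyclic: "sl2_model C3_sdp_C4 fD"
  unfolding sl2_model_def
proof (intro conjI ballI)
  have rs: "entries_in KK rD" "entries_in KK sD"
    using pq_KK by (auto simp: entries_in_def forall_2 companion_def partner_def)
  have one: "entries_in KK (mat 1 :: complex^2^2)" by (auto simp: entries_in_def mat_def)
  have neg: "entries_in KK (- x)" if "entries_in KK x" for x :: "complex^2^2"
    using that by (simp add: entries_in_def)
  have "entries_in KK (powr3 n)" for n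
    using one rs(1) entries_in_KK_mult[OF rs(1) rs(1)] by (simp add: powr3_def)
  moreover have "entries_in KK (powr4 n)" for n
    using one neg[OF one] rs(2) neg[OF rs(2)] by (simp add: powr4_def)
  ultimately show "entries_in KK (fD x)" for x
    unfolding fD_def by (rule entries_in_KK_mult)
  have "det (- x) = det x" for x :: "complex^2^2" by (simp add: det_2)
  then show "det (fD x) = 1" for x
    unfolding fD_def powr3_def powr4_def by (simp add: det_mul dicyclic_relations)
  show "fD \<one>\<^bsub>C3_sdp_C4\<^esub> = mat 1"
    by (simp add: C3_sdp_C4_def semidirect_prod_def) (simp add: fD_def powr3_def powr4_def)
  show "finite (carrier C3_sdp_C4)" by (simp add: carrier_C3_sdp_C4)
qed (rule group_C3_sdp_C4 fD_inj fD_mult, assumption?)+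

section \<open>Conjugacy classes\<close>

lemma card_hurwitz: "card hurwitz = 24"
proof -
  have "hurwitz_even \<inter> hurwitz_odd = {}" by (auto simp: hurwitz_even_def hurwitz_odd_def signs_def)
  moreover have "card hurwitz_even = 8" "card hurwitz_odd = 16"
    by (simp_all add: hurwitz_even_def hurwitz_odd_def signs_def card_cartesian_product)
  moreover have "finite hurwitz_even" "finite hurwitz_odd"
    by (simp_all add: hurwitz_even_def hurwitz_odd_def signs_def)
  ultimately show ?thesis unfolding hurwitz_eq by (simp add: card_Un_disjoint)
qed

lemma hurwitz_carrier: "hurwitz = carrier hurwitz_group"
  by (simp add: hurwitz_group_def)

lemma card_Q8: "card (carrier Q8) = 8"
  by (simp add: Q8_def)

lemma card_C3_sdp_C4: "card (carrier C3_sdp_C4) = 12"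
  by (simp add: carrier_C3_sdp_C4 card_cartesian_product)

lemma signQ_model:
  "signQ x = 1 \<or> signQ x = -1" "signQ \<one>\<^bsub>Q8\<^esub> = 1"
  "x \<in> carrier Q8 \<Longrightarrow> y \<in> carrier Q8 \<Longrightarrow> signQ (x \<otimes>\<^bsub>Q8\<^esub> y) = signQ x * signQ y"
proof -
  show "signQ x = 1 \<or> signQ x = -1" by (cases x) simp
  show "signQ \<one>\<^bsub>Q8\<^esub> = 1" by (simp add: Q8_def)
  show "x \<in> carrier Q8 \<Longrightarrow> y \<in> carrier Q8 \<Longrightarrow> signQ (x \<otimes>\<^bsub>Q8\<^esub> y) = signQ x * signQ y"
    unfolding Q8_def by (simp, elim disjE; simp)
qed

lemma signD_model:
  "signD x = 1 \<or> signD x = -1" "signD \<one>\<^bsub>C3_sdp_C4\<^esub> = 1"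
  "x \<in> carrier C3_sdp_C4 \<Longrightarrow> y \<in> carrier C3_sdp_C4 \<Longrightarrow> signD (x \<otimes>\<^bsub>C3_sdp_C4\<^esub> y) = signD x * signD y"
proof -
  show "signD x = 1 \<or> signD x = -1" by (simp add: signD_def)
  show "signD \<one>\<^bsub>C3_sdp_C4\<^esub> = 1" by (simp add: signD_def C3_sdp_C4_def semidirect_prod_def)
  assume xy: "x \<in> carrier C3_sdp_C4" "y \<in> carrier C3_sdp_C4"
  have "even (k mod 4) \<longleftrightarrow> even k" for k :: int by presburger
  then show "signD (x \<otimes>\<^bsub>C3_sdp_C4\<^esub> y) = signD x * signD y"
    unfolding mult_C3_sdp_C4[OF xy] by (simp add: signD_def)
qed

lemmas twisted_Q8 = twisted_model[OF sl2_model_Q8, of "\<lambda>_. 1", simplified] twisted_model[OF sl2_model_Q8 signQ_model]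
lemmas twisted_dicyclic = twisted_model[OF sl2_model_dicyclic, of "\<lambda>_. 1", simplified]
  twisted_model[OF sl2_model_dicyclic signD_model]
lemmas twisted_hurwitz = twisted_model[OF sl2_model_hurwitz, of "\<lambda>_. 1", simplified, folded hurwitz_carrier]
lemmas doubled_models = doubled_model[OF sl2_model_Q8] doubled_model[OF sl2_model_dicyclic]
  doubled_model[OF sl2_model_hurwitz, folded hurwitz_carrier]

lemma standard_groups_KK_group: "T \<in> set standard_groups \<Longrightarrow> KK_group T"
  using twisted_Q8 twisted_dicyclic twisted_hurwitz doubled_models by (auto simp: standard_groups_def)

lemma standard_groups_types:
  "list_all2 (\<lambda>P T. P ((GL KK)\<lparr>carrier := T\<rparr>))
     [\<lambda>A. A \<cong> Q8, \<lambda>A. A \<cong> Q8, \<lambda>A. A \<cong> C3_sdp_C4, \<lambda>A. A \<cong> C3_sdp_C4,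
      \<lambda>A. A \<cong> integer_mod_group 2 \<times>\<times> Q8, \<lambda>A. A \<cong> integer_mod_group 2 \<times>\<times> C3_sdp_C4,
      \<lambda>A. A \<cong> SL_2_3, \<lambda>A. A \<cong> integer_mod_group 2 \<times>\<times> SL_2_3] standard_groups"
proof -
  have 1: "(GL KK)\<lparr>carrier := twisted (\<lambda>_. 1) fT ` hurwitz\<rparr> \<cong> SL_2_3"
    using iso_trans[OF twisted_hurwitz(2) SL_2_3_iso] .
  interpret C2: group "integer_mod_group 2" by simp
  have "integer_mod_group 2 \<cong> integer_mod_group 2" by (rule iso_refl)
  then have "integer_mod_group 2 \<times>\<times> hurwitz_group \<cong> integer_mod_group 2 \<times>\<times> SL_2_3"
    using SL_2_3_iso by (rule C2.DirProd_iso_trans)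
  then have 2: "(GL KK)\<lparr>carrier := doubled fT ` ({0, 1} \<times> hurwitz)\<rparr> \<cong> integer_mod_group 2 \<times>\<times> SL_2_3"
    using iso_trans[OF doubled_models(8)] by blast
  show ?thesis
    unfolding standard_groups_def
    by (simp only: list_all2_Cons list_all2_Nil 1 2 twisted_Q8 twisted_dicyclic doubled_models simp_thms)
qed

lemma det_twisted: "det (twisted e f x) = e x * det (f x)"
  by (simp add: twisted_def det_blk)

text \<open>Both invariants are constant on conjugacy classes; the orders 8, 12 and 24 occur twice
  each and are separated by the determinant condition.\<close>

lemma standard_groups_invariants:
  "map (\<lambda>T. (card T, \<forall>x\<in>T. det x = 1)) standard_groups =
    [(8, True), (8, False), (12, True), (12, False), (16, False), (24, False), (24, True), (48, False)]"
proof -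
  have one: "\<forall>x\<in>twisted (\<lambda>_. 1) f ` carrier M. det x = 1" if "sl2_model M f" for M :: "('a, 'b) monoid_scheme" and f
    using that by (auto simp: det_twisted sl2_model_def)
  have two: "\<not> (\<forall>x\<in>doubled f ` ({0, 1} \<times> carrier M). det x = 1)" if "sl2_model M f" for M :: "('a, 'b) monoid_scheme" and f
  proof -
    interpret group M using that by (simp add: sl2_model_def)
    have "doubled f (1, \<one>\<^bsub>M\<^esub>) \<in> doubled f ` ({0, 1} \<times> carrier M)" by (intro imageI) simp
    moreover have "det (doubled f (1, \<one>\<^bsub>M\<^esub>)) = -1"
      using that by (simp add: doubled_def det_blk sl2_model_def)
    ultimately show ?thesis by force
  qed
  have Q: "\<not> (\<forall>x\<in>twisted signQ fQ ` carrier Q8. det x = 1)"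
  proof -
    have "(0, 0, 1, 0) \<in> carrier Q8" by (simp add: Q8_def)
    moreover have "det (twisted signQ fQ (0, 0, 1, 0)) = -1" by (simp add: det_twisted det_QM)
    ultimately show ?thesis by force
  qed
  have D: "\<not> (\<forall>x\<in>twisted signD fD ` carrier C3_sdp_C4. det x = 1)"
  proof -
    have "(0, 1) \<in> carrier C3_sdp_C4" by (simp add: carrier_C3_sdp_C4)
    moreover have "det (twisted signD fD (0, 1)) = -1"
      by (simp add: det_twisted signD_def fD_def powr3_def powr4_def dicyclic_relations)
    ultimately show ?thesis by force
  qed
  show ?thesis
    unfolding standard_groups_def list.map
    using one[OF sl2_model_Q8] one[OF sl2_model_dicyclic] one[OF sl2_model_hurwitz, folded hurwitz_carrier]
      two[OF sl2_model_Q8] two[OF sl2_model_dicyclic] two[OF sl2_model_hurwitz, folded hurwitz_carrier] Q D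
    by (simp only: twisted_Q8 twisted_dicyclic twisted_hurwitz doubled_models card_Q8 card_C3_sdp_C4 card_hurwitz
       simp_thms) simp
qed

lemma twisted_not_rationalizable:
  assumes "KK_group (twisted e f ` S)" "(u, p, q) \<in> standard_params"
    and "x \<in> S" "f x = companion u" "e x = 1" "y \<in> S" "f y = partner u p q"
  shows "\<not> rationalizable (twisted e f ` S)"
proof (rule not_rationalizable[OF assms(1,2)])
  show "blk 1 (companion u) \<in> twisted e f ` S" "blk (e y) (partner u p q) \<in> twisted e f ` S"
    using assms by (auto simp: twisted_def intro: rev_image_eqI)
qed

lemma doubled_not_rationalizable:
  assumes "KK_group (doubled f ` ({0, 1} \<times> S))" "(u, p, q) \<in> standard_params"
    and "x \<in> S" "f x = companion u" "y \<in> S" "f y = partner u p q"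
  shows "\<not> rationalizable (doubled f ` ({0, 1} \<times> S))"
proof (rule not_rationalizable[OF assms(1,2)])
  show "blk 1 (companion u) \<in> doubled f ` ({0, 1} \<times> S)"
    using assms by (intro image_eqI[of _ _ "(0, x)"]) (auto simp: doubled_def)
  show "blk 1 (partner u p q) \<in> doubled f ` ({0, 1} \<times> S)"
    using assms by (intro image_eqI[of _ _ "(0, y)"]) (auto simp: doubled_def)
qed

lemma standard_groups_nonrational:
  assumes T: "T \<in> set standard_groups" shows "\<not> rationalizable T"
proof -
  note G = standard_groups_KK_group[OF T]
  have Q: "(0, pQ, qQ) \<in> standard_params" and D: "(-1, pD, qD) \<in> standard_params"
    by (simp_all add: standard_params_def)
  have q: "(0, 1, 0, 0) \<in> carrier Q8" "fQ (0, 1, 0, 0) = companion 0"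
      "(0, 0, 1, 0) \<in> carrier Q8" "fQ (0, 0, 1, 0) = partner 0 pQ qQ"
      "(0, 2, 0, 0) \<in> hurwitz" "fT (0, 2, 0, 0) = companion 0"
      "(0, 0, 2, 0) \<in> hurwitz" "fT (0, 0, 2, 0) = partner 0 pQ qQ"
    by (simp_all add: Q8_def hurwitz_def companion_QM partner_QM)
  have d: "(1, 0) \<in> carrier C3_sdp_C4" "fD (1, 0) = rD" "(0, 1) \<in> carrier C3_sdp_C4" "fD (0, 1) = sD"
    by (simp_all add: carrier_C3_sdp_C4) (simp_all add: fD_def powr3_def powr4_def)
  have e: "signQ (0, 1, 0, 0) = 1" "signD (1, 0) = 1" by (simp_all add: signD_def)
  consider "T = twisted (\<lambda>_. 1) fQ ` carrier Q8" | "T = twisted signQ fQ ` carrier Q8"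
    | "T = twisted (\<lambda>_. 1) fD ` carrier C3_sdp_C4" | "T = twisted signD fD ` carrier C3_sdp_C4"
    | "T = doubled fQ ` ({0, 1} \<times> carrier Q8)" | "T = doubled fD ` ({0, 1} \<times> carrier C3_sdp_C4)"
    | "T = twisted (\<lambda>_. 1) fT ` hurwitz" | "T = doubled fT ` ({0, 1} \<times> hurwitz)"
    using T unfolding standard_groups_def list.set insert_iff empty_iff simp_thms by (elim disjE)
  then show ?thesis
  proof cases
    case 1
    show ?thesis
      unfolding 1 by (rule twisted_not_rationalizable[OF G[unfolded 1] Q, where x = "(0, 1, 0, 0)" and y = "(0, 0, 1, 0)"]) (rule q d e refl)+
  next
    case 2
    show ?thesis
      unfolding 2 by (rule twisted_not_rationalizable[OF G[unfolded 2] Q, where x = "(0, 1, 0, 0)" and y = "(0, 0, 1, 0)"]) (rule q d e refl)+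
  next
    case 3
    show ?thesis
      unfolding 3 by (rule twisted_not_rationalizable[OF G[unfolded 3] D, where x = "(1, 0)" and y = "(0, 1)"]) (rule q d e refl)+
  next
    case 4
    show ?thesis
      unfolding 4 by (rule twisted_not_rationalizable[OF G[unfolded 4] D, where x = "(1, 0)" and y = "(0, 1)"]) (rule q d e refl)+
  next
    case 5
    show ?thesis
      unfolding 5 by (rule doubled_not_rationalizable[OF G[unfolded 5] Q, where x = "(0, 1, 0, 0)" and y = "(0, 0, 1, 0)"]) (rule q d e refl)+
  next
    case 6
    show ?thesis
      unfolding 6 by (rule doubled_not_rationalizable[OF G[unfolded 6] D, where x = "(1, 0)" and y = "(0, 1)"]) (rule q d e refl)+
  next
    case 7
    show ?thesis
      unfolding 7 by (rule twisted_not_rationalizable[OF G[unfolded 7] Q, where x = "(0, 2, 0, 0)" and y = "(0, 0, 2, 0)"]) (rule q d e refl)+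
  next
    case 8
    show ?thesis
      unfolding 8 by (rule doubled_not_rationalizable[OF G[unfolded 8] Q, where x = "(0, 2, 0, 0)" and y = "(0, 0, 2, 0)"]) (rule q d e refl)+
  qed
qed

section \<open>Subgroups of the general linear group\<close>

lemma carrier_GL: "A \<in> carrier (GL F) \<longleftrightarrow>
    entries_in F A \<and> (\<exists>B. entries_in F B \<and> B ** A = mat 1 \<and> A ** B = mat 1)"
  by (auto simp: GL_def units_of_def Units_def mat_monoid_def entries_in_def)

lemma group_GL_Rats: "group (GL (\<rat> :: complex set) :: (complex^3^3) monoid)"
  unfolding GL_def by (intro monoid.units_group monoid_mat_monoid) auto

lemma inv_GL:
  fixes P Q :: "complex^3^3"
  assumes "group (GL F :: (complex^3^3) monoid)" "entries_in F P" "entries_in F Q" "P ** Q = mat 1" "Q ** P = mat 1"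
  shows "inv\<^bsub>GL F\<^esub> P = Q"
  using assms by (intro group.inv_equality) (auto simp: mult_GL carrier_GL)

lemma subgroup_GL_iff: "subgroup H (GL KK) \<and> finite H \<longleftrightarrow> KK_group H"
proof
  assume H: "subgroup H (GL KK) \<and> finite H"
  then interpret subgroup H "GL KK" by simp
  interpret GL: group "GL KK :: (complex^3^3) monoid" by (rule group_GL_quadratic_field)
  have one: "mat 1 \<in> H" using one_closed by (simp add: mult_GL)
  show "KK_group H"
    unfolding KK_group_def
  proof (intro conjI ballI)
    fix x assume x: "x \<in> H"
    then show "entries_in KK x" using mem_carrier carrier_GL by blast
    show "\<exists>y\<in>H. x ** y = mat 1 \<and> y ** x = mat 1"
      using m_inv_closed[OF x] GL.r_inv[OF mem_carrier[OF x]] GL.l_inv[OF mem_carrier[OF x]]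
      by (auto simp: mult_GL)
    fix y assume "y \<in> H"
    from m_closed[OF x this] show "x ** y \<in> H" by (simp add: mult_GL)
  qed (use H one in auto)
next
  assume H: "KK_group H"
  have carr: "x \<in> carrier (GL KK)" if "x \<in> H" for x
    using H that unfolding KK_group_def carrier_GL by metis
  have "subgroup H (GL KK)"
  proof
    show "H \<subseteq> carrier (GL KK)" using carr by blast
    show "x \<otimes>\<^bsub>GL KK\<^esub> y \<in> H" if "x \<in> H" "y \<in> H" for x y
      using H that by (simp add: KK_group_def mult_GL)
    show "\<one>\<^bsub>GL KK\<^esub> \<in> H" using H by (simp add: KK_group_def mult_GL)
    show "inv\<^bsub>GL KK\<^esub> x \<in> H" if x: "x \<in> H" for x
    proof -
      obtain y where y: "y \<in> H" "x ** y = mat 1" "y ** x = mat 1" using H x by (auto simp: KK_group_def)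
      have "inv\<^bsub>GL KK\<^esub> x = y"
        using H x y by (intro inv_GL group_GL_quadratic_field) (auto simp: KK_group_def)
      then show ?thesis using y(1) by simp
    qed
  qed
  then show "subgroup H (GL KK) \<and> finite H" using H by (simp add: KK_group_def)
qed

lemma conjugate_in_iff:
  "conjugate_in (GL KK) H H' \<longleftrightarrow> (\<exists>P Q. KK_inverses P Q \<and> H' = conj_by P Q H)"
proof -
  have eq: "g <#\<^bsub>GL KK\<^esub> (H #>\<^bsub>GL KK\<^esub> h) = conj_by h g H" for g h
    by (auto simp: l_coset_def r_coset_def conj_by_def mult_GL matrix_mul_assoc)
  show ?thesis
  proof
    assume "conjugate_in (GL KK) H H'"
    then obtain g where g: "g \<in> carrier (GL KK)" "H' = conj_by (inv\<^bsub>GL KK\<^esub> g) g H"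
      unfolding conjugate_in_def eq by blast
    obtain h where h: "entries_in KK g" "entries_in KK h" "h ** g = mat 1" "g ** h = mat 1"
      using g(1) unfolding carrier_GL by blast
    have "inv\<^bsub>GL KK\<^esub> g = h" by (rule inv_GL[OF group_GL_quadratic_field h(1,2,4,3)])
    then show "\<exists>P Q. KK_inverses P Q \<and> H' = conj_by P Q H"
      using g(2) h unfolding KK_inverses_def by blast
  next
    assume "\<exists>P Q. KK_inverses P Q \<and> H' = conj_by P Q H"
    then obtain P Q where PQ: "KK_inverses P Q" "H' = conj_by P Q H" by blast
    then have e: "entries_in KK Q" "entries_in KK P" "Q ** P = mat 1" "P ** Q = mat 1"
      by (auto simp: KK_inverses_def)
    have "inv\<^bsub>GL KK\<^esub> Q = P" by (rule inv_GL[OF group_GL_quadratic_field e])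
    moreover have "Q \<in> carrier (GL KK)" using e unfolding carrier_GL by blast
    ultimately show "conjugate_in (GL KK) H H'"
      unfolding conjugate_in_def eq using PQ(2) by auto
  qed
qed

text \<open>The inverse of a conjugated element lies in the conjugated group, so the entries of both
  are rational and the group sits in the units over the rationals.\<close>

lemma rationalizable_iff:
  assumes H: "KK_group H"
  shows "(\<exists>H'. subgroup H' (GL \<rat>) \<and> conjugate_in (GL KK) H H') \<longleftrightarrow> rationalizable H"
proof
  assume "\<exists>H'. subgroup H' (GL \<rat>) \<and> conjugate_in (GL KK) H H'"
  then obtain P Q where PQ: "KK_inverses P Q" "subgroup (conj_by P Q H) (GL \<rat>)"
    unfolding conjugate_in_iff by blast
  have "entries_in \<rat> (Q ** x ** P)" if "x \<in> H" for x
    using subgroup.mem_carrier[OF PQ(2) conj_byI[OF that]] unfolding carrier_GL by blast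
  then show "rationalizable H" using PQ(1) unfolding rationalizable_def by blast
next
  assume "rationalizable H"
  then obtain P Q where PQ: "KK_inverses P Q" "\<And>x. x \<in> H \<Longrightarrow> entries_in \<rat> (Q ** x ** P)"
    unfolding rationalizable_def by blast
  define H' where "H' = conj_by P Q H"
  have H': "KK_group H'" unfolding H'_def by (rule KK_group_conj_by[OF H PQ(1)])
  have rat: "entries_in \<rat> x" if "x \<in> H'" for x using that PQ(2) by (auto simp: H'_def conj_by_def)
  have "subgroup H' (GL \<rat>)"
  proof
    show "H' \<subseteq> carrier (GL \<rat>)"
      using H' rat unfolding KK_group_def carrier_GL by (metis subsetI carrier_GL)
    show "x \<otimes>\<^bsub>GL \<rat>\<^esub> y \<in> H'" if "x \<in> H'" "y \<in> H'" for x y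
      using H' that by (simp add: KK_group_def mult_GL)
    show "\<one>\<^bsub>GL \<rat>\<^esub> \<in> H'" using H' by (simp add: KK_group_def mult_GL)
    show "inv\<^bsub>GL \<rat>\<^esub> x \<in> H'" if x: "x \<in> H'" for x
    proof -
      obtain y where y: "y \<in> H'" "x ** y = mat 1" "y ** x = mat 1" using H' x by (auto simp: KK_group_def)
      have "inv\<^bsub>GL \<rat>\<^esub> x = y" by (rule inv_GL[OF group_GL_Rats rat[OF x] rat[OF y(1)] y(2,3)])
      then show ?thesis using y(1) by simp
    qed
  qed
  then show "\<exists>H'. subgroup H' (GL \<rat>) \<and> conjugate_in (GL KK) H H'"
    unfolding conjugate_in_iff using PQ(1) H'_def by blast
qed

lemma finite_subgroups_not_over_Q_iff:
  "H \<in> finite_subgroups_not_over_Q KK \<longleftrightarrow> KK_group H \<and> \<not> rationalizable H"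
  unfolding finite_subgroups_not_over_Q_def using subgroup_GL_iff[of H] rationalizable_iff[of H] by blast

lemma inj_on_conj:
  assumes PQ: "KK_inverses P Q"
  shows "inj_on (\<lambda>x. Q ** x ** P) H"
proof (rule inj_onI)
  fix x y assume "Q ** x ** P = Q ** y ** P"
  then have "P ** (Q ** x ** P) ** Q = P ** (Q ** y ** P) ** Q" by simp
  then show "x = y" by (simp add: matrix_mul_assoc KK_inverses_cancel[OF PQ]) (use PQ in \<open>simp add: KK_inverses_def\<close>)
qed

lemma conj_by_iso:
  assumes PQ: "KK_inverses P Q" and H: "KK_group H"
  shows "(GL KK)\<lparr>carrier := H\<rparr> \<cong> (GL KK)\<lparr>carrier := conj_by P Q H\<rparr>"
proof (rule is_isoI, rule isoI)
  show "(\<lambda>x. Q ** x ** P) \<in> hom ((GL KK)\<lparr>carrier := H\<rparr>) ((GL KK)\<lparr>carrier := conj_by P Q H\<rparr>)"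
    by (rule homI) (simp_all add: conj_byI mult_GL conj_mult[OF PQ])
  show "bij_betw (\<lambda>x. Q ** x ** P) (carrier ((GL KK)\<lparr>carrier := H\<rparr>)) (carrier ((GL KK)\<lparr>carrier := conj_by P Q H\<rparr>))"
    using inj_on_conj[OF PQ] by (simp add: bij_betw_def conj_by_def)
qed

lemma conj_by_invariants:
  assumes PQ: "KK_inverses P Q"
  shows "card (conj_by P Q H) = card H" "(\<forall>x\<in>conj_by P Q H. det x = 1) \<longleftrightarrow> (\<forall>x\<in>H. det x = 1)"
proof -
  show "card (conj_by P Q H) = card H" unfolding conj_by_def by (rule card_image[OF inj_on_conj[OF PQ]])
  show "(\<forall>x\<in>conj_by P Q H. det x = 1) \<longleftrightarrow> (\<forall>x\<in>H. det x = 1)"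
    by (simp add: conj_by_def det_conj[OF PQ])
qed

lemma equiv_conjugate:
  fixes S :: "(complex^3^3) set set"
  shows "equiv S {(H, H'). H \<in> S \<and> H' \<in> S \<and> conjugate_in (GL KK) H H'}"
proof (rule equivI)
  show "{(H, H'). H \<in> S \<and> H' \<in> S \<and> conjugate_in (GL KK) H H'} \<subseteq> S \<times> S" by auto
  have "conj_by (mat 1) (mat 1) H = H" for H by (simp add: conj_by_def)
  moreover have "KK_inverses (mat 1) (mat 1)" by (simp add: KK_inverses_def)
  ultimately have "conjugate_in (GL KK) H H" for H :: "(complex^3^3) set" unfolding conjugate_in_iff by metis
  then show "refl_on S {(H, H'). H \<in> S \<and> H' \<in> S \<and> conjugate_in (GL KK) H H'}"
    by (auto simp: refl_on_def)
  have "conjugate_in (GL KK) H' H" if c: "conjugate_in (GL KK) H H'" for H H' :: "(complex^3^3) set"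
  proof -
    obtain P Q where PQ: "KK_inverses P Q" "H' = conj_by P Q H" using c unfolding conjugate_in_iff by blast
    then have "KK_inverses Q P" "H = conj_by Q P H'" by (simp_all add: KK_inverses_sym conj_by_inverse)
    then show ?thesis unfolding conjugate_in_iff by blast
  qed
  then show "sym {(H, H'). H \<in> S \<and> H' \<in> S \<and> conjugate_in (GL KK) H H'}" by (auto simp: sym_def)
  have "conjugate_in (GL KK) H H''" if c: "conjugate_in (GL KK) H H'" "conjugate_in (GL KK) H' H''"
    for H H' H'' :: "(complex^3^3) set"
  proof -
    obtain P Q where PQ: "KK_inverses P Q" "H' = conj_by P Q H" using c(1) unfolding conjugate_in_iff by blast
    obtain P' Q' where PQ': "KK_inverses P' Q'" "H'' = conj_by P' Q' H'" using c(2) unfolding conjugate_in_iff by blast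
    have "KK_inverses (P ** P') (Q' ** Q)" "H'' = conj_by (P ** P') (Q' ** Q) H"
      using KK_inverses_mult[OF PQ(1) PQ'(1)] PQ(2) PQ'(2) by (simp_all add: conj_by_conj_by)
    then show ?thesis unfolding conjugate_in_iff by blast
  qed
  then show "trans {(H, H'). H \<in> S \<and> H' \<in> S \<and> conjugate_in (GL KK) H H'}"
    unfolding trans_def by blast
qed

section \<open>The main theorem\<close>

theorem mainTheorem3:
  fixes K :: "complex set" and G :: "(complex^3^3) monoid"
    and Cl :: "(complex^3^3) set set set"
  assumes "K = quadratic_field (-19)"
    and "G = GL K"
    and "Cl = conjugacy_classes_in G (finite_subgroups_not_over_Q K)"
  shows "card Cl = 8 \<and>
    (\<exists>Cs. distinct Cs \<and> set Cs = Cl \<and>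
      list_all2 (\<lambda>has_type cl. \<forall>H\<in>cl. has_type (G\<lparr>carrier := H\<rparr>))
        [\<lambda>A. A \<cong> Q8,
         \<lambda>A. A \<cong> Q8,
         \<lambda>A. A \<cong> C3_sdp_C4,
         \<lambda>A. A \<cong> C3_sdp_C4,
         \<lambda>A. A \<cong> integer_mod_group 2 \<times>\<times> Q8,
         \<lambda>A. A \<cong> integer_mod_group 2 \<times>\<times> C3_sdp_C4,
         \<lambda>A. A \<cong> SL_2_3,
         \<lambda>A. A \<cong> integer_mod_group 2 \<times>\<times> SL_2_3]
        Cs)"
proof -
  define S :: "(complex^3^3) set set" where "S = finite_subgroups_not_over_Q KK"
  define r where "r = {(H, H'). H \<in> S \<and> H' \<in> S \<and> conjugate_in (GL KK) H H'}"
  have G: "G = GL KK" using assms(1,2) by simp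
  have Cl: "Cl = S // r" using assms unfolding conjugacy_classes_in_def S_def r_def by simp
  have S: "H \<in> S \<longleftrightarrow> KK_group H \<and> \<not> rationalizable H" for H
    unfolding S_def by (rule finite_subgroups_not_over_Q_iff)
  have eq: "equiv S r" unfolding r_def by (rule equiv_conjugate)
  define Cs where "Cs = map (\<lambda>T. r `` {T}) standard_groups"
  have std: "T \<in> S" if "T \<in> set standard_groups" for T
    using that standard_groups_KK_group standard_groups_nonrational S by blast
  have r_conj: "\<exists>P Q. KK_inverses P Q \<and> H' = conj_by P Q H" if "(H, H') \<in> r" for H H'
    using that unfolding r_def conjugate_in_iff by blast
  have set_Cs: "set Cs = Cl"
  proof
    show "set Cs \<subseteq> Cl" unfolding Cl Cs_def using std by (auto intro: quotientI)
    show "Cl \<subseteq> set Cs"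
    proof
      fix cl assume "cl \<in> Cl"
      then obtain H where H: "cl = r `` {H}" "H \<in> S" unfolding Cl by (rule quotientE)
      obtain P Q where PQ: "KK_inverses P Q" "conj_by P Q H \<in> set standard_groups"
        using nonrational_conj_standard H(2) S by metis
      have "conjugate_in (GL KK) H (conj_by P Q H)" using PQ(1) unfolding conjugate_in_iff by blast
      then have "(H, conj_by P Q H) \<in> r" using H(2) std[OF PQ(2)] by (simp add: r_def)
      then have "cl = r `` {conj_by P Q H}" unfolding H(1) by (rule equiv_class_eq[OF eq])
      then show "cl \<in> set Cs" using PQ(2) by (simp add: Cs_def)
    qed
  qed
  define invar where "invar T = (card T, \<forall>x\<in>T. det x = 1)" for T :: "(complex^3^3) set"
  have invar_eq: "invar H = invar H'" if "(H, H') \<in> r" for H H'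
    using r_conj[OF that] conj_by_invariants unfolding invar_def by fastforce
  have "distinct (map invar standard_groups)"
    unfolding invar_def standard_groups_invariants by simp
  then have inj: "distinct standard_groups" "inj_on invar (set standard_groups)"
    by (simp_all add: distinct_map)
  have "inj_on (\<lambda>T. r `` {T}) (set standard_groups)"
  proof (rule inj_onI)
    \<comment> \<open>Equal classes make the two representatives conjugate, and the invariants
      already tell all eight representatives apart.\<close>
    fix T T' assume T: "T \<in> set standard_groups" "T' \<in> set standard_groups" "r `` {T} = r `` {T'}"
    then have "(T, T') \<in> r" using eq_equiv_class[OF _ eq] std by blast
    then show "T = T'" using invar_eq inj(2) T(1,2) by (simp add: inj_on_def)
  qed
  then have dist: "distinct Cs" using inj(1) by (simp add: Cs_def distinct_map)
  have len: "length Cs = 8" by (simp add: Cs_def standard_groups_def)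
  have iso: "(GL KK)\<lparr>carrier := H\<rparr> \<cong> (GL KK)\<lparr>carrier := T\<rparr>" if "H \<in> r `` {T}" for H T
  proof -
    have "(H, T) \<in> r" using that eq by (auto simp: equiv_def sym_def)
    then obtain P Q where PQ: "KK_inverses P Q" "T = conj_by P Q H" using r_conj by blast
    have "KK_group H" using \<open>(H, T) \<in> r\<close> S by (auto simp: r_def)
    then show ?thesis unfolding PQ(2) by (rule conj_by_iso[OF PQ(1)])
  qed
  have "list_all2 (\<lambda>has_type cl. \<forall>H\<in>cl. has_type (G\<lparr>carrier := H\<rparr>))
        [\<lambda>A. A \<cong> Q8,
         \<lambda>A. A \<cong> Q8,
         \<lambda>A. A \<cong> C3_sdp_C4,
         \<lambda>A. A \<cong> C3_sdp_C4,
         \<lambda>A. A \<cong> integer_mod_group 2 \<times>\<times> Q8,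
         \<lambda>A. A \<cong> integer_mod_group 2 \<times>\<times> C3_sdp_C4,
         \<lambda>A. A \<cong> SL_2_3,
         \<lambda>A. A \<cong> integer_mod_group 2 \<times>\<times> SL_2_3]
        Cs"
    using standard_groups_types
    unfolding G Cs_def standard_groups_def list.map list_all2_Cons list_all2_Nil
    by (elim conjE, intro conjI ballI) ((erule iso_trans[OF iso], assumption) | rule refl)+
  moreover have "card Cl = 8" using distinct_card[OF dist] set_Cs len by simp
  ultimately show ?thesis using dist set_Cs by blast
qed

end
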